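(* Let $k,r$ be positive integers satisfying $r\le k$. (1) In the ring $\mathcal{A}_2$, $$\sum_{\boldsymbol{k}\in I_{k,r}}\zeta_{\mathcal{A}_2}(\boldsymbol{k})=(-1)^{r-1}\binom{k}{r}\frac{B_{\boldsymbol{p}-k-1}}{k+1}\boldsymbol{p},\qquad \sum_{\boldsymbol{k}\in I_{k,r}}\zeta^{\star}_{\mathcal{A}_2}(\boldsymbol{k})=\binom{k}{r}\frac{B_{\boldsymbol{p}-k-1}}{k+1}\boldsymbol{p}.$$ (2) If $k$ is odd, then in the ring $\mathcal{A}_3$, $$\sum_{\boldsymbol{k}\in I_{k,r}}\zeta_{\mathcal{A}_3}(\boldsymbol{k})=(-1)^{r}\frac{k+1}{2}\binom{k}{r}\frac{B_{\boldsymbol{p}-k-2}}{k+2}\boldsymbol{p}^2,\qquad \sum_{\boldsymbol{k}\in I_{k,r}}\zeta^{\star}_{\mathcal{A}_3}(\boldsymbol{k})=-\frac{k+1}{2}\binom{k}{r}\frac{B_{\boldsymbol{p}-k-2}}{k+2}\boldsymbol{p}^2.$$ (3) Let $i$ be an integer with $1\le i\le r$, and assume that $k$ is even and $k>r$. Then in the ring $\mathcal{A}_2$, $$\sum_{\boldsymbol{k}\in I_{k,r,i}}\zeta_{\mathcal{A}_2}(\boldsymbol{k})=(-1)^{r-1}\frac{a_{k,r,i}}{2}\cdot\frac{B_{\boldsymbol{p}-k-1}}{k+1}\boldsymbol{p},\qquad \sum_{\boldsymbol{k}\in I_{k,r,i}}\zeta^{\star}_{\mathcal{A}_2}(\boldsymbol{k})=\frac{b_{k,r,i}}{2}\cdot\frac{B_{\boldsymbol{p}-k-1}}{k+1}\boldsymbol{p},$$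 where $$a_{k,r,i}:=\binom{k-1}{r}+(-1)^{r-i}\left\{(k-r)\binom{k}{i-1}+\binom{k-1}{i-1}+(-1)^{r-1}\binom{k-1}{r-i}\right\},$$ $$b_{k,r,i}:=\binom{k-1}{r}+(-1)^{i-1}\left\{(k-r)\binom{k}{r-i}+\binom{k-1}{r-i}+(-1)^{r-1}\binom{k-1}{i-1}\right\}.$$
   Context: For a positive integer $n$, $\mathcal{A}_n$ is the $\mathbb{Q}$-algebra $$\mathcal{A}_n:=\Bigl(\prod_{p\text{ prime}}\mathbb{Z}/p^n\mathbb{Z}\Bigr)\Big/\Bigl(\bigoplus_{p\text{ prime}}\mathbb{Z}/p^n\mathbb{Z}\Bigr).$$ Thus an element of $\mathcal{A}_n$ is represented by a family $(x_p)_p$ with $x_p\in\mathbb{Z}/p^n\mathbb{Z}$, two families being equal when they agree for all but finitely many primes $p$; it suffices to define $x_p$ for all but finitely many $p$. $I_{k,r}$ is the set of all $r$-tuples $\boldsymbol{k}=(k_1,\dots,k_r)$ of positive integers with $k_1+\cdots+k_r=k$, and $I_{k,r,i}:=\{(k_1,\dots,k_r)\in I_{k,r}\mid k_i\ge 2\}$ for $1\le i\le r<k$. For a positive integer $N$ and $\boldsymbol{k}=(k_1,\dots,k_r)$, $$\zeta_N(\boldsymbol{k}):=\sum_{1\le m_1<\cdots<m_r\le N}\frac{1}{m_1^{k_1}\cdots m_r^{k_r}},\qquad \zeta_N^{\star}(\boldsymbol{k}):=\sum_{1\le m_1\le\cdots\le m_r\le N}\frac{1}{m_1^{k_1}\cdots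 m_r^{k_r}}.$$ The $\mathcal{A}_n$-finite multiple zeta values are $\zeta_{\mathcal{A}_n}(\boldsymbol{k}):=(\zeta_{p-1}(\boldsymbol{k})\bmod p^n)_p$ and $\zeta^{\star}_{\mathcal{A}_n}(\boldsymbol{k}):=(\zeta^{\star}_{p-1}(\boldsymbol{k})\bmod p^n)_p$ in $\mathcal{A}_n$. $B_m$ denotes the $m$-th (Seki-)Bernoulli number; $B_{\boldsymbol{p}-m}:=(B_{p-m}\bmod p^n)_p\in\mathcal{A}_n$ (well defined for $m\ge2$, since $B_{p-m}$ is $p$-integral for all sufficiently large $p$); $\boldsymbol{p}:=(p\bmod p^n)_p\in\mathcal{A}_n$. Rational coefficients act through the $\mathbb{Q}$-algebra structure. *)

theory Defs
  imports
    "HOL-Algebra.QuotRing"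
    "HOL-Computational_Algebra.Computational_Algebra"
    "HOL-Number_Theory.Number_Theory"
begin

section \<open>Products of rings and the ring $\mathcal{A}_n$\<close>

definition product_ring :: "'i set \<Rightarrow> ('i \<Rightarrow> ('a, 'm) ring_scheme) \<Rightarrow> ('i \<Rightarrow> 'a) ring" where
  "product_ring I R =
     \<lparr>carrier = (\<Pi>\<^sub>E i\<in>I. carrier (R i)),
      monoid.mult = (\<lambda>x y. \<lambda>i\<in>I. x i \<otimes>\<^bsub>R i\<^esub> y i),
      one = (\<lambda>i\<in>I. \<one>\<^bsub>R i\<^esub>),
      zero = (\<lambda>i\<in>I. \<zero>\<^bsub>R i\<^esub>),
      add = (\<lambda>x y. \<lambda>i\<in>I. x i \<oplus>\<^bsub>R i\<^esub> y i)\<rparr>"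

definition direct_sum_ideal :: "'i set \<Rightarrow> ('i \<Rightarrow> ('a, 'm) ring_scheme) \<Rightarrow> ('i \<Rightarrow> 'a) set" where
  "direct_sum_ideal I R =
     {x \<in> (\<Pi>\<^sub>E i\<in>I. carrier (R i)). finite {i \<in> I. x i \<noteq> \<zero>\<^bsub>R i\<^esub>}}"

abbreviation primes :: "nat set" where
  "primes \<equiv> {p. prime p}"

abbreviation Zpn :: "nat \<Rightarrow> nat \<Rightarrow> int ring" where
  "Zpn n p \<equiv> residue_ring (int p ^ n)"

definition A_ring :: "nat \<Rightarrow> (nat \<Rightarrow> int) set ring" where
  "A_ring n = product_ring primes (Zpn n) Quot direct_sum_ideal primes (Zpn n)"

text \<open>
  \<open>rat_mod m q\<close> is the residue in \<open>{0..<m}\<close> of a rational number \<open>q\<close> whose denominator is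
  coprime to \<open>m\<close>; it is \<open>0\<close> if the denominator is not coprime to \<open>m\<close>.
\<close>
definition rat_mod :: "int \<Rightarrow> rat \<Rightarrow> int" where
  "rat_mod m q = (fst (quotient_of q) * modular_inverse m (snd (quotient_of q))) mod m"

text \<open>
  The element $(x_p \bmod p^n)_p$ of $\mathcal{A}_n$ given by rational numbers $x_p$ that are
  $p$-integral for all but finitely many primes $p$. The finitely many components at which
  \<open>rat_mod\<close> takes its default value do not affect the class.
\<close>
definition A_class :: "nat \<Rightarrow> (nat \<Rightarrow> rat) \<Rightarrow> (nat \<Rightarrow> int) set" where
  "A_class n x =
     direct_sum_ideal primes (Zpn n) +>\<^bsub>product_ring primes (Zpn n)\<^esub>
       (\<lambda>p\<in>primes. rat_mod (int p ^ n) (x p))"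

text \<open>The action of $\mathbb{Q}$ on $\mathcal{A}_n$.\<close>
definition A_scale :: "nat \<Rightarrow> rat \<Rightarrow> (nat \<Rightarrow> int) set \<Rightarrow> (nat \<Rightarrow> int) set" where
  "A_scale n q a = A_class n (\<lambda>p. q) \<otimes>\<^bsub>A_ring n\<^esub> a"

section \<open>Indices and multiple harmonic sums\<close>

text \<open>An index $(k_1,\dots,k_r)$ is a list; $k_i$ is the entry \<open>ks ! (i - 1)\<close>.\<close>

definition indices :: "nat \<Rightarrow> nat \<Rightarrow> nat list set" where
  "indices k r = {ks. length ks = r \<and> (\<forall>x\<in>set ks. 1 \<le> x) \<and> sum_list ks = k}"

definition indices_at :: "nat \<Rightarrow> nat \<Rightarrow> nat \<Rightarrow> nat list set" where
  "indices_at k r i = {ks \<in> indices k r. 2 \<le> ks ! (i - 1)}"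

definition mzeta :: "nat \<Rightarrow> nat list \<Rightarrow> rat" where
  "mzeta N ks =
     (\<Sum>ms\<in>{ms. length ms = length ks \<and> set ms \<subseteq> {1..N} \<and> sorted_wrt (<) ms}.
        1 / (\<Prod>j<length ks. of_nat (ms ! j) ^ (ks ! j)))"

definition mzeta_star :: "nat \<Rightarrow> nat list \<Rightarrow> rat" where
  "mzeta_star N ks =
     (\<Sum>ms\<in>{ms. length ms = length ks \<and> set ms \<subseteq> {1..N} \<and> sorted_wrt (\<le>) ms}.
        1 / (\<Prod>j<length ks. of_nat (ms ! j) ^ (ks ! j)))"

definition zeta_A :: "nat \<Rightarrow> nat list \<Rightarrow> (nat \<Rightarrow> int) set" where
  "zeta_A n ks = A_class n (\<lambda>p. mzeta (p - 1) ks)"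

definition zeta_A_star :: "nat \<Rightarrow> nat list \<Rightarrow> (nat \<Rightarrow> int) set" where
  "zeta_A_star n ks = A_class n (\<lambda>p. mzeta_star (p - 1) ks)"

section \<open>Bernoulli numbers\<close>

text \<open>
  The convention $B_1 = -\frac12$; the choice of sign is immaterial for $B_{\boldsymbol{p}-m}$,
  since $p - m = 1$ for at most one $p$.
\<close>
fun bernoulli :: "nat \<Rightarrow> rat" where
  "bernoulli n = (if n = 0 then 1
     else - (\<Sum>j<n. of_nat (Suc n choose j) * bernoulli j) / of_nat (Suc n))"

declare bernoulli.simps [simp del]

text \<open>The truncated subtraction \<open>p - m\<close> only matters at the finitely many primes \<open>p < m\<close>.\<close>
definition bernoulli_A :: "nat \<Rightarrow> nat \<Rightarrow> (nat \<Rightarrow> int) set" where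
  "bernoulli_A n m = A_class n (\<lambda>p. bernoulli (p - m))"

definition p_A :: "nat \<Rightarrow> (nat \<Rightarrow> int) set" where
  "p_A n = A_class n (\<lambda>p. of_nat p)"

section \<open>The coefficients $a_{k,r,i}$ and $b_{k,r,i}$\<close>

definition a_coeff :: "nat \<Rightarrow> nat \<Rightarrow> nat \<Rightarrow> int" where
  "a_coeff k r i =
     int ((k - 1) choose r)
     + (-1) ^ (r - i) * ((int k - int r) * int (k choose (i - 1))
                         + int ((k - 1) choose (i - 1))
                         + (-1) ^ (r - 1) * int ((k - 1) choose (r - i)))"

definition b_coeff :: "nat \<Rightarrow> nat \<Rightarrow> nat \<Rightarrow> int" where
  "b_coeff k r i =
     int ((k - 1) choose r)
     + (-1) ^ (i - 1) * ((int k - int r) * int (k choose (r - i))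
                         + int ((k - 1) choose (r - i))
                         + (-1) ^ (r - 1) * int ((k - 1) choose (i - 1)))"

section \<open>Basic facts\<close>

lemma finite_bounded_lists: "finite {ms. length ms = l \<and> set ms \<subseteq> {1..N::nat} \<and> P ms}"
  by (rule finite_subset[OF _ finite_lists_length_eq[of "{1..N}" l]]) auto

lemma finite_indices: "finite (indices k r)"
proof -
  have "indices k r \<subseteq> {ks. set ks \<subseteq> {..k} \<and> length ks = r}"
    by (auto simp: indices_def intro: member_le_sum_list)
  thus ?thesis
    by (rule finite_subset) (simp add: finite_lists_length_eq)
qed

lemma finite_indices_at: "finite (indices_at k r i)"
  using finite_indices[of k r] by (simp add: indices_at_def)

text \<open>The defining generating function $t/(e^t-1)$ of the Bernoulli numbers.\<close>
lemma bernoulli_fps: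
  "Abs_fps (\<lambda>n. bernoulli n / fact n) * (fps_exp 1 - 1) = fps_X"
proof (rule fps_ext)
  fix n
  let ?B = "Abs_fps (\<lambda>n. bernoulli n / fact n)" and ?E = "fps_exp (1::rat) - 1"
  show "fps_nth (?B * ?E) n = fps_nth fps_X n"
  proof (cases n)
    case 0
    thus ?thesis by simp
  next
    case (Suc m)
    have eq: "fps_nth (?B * ?E) n = (\<Sum>j\<le>m. bernoulli j / fact j / fact (n - j))"
      unfolding fps_mult_nth Suc atLeast0AtMost sum.atMost_Suc by simp
    have "(\<Sum>j\<le>m. bernoulli j / fact j / fact (n - j)) =
          (\<Sum>j\<le>m. of_nat (n choose j) * bernoulli j) / fact n"
      unfolding sum_divide_distrib
      by (rule sum.cong) (auto simp: binomial_fact Suc simp del: fact_Suc)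
    also have "(\<Sum>j\<le>m. of_nat (n choose j) * bernoulli j) = (if m = 0 then 1 else 0)"
    proof (cases "m = 0")
      case False
      have "(\<Sum>j\<le>m. of_nat (n choose j) * bernoulli j) =
            (\<Sum>j<m. of_nat (n choose j) * bernoulli j) + of_nat n * bernoulli m"
        by (simp add: Suc lessThan_Suc_atMost[symmetric])
      also have "of_nat n * bernoulli m = - (\<Sum>j<m. of_nat (n choose j) * bernoulli j)"
        using False by (subst bernoulli.simps) (simp add: Suc del: of_nat_Suc binomial_Suc_Suc)
      finally show ?thesis using False by simp
    qed (simp add: Suc bernoulli.simps)
    finally show ?thesis using eq by (simp add: Suc)
  qed
qed

lemma cring_product_ring:
  assumes "\<And>i. i \<in> I \<Longrightarrow> cring (R i)"
  shows   "cring (product_ring I R)"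
proof -
  note rings = assms cring.axioms(1)[OF assms]
  show ?thesis
  proof (rule cringI)
    show "abelian_group (product_ring I R)"
    proof (rule abelian_groupI)
      fix x assume x: "x \<in> carrier (product_ring I R)"
      show "\<exists>y\<in>carrier (product_ring I R). y \<oplus>\<^bsub>product_ring I R\<^esub> x = \<zero>\<^bsub>product_ring I R\<^esub>"
        by (rule bexI[of _ "\<lambda>i\<in>I. \<ominus>\<^bsub>R i\<^esub> x i"])
           (use x rings in \<open>auto simp: product_ring_def PiE_iff cring.cring_simprules
              intro!: restrict_ext\<close>)
    qed (use rings in \<open>auto simp: product_ring_def PiE_iff cring.cring_simprules
           intro!: restrict_ext extensionalityI[of _ I]\<close>)
    show "comm_monoid (product_ring I R)"
      by (rule comm_monoidI)
         (use rings in \<open>auto simp: product_ring_def PiE_iff cring.cring_simprules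
           monoid.r_one[OF ring.is_monoid] intro!: restrict_ext extensionalityI[of _ I]\<close>)
  qed (use rings in \<open>auto simp: product_ring_def PiE_iff cring.cring_simprules
         intro!: restrict_ext\<close>)
qed

lemma a_inv_product_ring:
  assumes "\<And>i. i \<in> I \<Longrightarrow> cring (R i)" "x \<in> carrier (product_ring I R)"
  shows   "\<ominus>\<^bsub>product_ring I R\<^esub> x = (\<lambda>i\<in>I. \<ominus>\<^bsub>R i\<^esub> x i)"
proof -
  interpret P: cring "product_ring I R"
    using assms(1) by (rule cring_product_ring)
  show ?thesis
    by (rule P.minus_equality)
       (use assms in \<open>auto simp: product_ring_def PiE_iff cring.cring_simprules
          intro!: restrict_ext\<close>)
qed

lemma ideal_direct_sum:
  assumes "\<And>i. i \<in> I \<Longrightarrow> cring (R i)"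
  shows   "ideal (direct_sum_ideal I R) (product_ring I R)"
proof -
  interpret P: cring "product_ring I R"
    using assms by (rule cring_product_ring)
  have sub: "direct_sum_ideal I R \<subseteq> carrier (product_ring I R)"
    by (auto simp: direct_sum_ideal_def product_ring_def)
  have mult: "a \<otimes>\<^bsub>product_ring I R\<^esub> x \<in> direct_sum_ideal I R"
    if "a \<in> direct_sum_ideal I R" "x \<in> carrier (product_ring I R)" for a x
  proof -
    have "finite {i \<in> I. a i \<noteq> \<zero>\<^bsub>R i\<^esub>}"
      using that(1) by (simp add: direct_sum_ideal_def)
    hence "finite {i \<in> I. a i \<otimes>\<^bsub>R i\<^esub> x i \<noteq> \<zero>\<^bsub>R i\<^esub>}"
      by (rule finite_subset[rotated])
         (use that(2) assms in \<open>auto simp: product_ring_def PiE_iff cring.cring_simprules\<close>)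
    thus ?thesis
      using that assms
      by (auto simp: direct_sum_ideal_def product_ring_def PiE_iff cring.cring_simprules
            cong: conj_cong)
  qed
  show ?thesis
  proof (rule idealI)
    show "subgroup (direct_sum_ideal I R) (add_monoid (product_ring I R))"
    proof (rule P.add.subgroupI)
      show "direct_sum_ideal I R \<noteq> {}"
        using assms
        by (auto simp: direct_sum_ideal_def cring.cring_simprules
              intro!: exI[of _ "\<lambda>i\<in>I. \<zero>\<^bsub>R i\<^esub>"] cong: conj_cong)
    next
      fix a assume a: "a \<in> direct_sum_ideal I R"
      have "finite {i \<in> I. a i \<noteq> \<zero>\<^bsub>R i\<^esub>}"
        using a by (simp add: direct_sum_ideal_def)
      hence "finite {i \<in> I. \<ominus>\<^bsub>R i\<^esub> a i \<noteq> \<zero>\<^bsub>R i\<^esub>}"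
        by (rule finite_subset[rotated]) (use assms in \<open>auto simp: cring.cring_simprules\<close>)
      moreover have "\<ominus>\<^bsub>product_ring I R\<^esub> a = (\<lambda>i\<in>I. \<ominus>\<^bsub>R i\<^esub> a i)"
        using a sub assms by (intro a_inv_product_ring) auto
      ultimately have "\<ominus>\<^bsub>product_ring I R\<^esub> a \<in> direct_sum_ideal I R"
        using a assms
        by (auto simp: direct_sum_ideal_def PiE_iff cring.cring_simprules cong: conj_cong)
      thus "\<ominus>\<^bsub>product_ring I R\<^esub> a \<in> direct_sum_ideal I R" .
    next
      fix a b assume ab: "a \<in> direct_sum_ideal I R" "b \<in> direct_sum_ideal I R"
      have "finite ({i \<in> I. a i \<noteq> \<zero>\<^bsub>R i\<^esub>} \<union> {i \<in> I. b i \<noteq> \<zero>\<^bsub>R i\<^esub>})"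
        using ab by (simp add: direct_sum_ideal_def)
      hence "finite {i \<in> I. a i \<oplus>\<^bsub>R i\<^esub> b i \<noteq> \<zero>\<^bsub>R i\<^esub>}"
        by (rule finite_subset[rotated]) (use assms in \<open>auto simp: cring.cring_simprules\<close>)
      thus "a \<oplus>\<^bsub>product_ring I R\<^esub> b \<in> direct_sum_ideal I R"
        using ab assms
        by (auto simp: direct_sum_ideal_def product_ring_def PiE_iff cring.cring_simprules
              cong: conj_cong)
    qed (use sub in auto)
  next
    fix a x assume *: "a \<in> direct_sum_ideal I R" "x \<in> carrier (product_ring I R)"
    show "a \<otimes>\<^bsub>product_ring I R\<^esub> x \<in> direct_sum_ideal I R"
      using * by (rule mult)
    thus "x \<otimes>\<^bsub>product_ring I R\<^esub> a \<in> direct_sum_ideal I R"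
      using * sub by (subst P.m_comm) auto
  qed (rule P.ring_axioms)
qed

lemma cring_Zpn:
  assumes "0 < n" "prime p"
  shows   "cring (Zpn n p)"
proof -
  have "1 < int p ^ n"
    using assms prime_gt_1_nat[of p] by (simp add: one_less_power)
  thus ?thesis
    by (intro residues.cring) (simp add: residues_def)
qed

lemma cring_A_ring:
  assumes "0 < n"
  shows   "cring (A_ring n)"
  unfolding A_ring_def
  by (intro ideal.quotient_is_cring ideal_direct_sum cring_product_ring)
     (use assms in \<open>auto intro: cring_Zpn\<close>)

lemma ideal_A:
  assumes "0 < n"
  shows   "ideal (direct_sum_ideal primes (Zpn n)) (product_ring primes (Zpn n))"
  using assms by (intro ideal_direct_sum) (auto intro: cring_Zpn)

lemma rat_mod_carrier:
  assumes "prime p"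
  shows   "rat_mod (int p ^ n) q \<in> carrier (Zpn n p)"
  using prime_gt_0_nat[OF assms] by (simp add: rat_mod_def residue_ring_def)

lemma A_class_closed:
  assumes "0 < n"
  shows   "A_class n x \<in> carrier (A_ring n)"
proof -
  interpret ideal "direct_sum_ideal primes (Zpn n)" "product_ring primes (Zpn n)"
    using assms by (rule ideal_A)
  show ?thesis
    unfolding A_class_def A_ring_def FactRing_def
    using a_rcosetsI[OF a_subset] rat_mod_carrier by (simp add: product_ring_def)
qed

lemma A_class_eq_iff:
  assumes "0 < n"
  shows   "A_class n x = A_class n y \<longleftrightarrow>
           finite {p. prime p \<and> rat_mod (int p ^ n) (x p) \<noteq> rat_mod (int p ^ n) (y p)}"
proof -
  let ?P = "product_ring primes (Zpn n)" and ?I = "direct_sum_ideal primes (Zpn n)"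
  let ?f = "\<lambda>x. \<lambda>p\<in>primes. rat_mod (int p ^ n) (x p)"
  interpret ideal ?I ?P
    using assms by (rule ideal_A)
  have cr: "cring (Zpn n p)" if "p \<in> primes" for p
    using assms that by (auto intro: cring_Zpn)
  have closed: "?f x \<in> carrier ?P" for x
    using rat_mod_carrier by (simp add: product_ring_def)
  have minus: "?f x \<ominus>\<^bsub>?P\<^esub> ?f y = (\<lambda>p\<in>primes. ?f x p \<ominus>\<^bsub>Zpn n p\<^esub> ?f y p)"
    unfolding a_minus_def using closed cr
    by (subst a_inv_product_ring) (auto simp: product_ring_def intro!: restrict_ext)
  have "A_class n x = A_class n y \<longleftrightarrow> ?f x \<ominus>\<^bsub>?P\<^esub> ?f y \<in> ?I"
    unfolding A_class_def by (rule quotient_eq_iff_same_a_r_cos[symmetric]) (fact is_ideal closed)+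
  also have "\<dots> \<longleftrightarrow> (?f x \<ominus>\<^bsub>?P\<^esub> ?f y \<in> carrier ?P \<and>
               finite {p \<in> primes. (?f x \<ominus>\<^bsub>?P\<^esub> ?f y) p \<noteq> \<zero>\<^bsub>Zpn n p\<^esub>})"
    by (simp add: direct_sum_ideal_def product_ring_def)
  also have "{p \<in> primes. (?f x \<ominus>\<^bsub>?P\<^esub> ?f y) p \<noteq> \<zero>\<^bsub>Zpn n p\<^esub>} =
             {p. prime p \<and> rat_mod (int p ^ n) (x p) \<noteq> rat_mod (int p ^ n) (y p)}"
    unfolding minus using cr
    by (auto simp: ring.r_right_minus_eq[OF cring.axioms(1)] rat_mod_carrier)
  finally show ?thesis
    using minus_closed[OF closed closed] by blast
qed

lemma rat_mod_cong:
  assumes "coprime b m" "b \<noteq> 0"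
  shows   "[b * rat_mod m (of_int a / of_int b) = a] (mod m)"
proof -
  obtain c d where cd: "quotient_of (of_int a / of_int b) = (c, d)"
    by (cases "quotient_of (of_int a / of_int b)")
  have d: "d > 0" and cop: "coprime c d"
    using quotient_of_denom_pos[OF cd] quotient_of_coprime[OF cd] by auto
  have "(of_int a / of_int b :: rat) = of_int c / of_int d"
    using quotient_of_div[OF cd] .
  hence "(of_int (a * d) :: rat) = of_int (c * b)"
    using assms(2) d by (simp add: field_simps)
  hence eq: "a * d = c * b"
    by (simp only: of_int_eq_iff)
  hence "d dvd b"
    using cop by (metis coprime_commute coprime_dvd_mult_right_iff dvd_triv_right)
  hence "coprime d m"
    using assms(1) by (rule coprime_divisors[OF _ dvd_refl])
  have "[d * rat_mod m (of_int a / of_int b) = c * (d * modular_inverse m d)] (mod m)"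
    by (simp add: rat_mod_def cd cong_def mod_mult_right_eq mult_ac)
  also have "[c * (d * modular_inverse m d) = c * 1] (mod m)"
    using \<open>coprime d m\<close> by (intro cong_mult cong_refl cong_modular_inverse1)
  finally have "[b * (d * rat_mod m (of_int a / of_int b)) = b * c] (mod m)"
    by (intro cong_mult cong_refl) simp
  hence "[d * (b * rat_mod m (of_int a / of_int b)) = d * a] (mod m)"
    using eq by (simp add: mult_ac)
  thus ?thesis
    using \<open>coprime d m\<close> by (simp add: cong_mult_lcancel)
qed

lemma rat_mod_unique:
  assumes "coprime b m" "b \<noteq> 0" "[b * x = a] (mod m)"
  shows   "rat_mod m (of_int a / of_int b) = x mod m"
proof -
  have "[b * rat_mod m (of_int a / of_int b) = b * x] (mod m)"
    using rat_mod_cong[OF assms(1,2)] assms(3) by (metis cong_sym cong_trans)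
  hence "[rat_mod m (of_int a / of_int b) = x] (mod m)"
    using assms(1) by (simp add: cong_mult_lcancel)
  thus ?thesis
    by (simp add: cong_def rat_mod_def)
qed

lemma rat_mod_add_mult:
  assumes "coprime (snd (quotient_of x)) m" "coprime (snd (quotient_of y)) m"
  shows   "rat_mod m (x + y) = (rat_mod m x + rat_mod m y) mod m"
    and   "rat_mod m (x * y) = (rat_mod m x * rat_mod m y) mod m"
proof -
  obtain a b c d where ab: "quotient_of x = (a, b)" and cd: "quotient_of y = (c, d)"
    by (cases "quotient_of x"; cases "quotient_of y")
  have pos: "b > 0" "d > 0"
    using quotient_of_denom_pos ab cd by auto
  have x: "x = of_int a / of_int b" and y: "y = of_int c / of_int d"
    using quotient_of_div ab cd by auto
  have cop: "coprime b m" "coprime d m"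
    using assms ab cd by auto
  have 1: "[b * rat_mod m x = a] (mod m)" "[d * rat_mod m y = c] (mod m)"
    unfolding x y using cop pos by (auto intro!: rat_mod_cong)
  have "x + y = of_int (a * d + c * b) / of_int (b * d)"
    unfolding x y using pos by (simp add: field_simps)
  moreover have "[d * (b * rat_mod m x) + b * (d * rat_mod m y) = d * a + b * c] (mod m)"
    using 1 by (intro cong_add cong_mult cong_refl)
  hence "rat_mod m (of_int (a * d + c * b) / of_int (b * d)) = (rat_mod m x + rat_mod m y) mod m"
    using cop pos by (intro rat_mod_unique) (auto simp: algebra_simps)
  ultimately show "rat_mod m (x + y) = (rat_mod m x + rat_mod m y) mod m"
    by simp
  have "x * y = of_int (a * c) / of_int (b * d)"
    unfolding x y by simp
  moreover have "[(b * rat_mod m x) * (d * rat_mod m y) = a * c] (mod m)"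
    using 1 by (intro cong_mult)
  hence "rat_mod m (of_int (a * c) / of_int (b * d)) = (rat_mod m x * rat_mod m y) mod m"
    using cop pos by (intro rat_mod_unique) (auto simp: algebra_simps)
  ultimately show "rat_mod m (x * y) = (rat_mod m x * rat_mod m y) mod m"
    by simp
qed

definition almost_integral :: "(nat \<Rightarrow> rat) \<Rightarrow> bool" where
  "almost_integral x \<longleftrightarrow> finite {p. prime p \<and> \<not> coprime (snd (quotient_of (x p))) (int p)}"

lemma almost_integral_const: "almost_integral (\<lambda>_. q)"
proof -
  have "{p. prime p \<and> \<not> coprime (snd (quotient_of q)) (int p)} \<subseteq>
        {..nat (snd (quotient_of q))}"
  proof safe
    fix p :: nat assume p: "prime p" "\<not> coprime (snd (quotient_of q)) (int p)"
    hence "int p dvd snd (quotient_of q)"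
      using prime_imp_coprime[of "int p" "snd (quotient_of q)"]
      by (metis coprime_commute prime_nat_int_transfer)
    hence "int p \<le> snd (quotient_of q)"
      using quotient_of_denom_pos' zdvd_imp_le by blast
    thus "p \<le> nat (snd (quotient_of q))" by linarith
  qed
  thus ?thesis
    unfolding almost_integral_def by (rule finite_subset) simp
qed

text \<open>
  On almost integral families, \<open>A_class n\<close> respects the ring operations. On constant
  families this says that \<open>A_class n (\<lambda>_. q)\<close> is the structure map
  $\mathbb{Q} \to \mathcal{A}_n$.
\<close>
lemma A_class_one:
  assumes "0 < n"
  shows   "A_class n (\<lambda>_. 1) = \<one>\<^bsub>A_ring n\<^esub>"
proof -
  have "rat_mod (int p ^ n) 1 = 1" if "prime p" for p
  proof -
    have "1 < int p ^ n"
      using assms prime_gt_1_nat[OF that] by (simp add: one_less_power)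
    thus ?thesis
      using rat_mod_unique[of 1 "int p ^ n" 1 1] by simp
  qed
  hence "(\<lambda>p\<in>primes. rat_mod (int p ^ n) 1) = \<one>\<^bsub>product_ring primes (Zpn n)\<^esub>"
    by (auto simp: product_ring_def residue_ring_def intro!: restrict_ext)
  thus ?thesis
    by (simp add: A_class_def A_ring_def FactRing_def)
qed

lemma A_class_add_mult:
  assumes "0 < n" "almost_integral x" "almost_integral y"
  shows   "A_class n (\<lambda>p. x p + y p) = A_class n x \<oplus>\<^bsub>A_ring n\<^esub> A_class n y"
    and   "A_class n (\<lambda>p. x p * y p) = A_class n x \<otimes>\<^bsub>A_ring n\<^esub> A_class n y"
proof -
  let ?P = "product_ring primes (Zpn n)" and ?I = "direct_sum_ideal primes (Zpn n)"
  let ?f = "\<lambda>x. \<lambda>p\<in>primes. rat_mod (int p ^ n) (x p)"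
  interpret ideal ?I ?P
    using assms(1) by (rule ideal_A)
  have closed: "?f x \<in> carrier ?P" for x
    using rat_mod_carrier by (simp add: product_ring_def)
  have rat_mod_int: "rat_mod m (of_int a) = a mod m" for m a
    using rat_mod_unique[of 1 m a a] by simp
  have fin: "finite ({p. prime p \<and> \<not> coprime (snd (quotient_of (x p))) (int p)} \<union>
                     {p. prime p \<and> \<not> coprime (snd (quotient_of (y p))) (int p)})"
    using assms(2,3) by (simp add: almost_integral_def)
  have "A_class n (\<lambda>p. x p + y p) =
        A_class n (\<lambda>p. of_int (rat_mod (int p ^ n) (x p) + rat_mod (int p ^ n) (y p)))"
    unfolding A_class_eq_iff[OF assms(1)] rat_mod_int
    by (rule finite_subset[OF _ fin]) (auto simp: rat_mod_add_mult)
  also have "\<dots> = ?I +>\<^bsub>?P\<^esub> (?f x \<oplus>\<^bsub>?P\<^esub> ?f y)"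
    unfolding A_class_def rat_mod_int
    by (rule arg_cong[where f = "\<lambda>z. ?I +>\<^bsub>?P\<^esub> z"])
       (auto simp: product_ring_def residue_ring_def intro!: restrict_ext)
  also have "\<dots> = A_class n x \<oplus>\<^bsub>A_ring n\<^esub> A_class n y"
    unfolding A_class_def A_ring_def using closed
    by (intro ring_hom_add[OF rcos_ring_hom])
  finally show "A_class n (\<lambda>p. x p + y p) = A_class n x \<oplus>\<^bsub>A_ring n\<^esub> A_class n y" .
  have "A_class n (\<lambda>p. x p * y p) =
        A_class n (\<lambda>p. of_int (rat_mod (int p ^ n) (x p) * rat_mod (int p ^ n) (y p)))"
    unfolding A_class_eq_iff[OF assms(1)] rat_mod_int
    by (rule finite_subset[OF _ fin]) (auto simp: rat_mod_add_mult)
  also have "\<dots> = ?I +>\<^bsub>?P\<^esub> (?f x \<otimes>\<^bsub>?P\<^esub> ?f y)"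
    unfolding A_class_def rat_mod_int
    by (rule arg_cong[where f = "\<lambda>z. ?I +>\<^bsub>?P\<^esub> z"])
       (auto simp: product_ring_def residue_ring_def intro!: restrict_ext)
  also have "\<dots> = A_class n x \<otimes>\<^bsub>A_ring n\<^esub> A_class n y"
    unfolding A_class_def A_ring_def using closed
    by (intro ring_hom_mult[OF rcos_ring_hom])
  finally show "A_class n (\<lambda>p. x p * y p) = A_class n x \<otimes>\<^bsub>A_ring n\<^esub> A_class n y" .
qed

end

theory Submission
  imports Defs
begin

text \<open>
  Put $N = p - 1$ and $P(x) = \prod_{j \le N} (1 - x/j)$. Because
  $\sum_{a \ge 1} x^a / m^a = (x/m) / (1 - x/m)$, summing $\zeta_N$ or $\zeta^{\star}_N$ over
  all indices of depth $r$, with $x$ marking the weight, produces the $r$-th elementary or complete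
  symmetric function of $N$ explicit series. These are $(-1)^r D_r P / P$ and $P \, D_r (1/P)$ for the
  divided derivative $D_r f = x^r f^{(r)} / r!$ (\<open>mzeta_gf_pos\<close>, \<open>mzeta_star_gf_pos\<close>), so each sum over
  $I_{k,r}$ is a bilinear expression in the coefficients of $P$ and of $1/P$. In positive degrees
  below $p - 1$ these coefficients are divisible by $p$, and in odd degrees below $p - 3$ by $p^2$. Modulo $p^2$,
  and modulo $p^3$ for odd $k$, a single term survives: $\binom{k}{r}$ times a coefficient of degree
  $k$, which by Newton's identities is $\pm H_k / k$ with $H_k = \sum_{m < p} m^{-k}$ (\<open>sum_indices_zcong\<close>).

  The value of $H_k$ modulo $p^2$ comes from the duality
  $\zeta^{\star}_N(\{1\}^k) = \sum_l (-1)^{l-1} \binom{N}{l} l^{-k}$ (\<open>hcoeff_dual\<close>). The left-hand side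
  is $H_k / k$ up to a multiple of $p^2$, and on the right
  $(-1)^l \binom{p-1}{l} \equiv 1 - p \sum_{n \le l} 1/n$. Hence $(k+1) H_k / k$ is $p$ times a double
  sum that matters modulo $p$ only, where Faulhaber's formula evaluates it as a Bernoulli number
  (\<open>harm2_zcong\<close>). The reflection $m \mapsto p - m$ carries this over to $H_k$ modulo $p^3$ for odd $k$.

  The condition $k_i \ge 2$ replaces one factor by $(x/m)^2 / (1 - x/m)$. The same argument reduces the
  restricted sums to $\zeta(\{1\}^s, 2, \{1\}^t)$ with $s + t = k - 2$ modulo $p^2$. Duality
  (\<open>marked_star_dual\<close>) turns these into a double sum of even weight modulo $p^2$ and $p$ times a
  triple sum of odd weight. Comparing each of them with its image under $m \mapsto p - m$, and using
  the stuffle product for the double sum, expresses twice its value through $H_k$ and double sums modulo $p$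
  (\<open>marked_star_zcong\<close>). What remains is a binomial sum, whose alternating part is a finite difference
  of a polynomial of too small degree, up to three boundary terms
  (\<open>sum_alternating_choose_convolution\<close>): this is where $a_{k,r,i}$ and $b_{k,r,i}$ come from.
\<close>

section \<open>The localisation of the integers at a prime\<close>

locale at_prime =
  fixes p :: nat
  assumes prime_p: "prime p"
begin

text \<open>
  The ideal $p^n \mathbb{Z}_{(p)}$ of the localisation $\mathbb{Z}_{(p)} \subseteq \mathbb{Q}$.
\<close>
definition Zp :: "nat \<Rightarrow> rat set" where
  "Zp n = {x. \<exists>a b. \<not> int p dvd b \<and> x = of_nat p ^ n * of_int a / of_int b}"

definition zcong :: "rat \<Rightarrow> nat \<Rightarrow> rat \<Rightarrow> bool" ("(_ \<sim>\<^bsub>_\<^esub> _)" [51, 0, 51] 50) where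
  "x \<sim>\<^bsub>n\<^esub> y \<longleftrightarrow> x - y \<in> Zp n"

lemma prime_int_p: "prime (int p)"
  using prime_p by simp

lemma p_gt_0: "0 < p"
  using prime_gt_0_nat[OF prime_p] .

lemma ZpI: "\<not> int p dvd b \<Longrightarrow> x = of_nat p ^ n * of_int a / of_int b \<Longrightarrow> x \<in> Zp n"
  unfolding Zp_def by blast

lemma Zp_add:
  assumes "x \<in> Zp n" "y \<in> Zp n"
  shows "x + y \<in> Zp n"
proof -
  obtain a b c d where 1: "\<not> int p dvd b" "x = of_nat p ^ n * of_int a / of_int b"
    and 2: "\<not> int p dvd d" "y = of_nat p ^ n * of_int c / of_int d"
    using assms unfolding Zp_def by blast
  have "b \<noteq> 0" "d \<noteq> 0" using 1(1) 2(1) by auto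
  moreover have "\<not> int p dvd b * d"
    using 1 2 prime_int_p by (simp add: prime_dvd_mult_iff)
  ultimately show ?thesis
    by (intro ZpI[of "b * d" _ _ "a * d + c * b"]) (auto simp: 1 2 field_simps)
qed

lemma Zp_mult:
  assumes "x \<in> Zp m" "y \<in> Zp n"
  shows "x * y \<in> Zp (m + n)"
proof -
  obtain a b c d where 1: "\<not> int p dvd b" "x = of_nat p ^ m * of_int a / of_int b"
    and 2: "\<not> int p dvd d" "y = of_nat p ^ n * of_int c / of_int d"
    using assms unfolding Zp_def by blast
  have "\<not> int p dvd b * d"
    using 1 2 prime_int_p by (simp add: prime_dvd_mult_iff)
  thus ?thesis
    by (intro ZpI[of "b * d" _ _ "a * c"]) (auto simp: 1 2 power_add)
qed

lemma Zp_of_int [simp]: "of_int a \<in> Zp 0"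
  using prime_int_p by (intro ZpI[of 1 _ _ a]) auto

lemma Zp_of_nat [simp]: "of_nat a \<in> Zp 0"
  using Zp_of_int[of "int a"] by simp

lemma Zp_numeral [simp]: "1 \<in> Zp 0" "numeral k \<in> Zp 0"
  using Zp_of_nat[of 1] Zp_of_nat[of "numeral k"] by simp_all

lemma Zp_zero [simp]: "0 \<in> Zp n"
  using prime_int_p by (intro ZpI[of 1 _ _ 0]) auto

lemma Zp_p: "of_nat p \<in> Zp 1"
  using prime_int_p by (intro ZpI[of 1 _ _ 1]) auto

lemma Zp_mult_left: "x \<in> Zp 0 \<Longrightarrow> y \<in> Zp n \<Longrightarrow> x * y \<in> Zp n"
  using Zp_mult[of x 0 y n] by simp

lemma Zp_mult_right: "x \<in> Zp n \<Longrightarrow> y \<in> Zp 0 \<Longrightarrow> x * y \<in> Zp n"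
  using Zp_mult[of x n y 0] by simp

lemma Zp_minus: "x \<in> Zp n \<Longrightarrow> - x \<in> Zp n"
  using Zp_mult_left[of "of_int (-1)" x n] Zp_of_int[of "-1"] by simp

lemma Zp_diff: "x \<in> Zp n \<Longrightarrow> y \<in> Zp n \<Longrightarrow> x - y \<in> Zp n"
  using Zp_add[of x n "- y"] Zp_minus by simp

lemma Zp_sum: "(\<And>i. i \<in> A \<Longrightarrow> f i \<in> Zp n) \<Longrightarrow> sum f A \<in> Zp n"
  by (induction A rule: infinite_finite_induct) (auto intro: Zp_add)

lemma Zp_prod: "(\<And>i. i \<in> A \<Longrightarrow> f i \<in> Zp 0) \<Longrightarrow> prod f A \<in> Zp 0"
  by (induction A rule: infinite_finite_induct) (auto intro: Zp_mult_left)

lemma Zp_mono: "x \<in> Zp n \<Longrightarrow> m \<le> n \<Longrightarrow> x \<in> Zp m"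
proof -
  assume "x \<in> Zp n" "m \<le> n"
  then obtain a b where *: "\<not> int p dvd b" "x = of_nat p ^ n * of_int a / of_int b"
    unfolding Zp_def by blast
  have "(of_nat p :: rat) ^ n = of_nat p ^ m * of_int (int p ^ (n - m))"
    using \<open>m \<le> n\<close> by (simp flip: power_add)
  thus ?thesis
    using * by (intro ZpI[of b _ _ "int p ^ (n - m) * a"]) auto
qed

lemma Zp_power: "x \<in> Zp 0 \<Longrightarrow> x ^ k \<in> Zp 0"
  by (induction k) (auto intro: Zp_mult_left)

lemma Zp_p_power: "of_nat p ^ n \<in> Zp n"
  by (induction n) (use Zp_p Zp_mult in \<open>force+\<close>)

lemma not_dvd_small: "0 < m \<Longrightarrow> m < p \<Longrightarrow> \<not> int p dvd int m"
  by (simp add: nat_dvd_not_less)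

lemma Zp_inverse: "0 < m \<Longrightarrow> m < p \<Longrightarrow> 1 / of_nat m \<in> Zp 0"
  using not_dvd_small[of m] by (intro ZpI[of "int m" _ _ 1]) auto

lemma Zp_divide: "x \<in> Zp n \<Longrightarrow> 0 < m \<Longrightarrow> m < p \<Longrightarrow> x / of_nat m \<in> Zp n"
  using Zp_mult_right[OF _ Zp_inverse, of x n m] by simp

lemma Zp_divide_power: "x \<in> Zp n \<Longrightarrow> 0 < m \<Longrightarrow> m < p \<Longrightarrow> x / of_nat m ^ k \<in> Zp n"
  using Zp_mult_right[OF _ Zp_power[OF Zp_inverse], of x n m k]
  by (simp add: power_one_over)

lemma Zp_cancel:
  assumes "of_nat m * x \<in> Zp n" "0 < m" "m < p"
  shows "x \<in> Zp n"
  using Zp_divide[OF assms] assms by simp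

lemma zcong_refl [simp, intro]: "x \<sim>\<^bsub>n\<^esub> x"
  by (simp add: zcong_def)

lemma zcong_sym: "x \<sim>\<^bsub>n\<^esub> y \<Longrightarrow> y \<sim>\<^bsub>n\<^esub> x"
  using Zp_minus[of "x - y" n] by (simp add: zcong_def)

lemma zcong_trans [trans]: "x \<sim>\<^bsub>n\<^esub> y \<Longrightarrow> y \<sim>\<^bsub>n\<^esub> z \<Longrightarrow> x \<sim>\<^bsub>n\<^esub> z"
  using Zp_add[of "x - y" n "y - z"] by (simp add: zcong_def)

text \<open>
  The generic substitution rules would apply here as well, but their higher-order unification
  is very expensive on nested sums.
\<close>
lemma zcong_eq_trans [trans]: "x \<sim>\<^bsub>n\<^esub> y \<Longrightarrow> y = z \<Longrightarrow> x \<sim>\<^bsub>n\<^esub> z"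
  by simp

lemma eq_zcong_trans [trans]: "x = y \<Longrightarrow> y \<sim>\<^bsub>n\<^esub> z \<Longrightarrow> x \<sim>\<^bsub>n\<^esub> z"
  by simp

lemma zcong_add: "x \<sim>\<^bsub>n\<^esub> x' \<Longrightarrow> y \<sim>\<^bsub>n\<^esub> y' \<Longrightarrow> x + y \<sim>\<^bsub>n\<^esub> x' + y'"
  using Zp_add[of "x - x'" n "y - y'"] by (simp add: zcong_def algebra_simps)

lemma zcong_minus: "x \<sim>\<^bsub>n\<^esub> x' \<Longrightarrow> - x \<sim>\<^bsub>n\<^esub> - x'"
  using Zp_minus[of "x - x'" n] by (simp add: zcong_def algebra_simps)

lemma zcong_diff: "x \<sim>\<^bsub>n\<^esub> x' \<Longrightarrow> y \<sim>\<^bsub>n\<^esub> y' \<Longrightarrow> x - y \<sim>\<^bsub>n\<^esub> x' - y'"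
  using zcong_add[of x n x' "- y" "- y'"] zcong_minus by simp

lemma zcong_sum: "(\<And>i. i \<in> A \<Longrightarrow> f i \<sim>\<^bsub>n\<^esub> g i) \<Longrightarrow> sum f A \<sim>\<^bsub>n\<^esub> sum g A"
  using Zp_sum[of A "\<lambda>i. f i - g i" n] by (simp add: zcong_def sum_subtractf)

lemma zcong_mult:
  assumes "x \<sim>\<^bsub>n\<^esub> x'" "y \<sim>\<^bsub>n\<^esub> y'" "x \<in> Zp 0" "y' \<in> Zp 0"
  shows "x * y \<sim>\<^bsub>n\<^esub> x' * y'"
proof -
  have "x * (y - y') + (x - x') * y' \<in> Zp n"
    using assms by (intro Zp_add Zp_mult_left[of x] Zp_mult_right[of "x - x'"]) (auto simp: zcong_def)
  thus ?thesis by (simp add: zcong_def algebra_simps)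
qed

lemma zcong_mult_left: "y \<sim>\<^bsub>n\<^esub> y' \<Longrightarrow> x \<in> Zp m \<Longrightarrow> x * y \<sim>\<^bsub>m + n\<^esub> x * y'"
  using Zp_mult[of x m "y - y'" n] by (simp add: zcong_def algebra_simps)

lemma zcong_scale: "y \<sim>\<^bsub>n\<^esub> y' \<Longrightarrow> x \<in> Zp 0 \<Longrightarrow> x * y \<sim>\<^bsub>n\<^esub> x * y'"
  using zcong_mult_left[of y n y' x 0] by simp

lemma zcong_mono: "x \<sim>\<^bsub>n\<^esub> y \<Longrightarrow> m \<le> n \<Longrightarrow> x \<sim>\<^bsub>m\<^esub> y"
  unfolding zcong_def by (rule Zp_mono)

lemma zcong_0_iff: "x \<sim>\<^bsub>n\<^esub> 0 \<longleftrightarrow> x \<in> Zp n"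
  by (simp add: zcong_def)

lemma zcong_in: "x \<sim>\<^bsub>n\<^esub> y \<Longrightarrow> y \<in> Zp n \<Longrightarrow> x \<in> Zp n"
  using Zp_add[of "x - y" n y] by (simp add: zcong_def)

lemma zcong_cancel:
  "of_nat m * x \<sim>\<^bsub>n\<^esub> of_nat m * y \<Longrightarrow> 0 < m \<Longrightarrow> m < p \<Longrightarrow> x \<sim>\<^bsub>n\<^esub> y"
  using Zp_cancel[of m "x - y" n] by (simp add: zcong_def algebra_simps)

lemma Zp_0_coprime:
  assumes "x \<in> Zp 0"
  shows "coprime (snd (quotient_of x)) (int p)"
proof -
  obtain a b where *: "\<not> int p dvd b" "x = of_int a / of_int b"
    using assms unfolding Zp_def by auto
  obtain c d where cd: "quotient_of x = (c, d)" by fastforce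
  have d: "d > 0" "coprime c d" "x = of_int c / of_int d"
    using quotient_of_denom_pos[OF cd] quotient_of_coprime[OF cd] quotient_of_div[OF cd] by auto
  have "b \<noteq> 0" using * by auto
  hence "(of_int (a * d) :: rat) = of_int (c * b)"
    using * d by (simp add: field_simps)
  hence "a * d = c * b" by (simp only: of_int_eq_iff)
  hence "d dvd b"
    using d(2) by (metis coprime_commute coprime_dvd_mult_right_iff dvd_triv_right)
  hence "\<not> int p dvd d" using * dvd_trans by blast
  thus ?thesis
    using prime_int_p cd prime_imp_coprime coprime_commute by (metis snd_conv)
qed

text \<open>
  This connects congruence in $\mathbb{Z}_{(p)}$ with the residues that define $\mathcal{A}_n$.
\<close>
lemma rat_mod_eq_if_zcong:
  assumes "x \<sim>\<^bsub>n\<^esub> y" "y \<in> Zp 0"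
  shows "rat_mod (int p ^ n) x = rat_mod (int p ^ n) y"
proof -
  define z where "z = x - y"
  have z: "z \<in> Zp n" and x: "x = y + z"
    using assms by (auto simp: zcong_def z_def)
  obtain a b where *: "\<not> int p dvd b" "z = of_nat p ^ n * of_int a / of_int b"
    using z unfolding Zp_def by auto
  have "b \<noteq> 0" using * by auto
  have "coprime b (int p)"
    using * prime_int_p prime_imp_coprime coprime_commute by metis
  have "rat_mod (int p ^ n) (of_int (int p ^ n * a) / of_int b) = 0 mod (int p ^ n)"
    using \<open>coprime b (int p)\<close> \<open>b \<noteq> 0\<close> by (intro rat_mod_unique) (auto simp: cong_def)
  hence "rat_mod (int p ^ n) z = 0" by (simp add: *)
  moreover have "rat_mod (int p ^ n) (y + z)
      = (rat_mod (int p ^ n) y + rat_mod (int p ^ n) z) mod int p ^ n"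
    using Zp_0_coprime[OF assms(2)] Zp_0_coprime[OF Zp_mono[OF z]]
    by (intro rat_mod_add_mult) auto
  ultimately show ?thesis
    by (simp add: x rat_mod_def)
qed

end

section \<open>Generating functions of sums over indices\<close>

text \<open>
  The allowed values of the $j$-th entry of the index are given by the $j$-th set of the list. This
  treats $I_{k,r}$ and $I_{k,r,i}$ uniformly, and splits off the last entry of an index as the last
  element of that list.
\<close>
definition mzeta_gf :: "bool \<Rightarrow> nat \<Rightarrow> nat set list \<Rightarrow> rat fps" where
  "mzeta_gf star N As = Abs_fps (\<lambda>k. \<Sum>ks | list_all2 (\<in>) ks As \<and> sum_list ks = k.
     (if star then mzeta_star N ks else mzeta N ks))"

text \<open>
  An increasing sequence in $\{1, \dots, N + 1\}$ either avoids $N + 1$ or ends in it. In the strict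
  case the remaining entries are at most $N$, in the weak case $N + 1$ may occur again; this is the
  only difference between the recursions for $\zeta_N$ and $\zeta^{\star}_N$.
\<close>
lemma sorted_wrt_less_snoc_set:
  "{ms. length ms = Suc l \<and> set ms \<subseteq> {1..Suc N} \<and> sorted_wrt (<) ms} =
   {ms. length ms = Suc l \<and> set ms \<subseteq> {1..N} \<and> sorted_wrt (<) ms} \<union>
   (\<lambda>ms. ms @ [Suc N]) ` {ms. length ms = l \<and> set ms \<subseteq> {1..N} \<and> sorted_wrt (<) ms}"
  (is "?L = ?A \<union> ?B")
proof (intro equalityI subsetI)
  fix ms assume ms: "ms \<in> ?L"
  then obtain ns m where [simp]: "ms = ns @ [m]"
    by (cases ms rule: rev_cases) auto
  have ns: "length ns = l" "sorted_wrt (<) ns" "1 \<le> m" "m \<le> Suc N"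
    and bounds: "\<forall>x\<in>set ns. 1 \<le> x \<and> x < m"
    using ms by (auto simp: sorted_wrt_append)
  show "ms \<in> ?A \<union> ?B"
  proof (cases "m = Suc N")
    case True
    have "set ns \<subseteq> {1..N}"
      using bounds True by (meson atLeastAtMost_iff subsetI less_Suc_eq_le)
    hence "ns \<in> {ms. length ms = l \<and> set ms \<subseteq> {1..N} \<and> sorted_wrt (<) ms}"
      using ns by simp
    moreover have "ms = (\<lambda>ms. ms @ [Suc N]) ns" using True by simp
    ultimately show ?thesis by (intro UnI2 image_eqI)
  next
    case False
    hence "m \<le> N" using ns by simp
    hence "set (ns @ [m]) \<subseteq> {1..N}"
      using bounds ns by fastforce
    thus ?thesis using ms by simp
  qed
next
  fix ms assume "ms \<in> ?A \<union> ?B"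
  thus "ms \<in> ?L"
  proof
    assume "ms \<in> ?A"
    thus ?thesis by fastforce
  next
    assume "ms \<in> ?B"
    then obtain ns where "ms = ns @ [Suc N]" "length ns = l" "set ns \<subseteq> {1..N}" "sorted_wrt (<) ns"
      by blast
    thus ?thesis by (fastforce simp: sorted_wrt_append)
  qed
qed

lemma sorted_wrt_le_snoc_set:
  "{ms. length ms = Suc l \<and> set ms \<subseteq> {1..Suc N} \<and> sorted_wrt (\<le>) ms} =
   {ms. length ms = Suc l \<and> set ms \<subseteq> {1..N} \<and> sorted_wrt (\<le>) ms} \<union>
   (\<lambda>ms. ms @ [Suc N]) ` {ms. length ms = l \<and> set ms \<subseteq> {1..Suc N} \<and> sorted_wrt (\<le>) ms}"
  (is "?L = ?A \<union> ?B")
proof (intro equalityI subsetI)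
  fix ms assume ms: "ms \<in> ?L"
  then obtain ns m where [simp]: "ms = ns @ [m]"
    by (cases ms rule: rev_cases) auto
  have ns: "length ns = l" "sorted_wrt (\<le>) ns" "1 \<le> m" "m \<le> Suc N"
    and bounds: "\<forall>x\<in>set ns. 1 \<le> x \<and> x \<le> m"
    using ms by (auto simp: sorted_wrt_append)
  show "ms \<in> ?A \<union> ?B"
  proof (cases "m = Suc N")
    case True
    have "set ns \<subseteq> {1..Suc N}"
      using bounds True by (meson atLeastAtMost_iff subsetI less_Suc_eq_le)
    hence "ns \<in> {ms. length ms = l \<and> set ms \<subseteq> {1..Suc N} \<and> sorted_wrt (\<le>) ms}"
      using ns by simp
    moreover have "ms = (\<lambda>ms. ms @ [Suc N]) ns" using True by simp
    ultimately show ?thesis by (intro UnI2 image_eqI)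
  next
    case False
    hence "m \<le> N" using ns by simp
    hence "set (ns @ [m]) \<subseteq> {1..N}"
      using bounds ns by fastforce
    thus ?thesis using ms by simp
  qed
next
  fix ms assume "ms \<in> ?A \<union> ?B"
  thus "ms \<in> ?L"
  proof
    assume "ms \<in> ?A"
    thus ?thesis by fastforce
  next
    assume "ms \<in> ?B"
    then obtain ns where "ms = ns @ [Suc N]" "length ns = l" "set ns \<subseteq> {1..Suc N}" "sorted_wrt (\<le>) ns"
      by blast
    thus ?thesis by (fastforce simp: sorted_wrt_append)
  qed
qed

lemma prod_lessThan_snoc:
  fixes ks ms :: "nat list"
  assumes "length ms = length ks"
  shows "(\<Prod>j<Suc (length ks). of_nat ((ms @ [m]) ! j) ^ ((ks @ [a]) ! j)) =
         (\<Prod>j<length ks. of_nat (ms ! j) ^ (ks ! j)) * (of_nat m ^ a :: rat)"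
  using assms by (simp add: nth_append)

lemma mzeta_snoc:
  "mzeta (Suc N) (ks @ [a]) = mzeta N (ks @ [a]) + mzeta N ks / of_nat (Suc N) ^ a"
proof -
  let ?B = "{ms. length ms = length ks \<and> set ms \<subseteq> {1..N} \<and> sorted_wrt (<) ms}"
  let ?f = "\<lambda>ms. 1 / (\<Prod>j<Suc (length ks). of_nat (ms ! j) ^ ((ks @ [a]) ! j)) :: rat"
  have "mzeta (Suc N) (ks @ [a]) = mzeta N (ks @ [a]) + sum ?f ((\<lambda>ms. ms @ [Suc N]) ` ?B)"
    unfolding mzeta_def length_append_singleton sorted_wrt_less_snoc_set
    by (intro sum.union_disjoint finite_imageI finite_bounded_lists) auto
  also have "sum ?f ((\<lambda>ms. ms @ [Suc N]) ` ?B) = (\<Sum>ms\<in>?B. ?f (ms @ [Suc N]))"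
    by (rule sum.reindex_cong[of "\<lambda>ms. ms @ [Suc N]"]) (auto simp: inj_on_def)
  also have "\<dots> = mzeta N ks / of_nat (Suc N) ^ a"
    unfolding mzeta_def sum_divide_distrib
    by (rule sum.cong) (auto simp: prod_lessThan_snoc simp del: prod.lessThan_Suc of_nat_Suc)
  finally show ?thesis .
qed

lemma mzeta_star_snoc:
  "mzeta_star (Suc N) (ks @ [a]) = mzeta_star N (ks @ [a]) + mzeta_star (Suc N) ks / of_nat (Suc N) ^ a"
proof -
  let ?B = "{ms. length ms = length ks \<and> set ms \<subseteq> {1..Suc N} \<and> sorted_wrt (\<le>) ms}"
  let ?f = "\<lambda>ms. 1 / (\<Prod>j<Suc (length ks). of_nat (ms ! j) ^ ((ks @ [a]) ! j)) :: rat"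
  have "mzeta_star (Suc N) (ks @ [a]) =
      mzeta_star N (ks @ [a]) + sum ?f ((\<lambda>ms. ms @ [Suc N]) ` ?B)"
    unfolding mzeta_star_def length_append_singleton sorted_wrt_le_snoc_set
    by (intro sum.union_disjoint finite_imageI finite_bounded_lists) auto
  also have "sum ?f ((\<lambda>ms. ms @ [Suc N]) ` ?B) = (\<Sum>ms\<in>?B. ?f (ms @ [Suc N]))"
    by (rule sum.reindex_cong[of "\<lambda>ms. ms @ [Suc N]"]) (auto simp: inj_on_def)
  also have "\<dots> = mzeta_star (Suc N) ks / of_nat (Suc N) ^ a"
    unfolding mzeta_star_def sum_divide_distrib
    by (rule sum.cong) (auto simp: prod_lessThan_snoc simp del: prod.lessThan_Suc of_nat_Suc)
  finally show ?thesis .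
qed

lemma mzeta_Nil [simp]: "mzeta N [] = 1" "mzeta_star N [] = 1"
  by (auto simp: mzeta_def mzeta_star_def intro: sum.neutral cong: conj_cong)

lemma mzeta_0 [simp]: "ks \<noteq> [] \<Longrightarrow> mzeta 0 ks = 0" "ks \<noteq> [] \<Longrightarrow> mzeta_star 0 ks = 0"
  by (auto simp: mzeta_def mzeta_star_def intro!: sum.neutral)

lemma finite_list_all2_sum:
  fixes As :: "nat set list"
  shows "finite {ks. list_all2 (\<in>) ks As \<and> sum_list ks = k}"
proof (rule finite_subset)
  show "{ks. list_all2 (\<in>) ks As \<and> sum_list ks = k} \<subseteq> {ks. set ks \<subseteq> {..k} \<and> length ks = length As}"
    by (auto simp: list_all2_lengthD intro: member_le_sum_list)
qed (simp add: finite_lists_length_eq)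

lemma sum_list_all2_snoc:
  fixes f :: "nat list \<Rightarrow> rat"
  shows "(\<Sum>ks | list_all2 (\<in>) ks (As @ [A]) \<and> sum_list ks = k. f ks) =
    (\<Sum>a\<le>k. if a \<in> A then \<Sum>ks | list_all2 (\<in>) ks As \<and> sum_list ks = k - a. f (ks @ [a]) else 0)"
proof -
  let ?S = "\<lambda>k. {ks. list_all2 (\<in>) ks As \<and> sum_list ks = k}"
  have eq: "{ks. list_all2 (\<in>) ks (As @ [A]) \<and> sum_list ks = k} =
      (\<lambda>(a, ks). ks @ [a]) ` (SIGMA a:{..k} \<inter> A. ?S (k - a))"
  proof (intro equalityI subsetI)
    fix xs assume xs: "xs \<in> {ks. list_all2 (\<in>) ks (As @ [A]) \<and> sum_list ks = k}"
    then obtain ks a where [simp]: "xs = ks @ [a]"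
      by (cases xs rule: rev_cases) auto
    have "length ks = length As"
      using xs list_all2_lengthD by fastforce
    hence "list_all2 (\<in>) ks As" "a \<in> A" "sum_list ks = k - a" "a \<le> k"
      using xs by (auto simp: list_all2_append)
    thus "xs \<in> (\<lambda>(a, ks). ks @ [a]) ` (SIGMA a:{..k} \<inter> A. ?S (k - a))"
      by (auto intro!: image_eqI[of _ _ "(a, ks)"])
  next
    fix xs assume "xs \<in> (\<lambda>(a, ks). ks @ [a]) ` (SIGMA a:{..k} \<inter> A. ?S (k - a))"
    then obtain a ks where "xs = ks @ [a]" "a \<le> k" "a \<in> A" "list_all2 (\<in>) ks As" "sum_list ks = k - a"
      by auto
    thus "xs \<in> {ks. list_all2 (\<in>) ks (As @ [A]) \<and> sum_list ks = k}"
      by (simp add: list_all2_appendI)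
  qed
  have "(\<Sum>ks | list_all2 (\<in>) ks (As @ [A]) \<and> sum_list ks = k. f ks) =
     (\<Sum>(a, ks)\<in>(SIGMA a:{..k} \<inter> A. ?S (k - a)). f (ks @ [a]))"
    unfolding eq by (subst sum.reindex) (auto simp: inj_on_def case_prod_unfold)
  also have "\<dots> = (\<Sum>a\<in>{..k} \<inter> A. \<Sum>ks\<in>?S (k - a). f (ks @ [a]))"
    by (subst sum.Sigma) (auto intro: finite_list_all2_sum)
  finally show ?thesis
    by (simp add: sum.If_cases Int_def)
qed

definition power_gf :: "nat set \<Rightarrow> nat \<Rightarrow> rat fps" where
  "power_gf A m = Abs_fps (\<lambda>a. if a \<in> A then 1 / of_nat m ^ a else 0)"

text \<open>
  Splitting off the largest summation variable. All closed forms below are verified against this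
  recursion in $N$.
\<close>
lemma mzeta_gf_snoc:
  "mzeta_gf star (Suc N) (As @ [A]) = mzeta_gf star N (As @ [A]) +
     power_gf A (Suc N) * mzeta_gf star (if star then Suc N else N) As"
proof (rule fps_ext)
  fix k
  let ?z = "\<lambda>N ks. if star then mzeta_star N ks else mzeta N ks"
  let ?M = "if star then Suc N else N"
  have step: "?z (Suc N) (ks @ [a]) = ?z N (ks @ [a]) + 1 / of_nat (Suc N) ^ a * ?z ?M ks" for ks a
    by (cases star) (simp_all only: mzeta_snoc mzeta_star_snoc if_True if_False
        times_divide_eq_left mult_1)
  show "fps_nth (mzeta_gf star (Suc N) (As @ [A])) k = fps_nth (mzeta_gf star N (As @ [A]) +
     power_gf A (Suc N) * mzeta_gf star ?M As) k"
    unfolding mzeta_gf_def fps_nth_Abs_fps sum_list_all2_snoc step fps_add_nth fps_mult_nth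
      power_gf_def sum.distrib atLeast0AtMost
    by (subst sum.distrib[symmetric], rule sum.cong[OF refl])
      (simp only: sum_distrib_left split: if_split, simp)
qed

lemma mzeta_gf_Nil [simp]: "mzeta_gf star N [] = 1"
proof (rule fps_ext)
  fix k
  have "{ks :: nat list. list_all2 (\<in>) ks [] \<and> sum_list ks = k} = (if k = 0 then {[]} else {})"
    by auto
  thus "fps_nth (mzeta_gf star N []) k = fps_nth 1 k"
    by (simp add: mzeta_gf_def)
qed

lemma mzeta_gf_0 [simp]: "mzeta_gf star 0 (As @ [A]) = 0"
  by (rule fps_ext) (auto simp: mzeta_gf_def list_all2_append2 list_all2_Cons2 intro!: sum.neutral)

section \<open>Divided derivatives of products of linear factors\<close>

text \<open>
  The operator $x^r f^{(r)} / r!$. The factor $x^r$ keeps the degree, so that the exponent of $x$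
  is the weight throughout.
\<close>
definition hasse :: "nat \<Rightarrow> rat fps \<Rightarrow> rat fps" where
  "hasse r f = Abs_fps (\<lambda>s. of_nat (s choose r) * fps_nth f s)"

lemma hasse_0 [simp]: "hasse 0 f = f"
  by (rule fps_ext) (simp add: hasse_def)

lemma hasse_Suc_1 [simp]: "hasse (Suc r) 1 = 0"
  by (rule fps_ext) (auto simp: hasse_def)

text \<open>
  The Leibniz rule when one factor is linear.
\<close>
lemma hasse_linear_factor:
  fixes c :: rat
  defines "L \<equiv> 1 - fps_const c * fps_X"
  shows "hasse (Suc r) (L * f) = L * hasse (Suc r) f - fps_const c * fps_X * hasse r f"
proof (rule fps_ext)
  fix n
  show "fps_nth (hasse (Suc r) (L * f)) n = 
    fps_nth (L * hasse (Suc r) f - fps_const c * fps_X * hasse r f) n"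
    by (cases n) (auto simp: hasse_def L_def algebra_simps)
qed

definition lin :: "nat \<Rightarrow> rat fps" where
  "lin j = 1 - fps_const (1 / of_nat j) * fps_X"

definition linprod :: "nat \<Rightarrow> nat \<Rightarrow> rat fps" where
  "linprod m N = (\<Prod>j\<in>{m<..N}. lin j)"

lemma lin_nth_0 [simp]: "fps_nth (lin j) 0 = 1"
  by (simp add: lin_def)

lemma lin_inverse: "lin j * inverse (lin j) = 1"
  by (rule inverse_mult_eq_1') simp

lemma linprod_self [simp]: "linprod m m = 1"
  by (simp add: linprod_def)

lemma linprod_Suc: "m \<le> N \<Longrightarrow> linprod m (Suc N) = linprod m N * lin (Suc N)"
proof -
  assume "m \<le> N"
  hence "{m<..Suc N} = insert (Suc N) {m<..N}" by auto
  thus ?thesis by (simp add: linprod_def mult.commute)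
qed

lemma linprod_split: "l \<le> m \<Longrightarrow> m \<le> N \<Longrightarrow> linprod l N = linprod l m * linprod m N"
proof -
  assume "l \<le> m" "m \<le> N"
  hence "{l<..N} = {l<..m} \<union> {m<..N}" by auto
  thus ?thesis by (simp add: linprod_def prod.union_disjoint)
qed

lemma linprod_nth_0 [simp]: "fps_nth (linprod m N) 0 = 1"
proof (cases "m \<le> N")
  case True
  thus ?thesis by (induction N rule: dec_induct) (auto simp: linprod_Suc)
qed (simp add: linprod_def)

lemma linprod_inverse: "linprod m N * inverse (linprod m N) = 1"
  by (rule inverse_mult_eq_1') simp

text \<open>
  The closed forms of the elementary and the complete symmetric function of degree \<open>r\<close> in the
  series $(x/j) / (1 - x/j)$ for $m < j \le N$.
\<close>
definition esym_gf :: "nat \<Rightarrow> nat \<Rightarrow> nat \<Rightarrow> rat fps" where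
  "esym_gf m N r = (-1) ^ r * hasse r (linprod m N) * inverse (linprod m N)"

definition hsym_gf :: "nat \<Rightarrow> nat \<Rightarrow> nat \<Rightarrow> rat fps" where
  "hsym_gf m N r = hasse r (inverse (linprod m N)) * linprod m N"

lemma power_gf_pos:
  assumes "0 < m"
  shows "power_gf {1..} m * lin m = fps_const (1 / of_nat m) * fps_X"
proof (rule fps_ext)
  fix n
  show "fps_nth (power_gf {1..} m * lin m) n = fps_nth (fps_const (1 / of_nat m) * fps_X) n"
    using assms by (cases n; cases "n - 1") (auto simp: power_gf_def lin_def algebra_simps)
qed

lemma power_gf_ge_2:
  assumes "0 < m"
  shows "power_gf {2..} m * lin m = fps_const (1 / of_nat m ^ 2) * fps_X ^ 2"
proof (rule fps_ext)
  fix n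
  show "fps_nth (power_gf {2..} m * lin m) n = fps_nth (fps_const (1 / of_nat m ^ 2) * fps_X ^ 2) n"
    using assms
    by (cases n; cases "n - 1"; cases "n - 2")
      (auto simp: power_gf_def lin_def algebra_simps fps_X_power_nth numeral_2_eq_2)
qed

lemma esym_gf_0 [simp]: "esym_gf m N 0 = 1"
  by (simp add: esym_gf_def linprod_inverse)

lemma hsym_gf_0 [simp]: "hsym_gf m N 0 = 1"
  using linprod_inverse[of m N] by (simp add: hsym_gf_def mult.commute)

lemma esym_gf_self [simp]: "esym_gf m m (Suc r) = 0"
  by (simp add: esym_gf_def)

lemma hsym_gf_self [simp]: "hsym_gf m m (Suc r) = 0"
  by (simp add: hsym_gf_def)

text \<open>
  The recursion $e_{r+1}(X \cup \{z\}) = e_{r+1}(X) + z e_r(X)$ for elementary symmetric functions; for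
  the closed form it is the Leibniz rule divided by the product.
\<close>
lemma esym_gf_Suc:
  assumes "m \<le> N"
  shows "esym_gf m (Suc N) (Suc r) = esym_gf m N (Suc r) + power_gf {1..} (Suc N) * esym_gf m N r"
proof -
  define P where "P = linprod m N"
  define I where "I = inverse P"
  define L where "L = lin (Suc N)"
  define J where "J = inverse L"
  define X where "X = fps_const (1 / of_nat (Suc N)) * (fps_X :: rat fps)"
  have [simp]: "linprod m (Suc N) = L * P" using assms by (simp add: linprod_Suc P_def L_def)
  have PI: "P * I = 1" and LJ: "L * J = 1"
    by (simp_all add: P_def I_def L_def J_def linprod_inverse lin_inverse)
  have G: "power_gf {1..} (Suc N) = X * J"
  proof -
    have "power_gf {1..} (Suc N) = power_gf {1..} (Suc N) * (L * J)" by (simp add: LJ)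
    also have "\<dots> = X * J" using power_gf_pos[of "Suc N"] by (simp add: L_def X_def flip: mult.assoc)
    finally show ?thesis .
  qed
  have inv: "inverse (L * P) = J * I" by (simp add: fps_inverse_mult J_def I_def)
  have "hasse (Suc r) (L * P) = L * hasse (Suc r) P - X * hasse r P"
    unfolding L_def lin_def X_def by (rule hasse_linear_factor)
  hence "esym_gf m (Suc N) (Suc r) = (-1) ^ Suc r * (L * hasse (Suc r) P - X * hasse r P) * (J * I)"
    by (simp add: esym_gf_def inv)
  also have "\<dots> = (-1) ^ Suc r * hasse (Suc r) P * I * (L * J) + X * J * ((-1) ^ r * hasse r P * I)"
    by (simp add: algebra_simps)
  also have "\<dots> = esym_gf m N (Suc r) + power_gf {1..} (Suc N) * esym_gf m N r"
    by (simp only: LJ G esym_gf_def P_def I_def mult_1_right)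
  finally show ?thesis .
qed

text \<open>
  The recursion $h_{r+1}(X \cup \{z\}) = h_{r+1}(X) + z h_r(X \cup \{z\})$ for complete symmetric
  functions.
\<close>
lemma hsym_gf_Suc:
  assumes "m \<le> N"
  shows "hsym_gf m (Suc N) (Suc r) =
    hsym_gf m N (Suc r) + power_gf {1..} (Suc N) * hsym_gf m (Suc N) r"
proof -
  define P where "P = linprod m N"
  define I where "I = inverse P"
  define L where "L = lin (Suc N)"
  define J where "J = inverse L"
  define X where "X = fps_const (1 / of_nat (Suc N)) * (fps_X :: rat fps)"
  have [simp]: "linprod m (Suc N) = L * P" using assms by (simp add: linprod_Suc P_def L_def)
  have PI: "P * I = 1" and LJ: "L * J = 1"
    by (simp_all add: P_def I_def L_def J_def linprod_inverse lin_inverse)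
  have G: "power_gf {1..} (Suc N) * L = X"
    using power_gf_pos[of "Suc N"] by (simp add: L_def X_def)
  have inv: "inverse (L * P) = J * I" by (simp add: fps_inverse_mult J_def I_def)
  have "hasse (Suc r) (L * (J * I)) = L * hasse (Suc r) (J * I) - X * hasse r (J * I)"
    unfolding L_def lin_def X_def by (rule hasse_linear_factor)
  also have "L * (J * I) = I" by (simp add: LJ flip: mult.assoc)
  finally have *: "L * hasse (Suc r) (J * I) = hasse (Suc r) I + X * hasse r (J * I)"
    by simp
  have "hsym_gf m (Suc N) (Suc r) = (L * hasse (Suc r) (J * I)) * P"
    by (simp add: hsym_gf_def inv algebra_simps)
  also have "\<dots> = hasse (Suc r) I * P + power_gf {1..} (Suc N) * (hasse r (J * I) * (L * P))"
    unfolding * by (simp add: algebra_simps flip: G)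
  also have "\<dots> = hsym_gf m N (Suc r) + power_gf {1..} (Suc N) * hsym_gf m (Suc N) r"
    by (simp only: hsym_gf_def \<open>linprod m (Suc N) = L * P\<close> inv) (simp only: P_def I_def)
  finally show ?thesis .
qed

lemma mzeta_gf_pos: "mzeta_gf False N (replicate r {1..}) = esym_gf 0 N r"
proof (induction N arbitrary: r)
  case 0
  show ?case by (cases r) (simp_all add: replicate_append_same[symmetric])
next
  case (Suc N)
  show ?case
    by (cases r) (simp_all add: replicate_append_same[symmetric] mzeta_gf_snoc esym_gf_Suc
        flip: Suc.IH)
qed

lemma mzeta_star_gf_pos: "mzeta_gf True N (replicate r {1..}) = hsym_gf 0 N r"
proof (induction N arbitrary: r)
  case 0
  show ?case by (cases r) (simp_all add: replicate_append_same[symmetric])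
next
  case (Suc N)
  show ?case
    by (induction r) (simp_all add: replicate_append_same[symmetric] mzeta_gf_snoc hsym_gf_Suc
        flip: Suc.IH)
qed

text \<open>
  Grouping by the value \<open>m\<close> of the summation variable that belongs to the distinguished entry: the
  earlier variables are below \<open>m\<close>, the later ones above.
\<close>
lemma mzeta_gf_marked:
  "mzeta_gf False N (As @ [A] @ replicate t {1..}) =
     (\<Sum>m\<in>{1..N}. mzeta_gf False (m - 1) As * power_gf A m * esym_gf m N t)"
proof (induction N arbitrary: t)
  case 0
  show ?case
    using mzeta_gf_0[of False As A] mzeta_gf_0[of False "As @ [A] @ replicate (t - 1) {1..}" "{1..}"]
    by (cases t) (simp_all add: replicate_append_same)
next
  case (Suc N)
  show ?case
  proof (cases t)
    case 0
    have "mzeta_gf False (Suc N) (As @ [A]) = mzeta_gf False N (As @ [A] @ replicate 0 {1..})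
        + power_gf A (Suc N) * mzeta_gf False N As"
      by (simp add: mzeta_gf_snoc)
    thus ?thesis unfolding Suc.IH by (simp add: 0 algebra_simps)
  next
    case (Suc u)
    have "mzeta_gf False (Suc N) (As @ [A] @ replicate (Suc u) {1..}) =
       mzeta_gf False N (As @ [A] @ replicate (Suc u) {1..}) +
       power_gf {1..} (Suc N) * mzeta_gf False N (As @ [A] @ replicate u {1..})"
      using mzeta_gf_snoc[of False N "As @ [A] @ replicate u {1..}" "{1..}"]
      by (simp add: replicate_append_same)
    also have "\<dots> = (\<Sum>m\<in>{1..N}. mzeta_gf False (m - 1) As * power_gf A m * esym_gf m (Suc N) (Suc u))"
      unfolding Suc.IH sum_distrib_left sum.distrib[symmetric]
      by (rule sum.cong) (simp_all add: esym_gf_Suc algebra_simps)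
    finally show ?thesis by (simp add: Suc)
  qed
qed

text \<open>
  Here the earlier variables are at most \<open>m\<close> and the later ones at least \<open>m\<close>, which is why the
  last factor starts at \<open>m - 1\<close>.
\<close>
lemma mzeta_star_gf_marked:
  "mzeta_gf True N (As @ [A] @ replicate t {1..}) =
     (\<Sum>m\<in>{1..N}. mzeta_gf True m As * power_gf A m * hsym_gf (m - 1) N t)"
proof (induction N arbitrary: t)
  case 0
  show ?case
    using mzeta_gf_0[of True As A] mzeta_gf_0[of True "As @ [A] @ replicate (t - 1) {1..}" "{1..}"]
    by (cases t) (simp_all add: replicate_append_same)
next
  case (Suc N)
  note IH_N = Suc.IH
  show ?case
  proof (induction t)
    case 0
    have "mzeta_gf True (Suc N) (As @ [A]) = mzeta_gf True N (As @ [A] @ replicate 0 {1..})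
        + power_gf A (Suc N) * mzeta_gf True (Suc N) As"
      by (simp add: mzeta_gf_snoc)
    thus ?case unfolding IH_N by (simp add: algebra_simps)
  next
    case (Suc u)
    have "mzeta_gf True (Suc N) (As @ [A] @ replicate (Suc u) {1..}) =
       mzeta_gf True N (As @ [A] @ replicate (Suc u) {1..}) +
       power_gf {1..} (Suc N) * mzeta_gf True (Suc N) (As @ [A] @ replicate u {1..})"
      using mzeta_gf_snoc[of True N "As @ [A] @ replicate u {1..}" "{1..}"]
      by (simp add: replicate_append_same)
    also have "mzeta_gf True N (As @ [A] @ replicate (Suc u) {1..}) =
      (\<Sum>m\<in>{1..Suc N}. mzeta_gf True m As * power_gf A m *
         (if m = Suc N then 0 else hsym_gf (m - 1) N (Suc u)))"
      unfolding IH_N by simp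
    also have "\<dots> + power_gf {1..} (Suc N) * mzeta_gf True (Suc N) (As @ [A] @ replicate u {1..}) =
      (\<Sum>m\<in>{1..Suc N}. mzeta_gf True m As * power_gf A m * hsym_gf (m - 1) (Suc N) (Suc u))"
      unfolding Suc.IH sum_distrib_left sum.distrib[symmetric]
    proof (rule sum.cong[OF refl])
      fix m assume m: "m \<in> {1..Suc N}"
      have "hsym_gf (m - 1) (Suc N) (Suc u) = (if m = Suc N then 0 else hsym_gf (m - 1) N (Suc u))
          + power_gf {1..} (Suc N) * hsym_gf (m - 1) (Suc N) u"
        using m hsym_gf_Suc[of "m - 1" N u] by auto
      thus "mzeta_gf True m As * power_gf A m * (if m = Suc N then 0 else hsym_gf (m - 1) N (Suc u)) +
         power_gf {1..} (Suc N) * (mzeta_gf True m As * power_gf A m * hsym_gf (m - 1) (Suc N) u) =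
         mzeta_gf True m As * power_gf A m * hsym_gf (m - 1) (Suc N) (Suc u)"
        by (simp add: algebra_simps)
    qed
    finally show ?case .
  qed
qed

section \<open>The sums over indices as bilinear expressions\<close>

lemma indices_conv_list_all2:
  "indices k r = {ks. list_all2 (\<in>) ks (replicate r {1..}) \<and> sum_list ks = k}"
  by (auto simp: indices_def list_all2_conv_all_nth all_set_conv_all_nth)

lemma indices_at_conv_list_all2:
  assumes "1 \<le> i" "i \<le> r"
  shows "indices_at k r i = {ks. list_all2 (\<in>) ks
     (replicate (i - 1) {1..} @ [{2..}] @ replicate (r - i) {1..}) \<and> sum_list ks = k}"
proof -
  define As :: "nat set list" where "As = replicate (i - 1) {1..} @ [{2..}] @ replicate (r - i) {1..}"
  have len: "length As = r" using assms by (simp add: As_def)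
  have nth: "As ! j = (if j = i - 1 then {2..} else {1..})" if "j < r" for j
    using that assms by (auto simp: As_def nth_append nth_Cons')
  have "list_all2 (\<in>) ks As \<longleftrightarrow> length ks = r \<and> (\<forall>x\<in>set ks. 1 \<le> x) \<and> 2 \<le> ks ! (i - 1)" for ks
  proof (cases "length ks = r")
    case True
    have "list_all2 (\<in>) ks As \<longleftrightarrow> (\<forall>j<r. ks ! j \<in> (if j = i - 1 then {2..} else {1..}))"
      by (simp add: list_all2_conv_all_nth len True nth)
    also have "\<dots> \<longleftrightarrow> (\<forall>j<r. 1 \<le> ks ! j) \<and> 2 \<le> ks ! (i - 1)"
    proof (intro iffI conjI allI impI)
      fix j assume *: "\<forall>j<r. ks ! j \<in> (if j = i - 1 then {2..} else {1..})" "j < r"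
      hence "ks ! j \<in> (if j = i - 1 then {2..} else {1..})" by blast
      thus "1 \<le> ks ! j" by (cases "j = i - 1") simp_all
    next
      assume *: "\<forall>j<r. ks ! j \<in> (if j = i - 1 then {2..} else {1..})"
      have "i - 1 < r" using assms by linarith
      with * have "ks ! (i - 1) \<in> (if i - 1 = i - 1 then {2..} else {1..})" by blast
      thus "2 \<le> ks ! (i - 1)" by simp
    qed (simp split: if_splits)
    finally show ?thesis
      by (simp add: True all_set_conv_all_nth)
  qed (auto simp: len dest: list_all2_lengthD)
  thus ?thesis
    unfolding As_def[symmetric] by (auto simp: indices_at_def indices_def)
qed

text \<open>
  These coefficients are $(-1)^j \zeta_N(\{1\}^j)$ and, for \<open>m = 0\<close>, $\zeta^{\star}_N(\{1\}^j)$; for general \<open>m\<close>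
  the latter sum runs over variables in $\{m + 1, \dots, N\}$.
\<close>
definition ecoeff :: "nat \<Rightarrow> nat \<Rightarrow> rat" where
  "ecoeff N j = fps_nth (linprod 0 N) j"

definition hcoeff :: "nat \<Rightarrow> nat \<Rightarrow> nat \<Rightarrow> rat" where
  "hcoeff m N j = fps_nth (inverse (linprod m N)) j"

definition harm :: "nat \<Rightarrow> nat \<Rightarrow> rat" where
  "harm N k = (\<Sum>m\<in>{1..N}. 1 / of_nat m ^ k)"

lemma sum_indices_mzeta:
  "(\<Sum>ks\<in>indices k r. mzeta N ks) =
     (-1) ^ r * (\<Sum>j\<le>k. of_nat (j choose r) * ecoeff N j * hcoeff 0 N (k - j))"
proof -
  have "(\<Sum>ks\<in>indices k r. mzeta N ks) = fps_nth (esym_gf 0 N r) k"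
    by (simp add: indices_conv_list_all2 mzeta_gf_def flip: mzeta_gf_pos)
  also have "esym_gf 0 N r = fps_const ((-1) ^ r) * (hasse r (linprod 0 N) * inverse (linprod 0 N))"
    by (simp add: esym_gf_def mult.assoc flip: fps_const_power fps_const_neg)
  also have "fps_nth \<dots> k = (-1) ^ r * (\<Sum>j\<le>k. of_nat (j choose r) * ecoeff N j * hcoeff 0 N (k - j))"
    unfolding fps_mult_left_const_nth
    by (simp add: fps_mult_nth hasse_def ecoeff_def hcoeff_def atLeast0AtMost)
  finally show ?thesis .
qed

lemma sum_indices_mzeta_star:
  "(\<Sum>ks\<in>indices k r. mzeta_star N ks) =
     (\<Sum>j\<le>k. of_nat (j choose r) * hcoeff 0 N j * ecoeff N (k - j))"
proof -
  have "(\<Sum>ks\<in>indices k r. mzeta_star N ks) = fps_nth (hsym_gf 0 N r) k"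
    by (simp add: indices_conv_list_all2 mzeta_gf_def flip: mzeta_star_gf_pos)
  thus ?thesis
    by (simp add: hsym_gf_def fps_mult_nth hasse_def ecoeff_def hcoeff_def atLeast0AtMost)
qed

text \<open>
  In the notation of multiple harmonic sums these are $(-1)^{s+t} \zeta_N(\{1\}^s, 2, \{1\}^t)$ and
  $\zeta^{\star}_N(\{1\}^s, 2, \{1\}^t)$, grouped by the variable \<open>m\<close> with exponent $2$.
\<close>
definition marked :: "nat \<Rightarrow> nat \<Rightarrow> nat \<Rightarrow> rat" where
  "marked N s t = (\<Sum>m\<in>{1..N}. 1 / of_nat m ^ 2 * fps_nth (linprod 0 (m - 1)) s * fps_nth (linprod m N) t)"

definition marked_star :: "nat \<Rightarrow> nat \<Rightarrow> nat \<Rightarrow> rat" where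
  "marked_star N s t = (\<Sum>m\<in>{1..N}. 1 / of_nat m ^ 2 * hcoeff 0 m s * hcoeff (m - 1) N t)"

lemma sum_hasse_product_nth:
  "fps_nth (\<Sum>m\<in>M. fps_const (c m) * hasse a (f m) * hasse b (g m)) n =
   (\<Sum>s\<le>n. of_nat (s choose a) * of_nat (n - s choose b) *
      (\<Sum>m\<in>M. c m * fps_nth (f m) s * fps_nth (g m) (n - s)))"
proof -
  have "fps_nth (\<Sum>m\<in>M. fps_const (c m) * hasse a (f m) * hasse b (g m)) n =
     (\<Sum>m\<in>M. \<Sum>s\<le>n. c m * (fps_nth (hasse a (f m)) s * fps_nth (hasse b (g m)) (n - s)))"
    unfolding fps_sum_nth mult.assoc fps_mult_left_const_nth
    by (simp add: fps_mult_nth atLeast0AtMost sum_distrib_left)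
  also have "\<dots> = (\<Sum>s\<le>n. \<Sum>m\<in>M. c m * (fps_nth (hasse a (f m)) s * fps_nth (hasse b (g m)) (n - s)))"
    by (rule sum.swap)
  finally show ?thesis
    by (simp add: hasse_def sum_distrib_left mult_ac)
qed

text \<open>
  In \<open>mzeta_gf_marked\<close> the denominators of the two symmetric functions and of
  $(x/m)^2 / (1 - x/m)$ multiply to the full product, independently of \<open>m\<close>. What is left of the sum over
  \<open>m\<close> is $x^2$ times a combination of the numbers \<open>marked N s t\<close>.
\<close>
lemma sum_indices_at_mzeta:
  assumes "1 \<le> i" "i \<le> r" "2 \<le> k"
  shows "(\<Sum>ks\<in>indices_at k r i. mzeta N ks) =
     (-1) ^ (r - 1) * (\<Sum>n\<le>k - 2. (\<Sum>s\<le>n. of_nat (s choose (i - 1)) * of_nat (n - s choose (r - i)) *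
        marked N s (n - s)) * hcoeff 0 N (k - 2 - n))"
proof -
  define F where "F = (\<Sum>m\<in>{1..N}. fps_const (1 / of_nat m ^ 2) * hasse (i - 1) (linprod 0 (m - 1)) *
     hasse (r - i) (linprod m N))"
  have sgn: "(-1) ^ (i - 1) * (-1) ^ (r - i) = ((-1) ^ (r - 1) :: rat fps)"
    using assms by (simp flip: power_add)
  have "mzeta_gf False N (replicate (i - 1) {1..} @ [{2..}] @ replicate (r - i) {1..}) =
     (\<Sum>m\<in>{1..N}. esym_gf 0 (m - 1) (i - 1) * power_gf {2..} m * esym_gf m N (r - i))"
    by (simp only: mzeta_gf_marked mzeta_gf_pos)
  also have "\<dots> = (\<Sum>m\<in>{1..N}. fps_X ^ 2 * ((-1) ^ (r - 1) * (fps_const (1 / of_nat m ^ 2) *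
      hasse (i - 1) (linprod 0 (m - 1)) * hasse (r - i) (linprod m N) * inverse (linprod 0 N))))"
  proof (rule sum.cong[OF refl])
    fix m assume m: "m \<in> {1..N}"
    define A B L where "A = linprod 0 (m - 1)" and "B = linprod m N" and "L = lin m"
    have "linprod 0 m = A * L"
      using linprod_Suc[of 0 "m - 1"] m by (simp add: A_def L_def)
    hence *: "linprod 0 N = A * L * B"
      using linprod_split[of 0 m N] m by (simp add: B_def)
    have G: "power_gf {2..} m = fps_const (1 / of_nat m ^ 2) * fps_X ^ 2 * inverse L"
    proof -
      have "power_gf {2..} m = power_gf {2..} m * (lin m * inverse (lin m))" by (simp add: lin_inverse)
      also have "\<dots> = fps_const (1 / of_nat m ^ 2) * fps_X ^ 2 * inverse L"
        using power_gf_ge_2[of m] m by (simp add: L_def flip: mult.assoc)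
      finally show ?thesis .
    qed
    show "esym_gf 0 (m - 1) (i - 1) * power_gf {2..} m * esym_gf m N (r - i) =
      fps_X ^ 2 * ((-1) ^ (r - 1) * (fps_const (1 / of_nat m ^ 2) *
      hasse (i - 1) (linprod 0 (m - 1)) * hasse (r - i) (linprod m N) * inverse (linprod 0 N)))"
      unfolding esym_gf_def G * sgn[symmetric]
      by (simp only: A_def[symmetric] B_def[symmetric] fps_inverse_mult mult_ac)
  qed
  also have "\<dots> = fps_X ^ 2 * (fps_const ((-1) ^ (r - 1)) * (F * inverse (linprod 0 N)))"
    by (simp only: F_def sum_distrib_left sum_distrib_right fps_const_power[symmetric]
        fps_const_neg[symmetric] fps_const_1_eq_1)
  finally have "(\<Sum>ks\<in>indices_at k r i. mzeta N ks) =
      fps_nth (fps_X ^ 2 * (fps_const ((-1) ^ (r - 1)) * (F * inverse (linprod 0 N)))) k"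
    using assms by (simp add: indices_at_conv_list_all2 mzeta_gf_def fps_eq_iff)
  also have "\<dots> = fps_nth (fps_const ((-1) ^ (r - 1)) * (F * inverse (linprod 0 N))) (k - 2)"
    using assms by (simp only: fps_X_power_mult_nth) simp
  also have "\<dots> = (-1) ^ (r - 1) * fps_nth (F * inverse (linprod 0 N)) (k - 2)"
    by (rule fps_mult_left_const_nth)
  also have "fps_nth (F * inverse (linprod 0 N)) (k - 2) =
      (\<Sum>n\<le>k - 2. fps_nth F n * hcoeff 0 N (k - 2 - n))"
    by (simp only: fps_mult_nth hcoeff_def atLeast0AtMost)
  finally show ?thesis
    by (simp only: F_def sum_hasse_product_nth marked_def)
qed

lemma sum_indices_at_mzeta_star:
  assumes "1 \<le> i" "i \<le> r" "2 \<le> k"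
  shows "(\<Sum>ks\<in>indices_at k r i. mzeta_star N ks) =
     (\<Sum>n\<le>k - 2. (\<Sum>s\<le>n. of_nat (s choose (i - 1)) * of_nat (n - s choose (r - i)) *
        marked_star N s (n - s)) * ecoeff N (k - 2 - n))"
proof -
  define F where "F = (\<Sum>m\<in>{1..N}. fps_const (1 / of_nat m ^ 2) * hasse (i - 1) (inverse (linprod 0 m)) *
     hasse (r - i) (inverse (linprod (m - 1) N)))"
  have "mzeta_gf True N (replicate (i - 1) {1..} @ [{2..}] @ replicate (r - i) {1..}) =
     (\<Sum>m\<in>{1..N}. hsym_gf 0 m (i - 1) * power_gf {2..} m * hsym_gf (m - 1) N (r - i))"
    by (simp only: mzeta_star_gf_marked mzeta_star_gf_pos)
  also have "\<dots> = (\<Sum>m\<in>{1..N}. fps_X ^ 2 * (fps_const (1 / of_nat m ^ 2) *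
      hasse (i - 1) (inverse (linprod 0 m)) * hasse (r - i) (inverse (linprod (m - 1) N)) * linprod 0 N))"
  proof (rule sum.cong[OF refl])
    fix m assume m: "m \<in> {1..N}"
    have 1: "linprod 0 m = linprod 0 (m - 1) * lin m"
      using linprod_Suc[of 0 "m - 1"] m by simp
    have "m - 1 \<le> N" using m by auto
    hence 2: "linprod 0 N = linprod 0 (m - 1) * linprod (m - 1) N"
      by (intro linprod_split) auto
    have "power_gf {2..} m * linprod 0 m * linprod (m - 1) N = (power_gf {2..} m * lin m) * linprod 0 N"
      unfolding 1 2 by (simp only: mult_ac)
    also have "\<dots> = fps_X ^ 2 * fps_const (1 / of_nat m ^ 2) * linprod 0 N"
      using m by (subst power_gf_ge_2) (auto simp: mult_ac)
    finally have G: "power_gf {2..} m * linprod 0 m * linprod (m - 1) N =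
      fps_X ^ 2 * fps_const (1 / of_nat m ^ 2) * linprod 0 N" .
    have "hsym_gf 0 m (i - 1) * power_gf {2..} m * hsym_gf (m - 1) N (r - i) =
      hasse (i - 1) (inverse (linprod 0 m)) * hasse (r - i) (inverse (linprod (m - 1) N)) *
      (power_gf {2..} m * linprod 0 m * linprod (m - 1) N)"
      by (simp only: hsym_gf_def mult_ac)
    also have "\<dots> = fps_X ^ 2 * (fps_const (1 / of_nat m ^ 2) *
      hasse (i - 1) (inverse (linprod 0 m)) * hasse (r - i) (inverse (linprod (m - 1) N)) * linprod 0 N)"
      unfolding G by (simp only: mult_ac)
    finally show "hsym_gf 0 m (i - 1) * power_gf {2..} m * hsym_gf (m - 1) N (r - i) = \<dots>" .
  qed
  also have "\<dots> = fps_X ^ 2 * (F * linprod 0 N)"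
    by (simp only: F_def sum_distrib_left sum_distrib_right)
  finally have "(\<Sum>ks\<in>indices_at k r i. mzeta_star N ks) = fps_nth (fps_X ^ 2 * (F * linprod 0 N)) k"
    using assms by (simp add: indices_at_conv_list_all2 mzeta_gf_def fps_eq_iff)
  also have "\<dots> = fps_nth (F * linprod 0 N) (k - 2)"
    using assms by (simp only: fps_X_power_mult_nth) simp
  also have "\<dots> = (\<Sum>n\<le>k - 2. fps_nth F n * ecoeff N (k - 2 - n))"
    by (simp only: fps_mult_nth ecoeff_def atLeast0AtMost)
  finally show ?thesis
    by (simp only: F_def sum_hasse_product_nth marked_star_def hcoeff_def)
qed

text \<open>
  Newton's identities, read off from the two closed forms for depth one.
\<close>
lemma newton_ecoeff: "of_nat k * ecoeff N k = - (\<Sum>i\<in>{1..k}. harm N i * ecoeff N (k - i))"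
  and newton_hcoeff: "of_nat k * hcoeff 0 N k = (\<Sum>i\<in>{1..k}. harm N i * hcoeff 0 N (k - i))"
proof -
  define H where "H = (\<Sum>m\<in>{1..N}. power_gf {1..} m)"
  have nth: "fps_nth H i = (if i = 0 then 0 else harm N i)" for i
    by (simp add: H_def fps_sum_nth power_gf_def harm_def)
  have conv: "fps_nth (H * f) k = (\<Sum>i\<in>{1..k}. harm N i * fps_nth f (k - i))" for f
    by (simp add: fps_mult_nth nth sum.atLeast_Suc_atMost)
  have "H = esym_gf 0 N 1"
    using mzeta_gf_marked[of N "[]" "{1..}" 0] mzeta_gf_pos[of N 1] by (simp add: H_def)
  hence "H * linprod 0 N = - hasse 1 (linprod 0 N)"
    using linprod_inverse[of 0 N] by (simp add: esym_gf_def mult_ac)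
  hence "fps_nth (H * linprod 0 N) k = - (of_nat k * ecoeff N k)"
    by (simp add: hasse_def ecoeff_def)
  thus "of_nat k * ecoeff N k = - (\<Sum>i\<in>{1..k}. harm N i * ecoeff N (k - i))"
    unfolding conv by (simp add: ecoeff_def)
  have "H = hsym_gf 0 N 1"
    using mzeta_star_gf_marked[of N "[]" "{1..}" 0] mzeta_star_gf_pos[of N 1] by (simp add: H_def)
  hence "H * inverse (linprod 0 N) = hasse 1 (inverse (linprod 0 N))"
    using linprod_inverse[of 0 N] by (simp add: hsym_gf_def mult_ac)
  hence "fps_nth (H * inverse (linprod 0 N)) k = of_nat k * hcoeff 0 N k"
    by (simp add: hasse_def hcoeff_def)
  thus "of_nat k * hcoeff 0 N k = (\<Sum>i\<in>{1..k}. harm N i * hcoeff 0 N (k - i))"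
    unfolding conv by (simp add: hcoeff_def)
qed

text \<open>
  The product over $j < m$ is the full product times the inverse of the product over $j \ge m$. This
  exchanges the roles of the two sides of \<open>m\<close>, hence of \<open>s\<close> and \<open>t\<close>.
\<close>
lemma marked_conv_marked_star:
  "marked N s t = (\<Sum>i\<le>s. \<Sum>j\<le>t. ecoeff N i * ecoeff N j * marked_star N (t - j) (s - i))"
proof -
  have "fps_nth (linprod 0 (m - 1)) s * fps_nth (linprod m N) t =
    (\<Sum>i\<le>s. \<Sum>j\<le>t. ecoeff N i * ecoeff N j * (hcoeff 0 m (t - j) * hcoeff (m - 1) N (s - i)))"
    if "m \<in> {1..N}" for m
  proof -
    have le: "m - 1 \<le> N" using that by auto
    have 1: "linprod 0 (m - 1) = linprod 0 N * inverse (linprod (m - 1) N)"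
      by (simp only: linprod_split[OF le0 le] mult.assoc linprod_inverse mult_1_right)
    have 2: "linprod m N = linprod 0 N * inverse (linprod 0 m)"
      using linprod_split[of 0 m N] linprod_inverse[of 0 m] that
      by (metis atLeastAtMost_iff le0 mult.assoc mult.commute mult_1_right)
    show ?thesis unfolding 1 2
      unfolding fps_mult_nth sum_product by (simp add: atLeast0AtMost ecoeff_def hcoeff_def mult_ac)
  qed
  hence "marked N s t = (\<Sum>m\<in>{1..N}. 1 / of_nat m ^ 2 *
    (\<Sum>i\<le>s. \<Sum>j\<le>t. ecoeff N i * ecoeff N j * (hcoeff 0 m (t - j) * hcoeff (m - 1) N (s - i))))"
    unfolding marked_def by (intro sum.cong) (auto simp: mult.assoc)
  also have "\<dots> = (\<Sum>i\<le>s. \<Sum>j\<le>t. \<Sum>m\<in>{1..N}. 1 / of_nat m ^ 2 *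
    (ecoeff N i * ecoeff N j * (hcoeff 0 m (t - j) * hcoeff (m - 1) N (s - i))))"
    unfolding sum_distrib_left by (subst sum.swap) (intro sum.cong refl sum.swap)
  finally show ?thesis
    unfolding marked_star_def sum_distrib_left by (simp add: mult_ac)
qed

section \<open>Duality\<close>

text \<open>
  The functional behind the duality of finite multiple harmonic sums.
\<close>
definition alt_binom_sum :: "nat \<Rightarrow> (nat \<Rightarrow> rat) \<Rightarrow> rat" where
  "alt_binom_sum N f = (\<Sum>l\<in>{1..N}. (-1) ^ (l - 1) * of_nat (N choose l) * f l)"

lemma binomial_pred_absorb:
  "1 \<le> l \<Longrightarrow> of_nat (N choose (l - 1)) = (of_nat l / of_nat (Suc N) * of_nat (Suc N choose l) :: rat)"
proof -
  assume "1 \<le> l"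
  hence "Suc N * (N choose (l - 1)) = (Suc N choose l) * l"
    using Suc_times_binomial_eq[of N "l - 1"] by simp
  hence "of_nat (Suc N) * of_nat (N choose (l - 1)) = (of_nat (Suc N choose l) * of_nat l :: rat)"
    by (metis of_nat_mult)
  thus ?thesis by (simp add: field_simps del: of_nat_Suc binomial_Suc_Suc)
qed

text \<open>
  Pascal's rule and $\binom{N}{l-1} = \frac{l}{N+1} \binom{N+1}{l}$: on functions of the form $g(l)/l$ this
  is the recursion in \<open>N\<close> that star sums satisfy.
\<close>
lemma alt_binom_sum_Suc:
  "alt_binom_sum (Suc N) f =
    alt_binom_sum N f + alt_binom_sum (Suc N) (\<lambda>l. of_nat l * f l) / of_nat (Suc N)"
proof -
  have "alt_binom_sum (Suc N) f = (\<Sum>l\<in>{1..Suc N}. (-1) ^ (l - 1) * of_nat (N choose l) * f l +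
     (-1) ^ (l - 1) * of_nat (N choose (l - 1)) * f l)"
    unfolding alt_binom_sum_def
  proof (rule sum.cong[OF refl])
    fix l assume "l \<in> {1..Suc N}"
    then obtain j where "l = Suc j" by (cases l) auto
    thus "(-1) ^ (l - 1) * of_nat (Suc N choose l) * f l =
      (-1) ^ (l - 1) * of_nat (N choose l) * f l + (-1) ^ (l - 1) * of_nat (N choose (l - 1)) * f l"
      by (simp add: algebra_simps)
  qed
  also have "\<dots> = alt_binom_sum N f + (\<Sum>l\<in>{1..Suc N}. (-1) ^ (l - 1) * of_nat (N choose (l - 1)) * f l)"
    by (simp add: sum.distrib alt_binom_sum_def)
  also have "(\<Sum>l\<in>{1..Suc N}. (-1) ^ (l - 1) * of_nat (N choose (l - 1)) * f l) =
      alt_binom_sum (Suc N) (\<lambda>l. of_nat l * f l) / of_nat (Suc N)"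
    unfolding alt_binom_sum_def sum_divide_distrib
    by (intro sum.cong refl) (simp add: binomial_pred_absorb del: of_nat_Suc binomial_Suc_Suc One_nat_def)
  finally show ?thesis .
qed

text \<open>
  Summation by parts; the partial sums of the alternating binomial coefficients are again binomial
  coefficients.
\<close>
lemma alt_binom_sum_partial_sums:
  "alt_binom_sum (Suc N) (\<lambda>l. \<Sum>n\<in>{1..l}. g n) =
    alt_binom_sum (Suc N) (\<lambda>l. of_nat l * g l) / of_nat (Suc N)"
proof -
  let ?A = "\<lambda>l. \<Sum>n\<in>{1..l}. g n"
  have "alt_binom_sum (Suc N) (\<lambda>l. of_nat l * ?A l) / of_nat (Suc N) =
    (\<Sum>l\<in>{1..Suc N}. (-1) ^ (l - 1) * of_nat (N choose (l - 1)) * ?A l)"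
    unfolding alt_binom_sum_def sum_divide_distrib
    by (intro sum.cong refl) (simp add: binomial_pred_absorb del: of_nat_Suc binomial_Suc_Suc One_nat_def)
  also have "\<dots> = (\<Sum>l\<le>N. (-1) ^ l * of_nat (N choose l) * ?A (Suc l))"
    by (rule sum.reindex_bij_witness[of _ Suc "\<lambda>l. l - 1"]) auto
  finally have 1: "alt_binom_sum (Suc N) (\<lambda>l. of_nat l * ?A l) / of_nat (Suc N) = \<dots>" .
  have "alt_binom_sum (Suc N) (\<lambda>l. of_nat l * g l) / of_nat (Suc N) =
    (\<Sum>l\<in>{1..Suc N}. (-1) ^ (l - 1) * of_nat (N choose (l - 1)) * g l)"
    unfolding alt_binom_sum_def sum_divide_distrib
    by (intro sum.cong refl) (simp add: binomial_pred_absorb del: of_nat_Suc binomial_Suc_Suc One_nat_def)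
  also have "\<dots> = (\<Sum>l\<le>N. (-1) ^ l * of_nat (N choose l) * g (Suc l))"
    by (rule sum.reindex_bij_witness[of _ Suc "\<lambda>l. l - 1"]) auto
  finally have 2: "alt_binom_sum (Suc N) (\<lambda>l. of_nat l * g l) / of_nat (Suc N) = \<dots>" .
  have "alt_binom_sum N ?A = (\<Sum>l\<in>{1..N}. - ((-1) ^ l * of_nat (N choose l) * ?A l))"
    unfolding alt_binom_sum_def
  proof (rule sum.cong[OF refl])
    fix l assume "l \<in> {1..N}"
    then obtain j where "l = Suc j" by (cases l) auto
    thus "(-1) ^ (l - 1) * of_nat (N choose l) * ?A l = - ((-1) ^ l * of_nat (N choose l) * ?A l)"
      by simp
  qed
  also have "\<dots> = (\<Sum>l\<le>N. - ((-1) ^ l * of_nat (N choose l) * ?A l))"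
    by (rule sum.mono_neutral_left) auto
  finally have 3: "alt_binom_sum N ?A = \<dots>" .
  have "(\<Sum>l\<le>N. - ((-1) ^ l * of_nat (N choose l) * ?A l)) +
      (\<Sum>l\<le>N. (-1) ^ l * of_nat (N choose l) * ?A (Suc l)) =
      (\<Sum>l\<le>N. (-1) ^ l * of_nat (N choose l) * g (Suc l))"
    unfolding sum.distrib[symmetric] by (rule sum.cong) (simp_all add: algebra_simps)
  thus ?thesis
    by (simp only: alt_binom_sum_Suc[of N ?A] 1 2 3)
qed

lemma alt_binom_sum_one: "alt_binom_sum (Suc N) (\<lambda>_. 1) = 1"
proof -
  have "alt_binom_sum (Suc N) (\<lambda>_. 1) = alt_binom_sum (Suc N) (\<lambda>l. \<Sum>n\<in>{1..l}. if n = 1 then 1 else 0)"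
    unfolding alt_binom_sum_def by (intro sum.cong) auto
  also have "\<dots> = alt_binom_sum (Suc N) (\<lambda>l. of_nat l * (if l = 1 then 1 else 0)) / of_nat (Suc N)"
    by (rule alt_binom_sum_partial_sums)
  also have "alt_binom_sum (Suc N) (\<lambda>l. of_nat l * (if l = 1 then 1 else 0)) =
     (\<Sum>l\<in>{1..Suc N}. if l = 1 then of_nat (Suc N) else 0)"
    unfolding alt_binom_sum_def by (intro sum.cong) auto
  finally show ?thesis by simp
qed

lemma hcoeff_0 [simp]: "hcoeff m N 0 = 1"
  by (simp add: hcoeff_def)

lemma hcoeff_self [simp]: "hcoeff m m (Suc j) = 0"
  by (simp add: hcoeff_def)

lemma hcoeff_Suc:
  assumes "m \<le> N"
  shows "hcoeff m (Suc N) (Suc j) = hcoeff m N (Suc j) + hcoeff m (Suc N) j / of_nat (Suc N)"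
proof -
  have "lin (Suc N) * inverse (linprod m (Suc N)) = (lin (Suc N) * inverse (lin (Suc N))) * inverse (linprod m N)"
    using assms by (simp add: linprod_Suc fps_inverse_mult mult_ac)
  hence "lin (Suc N) * inverse (linprod m (Suc N)) = inverse (linprod m N)"
    by (simp add: lin_inverse)
  hence "fps_nth (lin (Suc N) * inverse (linprod m (Suc N))) (Suc j) = hcoeff m N (Suc j)"
    by (simp add: hcoeff_def)
  thus ?thesis
    by (simp add: lin_def left_diff_distrib mult.assoc hcoeff_def)
qed

text \<open>
  Both sides satisfy the same recursion in \<open>N\<close> and \<open>k\<close>. Equivalently, this is the partial fraction
  decomposition of $\prod_{j \le N} (1 - x/j)^{-1}$.
\<close>
lemma hcoeff_dual: "alt_binom_sum (Suc N) (\<lambda>l. 1 / of_nat l ^ k) = hcoeff 0 (Suc N) k"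
proof (induction k arbitrary: N)
  case 0
  show ?case by (simp add: alt_binom_sum_one)
next
  case (Suc k)
  have eq: "alt_binom_sum (Suc N) (\<lambda>l. of_nat l * (1 / of_nat l ^ Suc k)) =
    alt_binom_sum (Suc N) (\<lambda>l. 1 / of_nat l ^ k)" for N
    unfolding alt_binom_sum_def by (intro sum.cong) auto
  have "alt_binom_sum N (\<lambda>l. 1 / of_nat l ^ Suc k) = hcoeff 0 N (Suc k)" for N
  proof (induction N)
    case 0
    show ?case by (simp add: alt_binom_sum_def)
  next
    case (Suc M)
    show ?case
      unfolding alt_binom_sum_Suc[of M] eq Suc.IH \<open>\<And>N. alt_binom_sum (Suc N) (\<lambda>l. 1 / of_nat l ^ k) = hcoeff 0 (Suc N) k\<close>
      by (simp add: hcoeff_Suc)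
  qed
  thus ?case .
qed

text \<open>
  The dual of the index $(\{1\}^t, 2, \{1\}^s)$ is $(t+1, s+1)$. As before, the proof compares recursions:
  in \<open>s\<close> by \<open>alt_binom_sum_Suc\<close>, and for \<open>s = 0\<close> by \<open>alt_binom_sum_partial_sums\<close>, which reduces the claim to
  depth one.
\<close>
lemma marked_star_dual:
  "marked_star N t s =
     alt_binom_sum N (\<lambda>l. (\<Sum>n\<in>{1..l}. 1 / of_nat n ^ Suc t) / of_nat l ^ Suc s)"
proof (induction N arbitrary: s)
  case 0
  show ?case by (simp add: marked_star_def alt_binom_sum_def)
next
  case (Suc N)
  let ?A = "\<lambda>l. \<Sum>n\<in>{1..l}. 1 / of_nat n ^ Suc t :: rat"
  note IH_N = Suc.IH
  show ?case
  proof (induction s)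
    case 0
    have "marked_star (Suc N) t 0 = marked_star N t 0 + hcoeff 0 (Suc N) t / of_nat (Suc N) ^ 2"
      by (simp add: marked_star_def)
    also have "hcoeff 0 (Suc N) t = alt_binom_sum (Suc N) (\<lambda>l. of_nat l * (1 / of_nat l ^ Suc t))"
      unfolding hcoeff_dual[symmetric] alt_binom_sum_def by (intro sum.cong) auto
    also have "\<dots> / of_nat (Suc N) ^ 2 = alt_binom_sum (Suc N) ?A / of_nat (Suc N)"
      unfolding alt_binom_sum_partial_sums by (simp add: power2_eq_square)
    also have "alt_binom_sum (Suc N) ?A = alt_binom_sum (Suc N) (\<lambda>l. of_nat l * (?A l / of_nat l ^ Suc 0))"
      unfolding alt_binom_sum_def by (intro sum.cong) auto
    finally show ?case
      unfolding IH_N by (simp only: alt_binom_sum_Suc[symmetric])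
  next
    case (Suc s)
    have "marked_star (Suc N) t (Suc s) = marked_star N t (Suc s) + marked_star (Suc N) t s / of_nat (Suc N)"
    proof -
      have eq: "marked_star N t (Suc s) =
        (\<Sum>m\<in>{1..Suc N}. 1 / of_nat m ^ 2 * hcoeff 0 m t * hcoeff (m - 1) N (Suc s))"
        unfolding marked_star_def by simp
      show ?thesis
        unfolding eq unfolding marked_star_def sum_divide_distrib sum.distrib[symmetric]
      proof (rule sum.cong[OF refl])
        fix m assume "m \<in> {1..Suc N}"
        hence "m - 1 \<le> N" by auto
        thus "1 / of_nat m ^ 2 * hcoeff 0 m t * hcoeff (m - 1) (Suc N) (Suc s) =
          1 / of_nat m ^ 2 * hcoeff 0 m t * hcoeff (m - 1) N (Suc s) +
          1 / of_nat m ^ 2 * hcoeff 0 m t * hcoeff (m - 1) (Suc N) s / of_nat (Suc N)"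
          by (simp only: hcoeff_Suc distrib_left times_divide_eq_right)
      qed
    qed
    also have "marked_star (Suc N) t s =
       alt_binom_sum (Suc N) (\<lambda>l. of_nat l * (?A l / of_nat l ^ Suc (Suc s)))"
      unfolding Suc.IH alt_binom_sum_def by (intro sum.cong) auto
    finally show ?case
      unfolding IH_N by (simp only: alt_binom_sum_Suc[symmetric])
  qed
qed

section \<open>Power sums and double sums modulo $p$\<close>

text \<open>
  Multiply the defining series $t / (e^t - 1)$ by $e^{lt} - 1 = (e^t - 1) \sum_{n<l} e^{nt}$ and compare
  coefficients of $t^{q+1}$.
\<close>
lemma faulhaber:
  "(\<Sum>n<l. of_nat n ^ q) =
     (\<Sum>j\<le>q. of_nat (Suc q choose j) * bernoulli j * of_nat l ^ (Suc q - j)) / of_nat (Suc q)"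
proof -
  let ?B = "Abs_fps (\<lambda>n. bernoulli n / fact n)" and ?E = "fps_exp (1::rat)"
  have "?E ^ n = fps_exp (of_nat n)" for n
    by (simp add: fps_exp_power_mult)
  hence "fps_exp (of_nat l) - 1 = (?E - 1) * (\<Sum>n<l. fps_exp (of_nat n :: rat))"
    using power_diff_1_eq[of ?E l] by simp
  hence "?B * (fps_exp (of_nat l) - 1) = (?B * (?E - 1)) * (\<Sum>n<l. fps_exp (of_nat n))"
    by (simp only: mult.assoc)
  hence *: "?B * (fps_exp (of_nat l) - 1) = fps_X * (\<Sum>n<l. fps_exp (of_nat n))"
    unfolding bernoulli_fps .
  have "fps_nth (?B * (fps_exp (of_nat l) - 1)) (Suc q) =
     (\<Sum>j\<le>q. bernoulli j / fact j * (of_nat l ^ (Suc q - j) / fact (Suc q - j)))"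
    unfolding fps_mult_nth atLeast0AtMost sum.atMost_Suc
    by (auto intro!: sum.cong simp del: fact_Suc)
  also have "\<dots> = (\<Sum>j\<le>q. of_nat (Suc q choose j) * bernoulli j * of_nat l ^ (Suc q - j)) / fact (Suc q)"
    unfolding sum_divide_distrib
    by (intro sum.cong refl) (simp add: binomial_fact del: fact_Suc binomial_Suc_Suc)
  finally have "(\<Sum>n<l. of_nat n ^ q) / fact q =
    (\<Sum>j\<le>q. of_nat (Suc q choose j) * bernoulli j * of_nat l ^ (Suc q - j)) / fact (Suc q)"
    unfolding * by (simp add: fps_sum_nth sum_divide_distrib)
  thus ?thesis
    by (simp add: field_simps del: binomial_Suc_Suc of_nat_Suc)
qed

text \<open>
  The double sum $\zeta^{\star}_N(a, b)$.
\<close>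
definition harm2 :: "nat \<Rightarrow> nat \<Rightarrow> nat \<Rightarrow> rat" where
  "harm2 N a b = (\<Sum>l\<in>{1..N}. harm l a / of_nat l ^ b)"

lemma harm2_stuffle: "harm2 N a b + harm2 N b a = harm N a * harm N b + harm N (a + b)"
  by (induction N) (auto simp: harm2_def harm_def algebra_simps power_add add_divide_distrib)

context at_prime
begin

text \<open>
  The recursion divides by $j + 1 < p$ only.
\<close>
lemma bernoulli_Zp: "j + 2 \<le> p \<Longrightarrow> bernoulli j \<in> Zp 0"
proof (induction j rule: less_induct)
  case (less j)
  show ?case
  proof (cases "j = 0")
    case False
    have "(\<Sum>i<j. of_nat (Suc j choose i) * bernoulli i) \<in> Zp 0"
      using less by (intro Zp_sum Zp_mult_left) auto
    thus ?thesis
      using less.prems False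
      by (subst bernoulli.simps, simp only: if_False) (intro Zp_divide Zp_minus, auto)
  qed (simp add: bernoulli.simps)
qed

text \<open>
  In Faulhaber's formula for \<open>l = p\<close> every term contains a positive power of \<open>p\<close>, and all Bernoulli
  numbers that occur are \<open>p\<close>-integral.
\<close>
lemma power_sum_Zp:
  assumes "1 \<le> e" "e + 2 \<le> p"
  shows "(\<Sum>n\<in>{1..p - 1}. of_nat n ^ e) \<in> Zp 1"
proof -
  have "(\<Sum>n<p. of_nat n ^ e :: rat) = (\<Sum>n\<in>{1..p - 1}. of_nat n ^ e)"
    using assms by (intro sum.mono_neutral_right) (auto simp: Suc_le_eq)
  moreover have "(\<Sum>n<p. of_nat n ^ e) \<in> Zp 1"
    unfolding faulhaber
  proof (intro Zp_divide Zp_sum)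
    fix j assume j: "j \<in> {..e}"
    have "of_nat (Suc e choose j) * bernoulli j \<in> Zp 0"
      using j assms by (intro Zp_mult_left bernoulli_Zp) auto
    moreover have "(of_nat p :: rat) ^ (Suc e - j) \<in> Zp 1"
      using j by (intro Zp_mono[OF Zp_p_power]) auto
    ultimately show "of_nat (Suc e choose j) * bernoulli j * of_nat p ^ (Suc e - j) \<in> Zp 1"
      by (rule Zp_mult_left)
  qed (use assms in auto)
  ultimately show ?thesis by simp
qed

lemma fermat_zcong:
  assumes "1 \<le> n" "n < p" "a \<le> p - 1"
  shows "1 / of_nat n ^ a \<sim>\<^bsub>1\<^esub> of_nat n ^ (p - 1 - a)"
proof -
  have "[n ^ (p - 1) = 1] (mod p)"
    using assms by (intro fermat_theorem prime_p) (auto simp: nat_dvd_not_less)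
  hence "int p dvd int n ^ (p - 1) - 1"
    by (metis cong_iff_dvd_diff cong_int_iff of_nat_1 of_nat_power)
  then obtain c where "int n ^ (p - 1) - 1 = int p * c" ..
  hence "(of_nat n :: rat) ^ (p - 1) - 1 = of_nat p * of_int c"
    by (metis of_int_1 of_int_diff of_int_mult of_int_of_nat_eq of_int_power)
  hence "(of_nat n :: rat) ^ (p - 1) - 1 \<in> Zp 1"
    using Zp_mult_right[OF Zp_p Zp_of_int, of c] by simp
  hence "((of_nat n :: rat) ^ (p - 1) - 1) / of_nat n ^ a \<in> Zp 1"
    using assms by (intro Zp_divide_power) auto
  moreover have "(of_nat n :: rat) ^ (p - 1) = of_nat n ^ (p - 1 - a) * of_nat n ^ a"
    using assms by (simp flip: power_add)
  ultimately have "of_nat n ^ (p - 1 - a) - 1 / of_nat n ^ a \<in> Zp 1"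
    using assms by (simp add: diff_divide_distrib)
  thus ?thesis
    using zcong_sym unfolding zcong_def[of "of_nat n ^ (p - 1 - a)", symmetric] by blast
qed

abbreviation H :: "nat \<Rightarrow> rat" where
  "H \<equiv> harm (p - 1)"

lemma one_over_power_Zp: "1 \<le> n \<Longrightarrow> n < p \<Longrightarrow> 1 / of_nat n ^ a \<in> Zp 0"
  by (intro Zp_divide_power) auto

lemma harm_Zp_0: "l < p \<Longrightarrow> harm l a \<in> Zp 0"
  unfolding harm_def by (intro Zp_sum one_over_power_Zp) auto

lemma H_Zp_1:
  assumes "1 \<le> k" "k + 2 \<le> p"
  shows "H k \<in> Zp 1"
proof (rule zcong_in)
  show "H k \<sim>\<^bsub>1\<^esub> (\<Sum>n\<in>{1..p - 1}. of_nat n ^ (p - 1 - k))"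
    unfolding harm_def using assms by (intro zcong_sum fermat_zcong) auto
  show "(\<Sum>n\<in>{1..p - 1}. of_nat n ^ (p - 1 - k)) \<in> Zp 1"
    using assms by (intro power_sum_Zp) auto
qed

text \<open>
  The exponent $u - b$ has absolute value below $p - 1$, so it is a multiple of $p - 1$ only if it
  vanishes.
\<close>
lemma quotient_power_sum:
  assumes "1 \<le> u" "u < p" "1 \<le> b" "b < p"
  shows "(\<Sum>l\<in>{1..p - 1}. of_nat l ^ u / of_nat l ^ b) \<sim>\<^bsub>1\<^esub> (if u = b then -1 else 0)"
proof -
  consider "u = b" | "u > b" | "u < b" by linarith
  thus ?thesis
  proof cases
    case 1
    have "(\<Sum>l\<in>{1..p - 1}. of_nat l ^ u / of_nat l ^ b) = (\<Sum>l\<in>{1..p - 1}. 1 :: rat)"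
      using 1 by (intro sum.cong) auto
    also have "\<dots> = of_nat p - 1" using p_gt_0 by (simp add: of_nat_diff)
    also have "\<dots> \<sim>\<^bsub>1\<^esub> -1" using Zp_p by (simp add: zcong_def)
    finally show ?thesis using 1 by simp
  next
    case 2
    have "(\<Sum>l\<in>{1..p - 1}. of_nat l ^ u / of_nat l ^ b) = (\<Sum>l\<in>{1..p - 1}. of_nat l ^ (u - b) :: rat)"
      using 2 by (intro sum.cong) (auto simp: power_diff)
    also have "\<dots> \<in> Zp 1" using 2 assms by (intro power_sum_Zp) auto
    finally show ?thesis using 2 by (simp add: zcong_0_iff)
  next
    case 3
    have "(of_nat l :: rat) ^ b = of_nat l ^ (b - u) * of_nat l ^ u" for l
      using 3 by (simp flip: power_add)
    hence "(\<Sum>l\<in>{1..p - 1}. of_nat l ^ u / of_nat l ^ b) = H (b - u)"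
      unfolding harm_def by (intro sum.cong) auto
    also have "\<dots> \<in> Zp 1" using 3 assms by (intro H_Zp_1) auto
    finally show ?thesis using 3 by (simp add: zcong_0_iff)
  qed
qed

text \<open>
  Modulo \<open>p\<close> the upper entry is $-1 - a$, and the claim becomes the negation rule for binomial
  coefficients.
\<close>
lemma binomial_reflect:
  assumes "a + b < p"
  shows "of_nat ((p - 1 - a) choose b) \<sim>\<^bsub>1\<^esub> (-1) ^ b * of_nat ((a + b) choose b)"
  using assms
proof (induction b)
  case (Suc b)
  let ?x = "(p - 1 - a) choose b" and ?y = "(a + b) choose b"
  have x: "(of_nat (Suc b) * of_nat ((p - 1 - a) choose Suc b) :: rat) =
     of_nat ?x * of_nat p + of_nat ?x * (- of_nat (a + b + 1))"
  proof -
    have "Suc b * ((p - 1 - a) choose Suc b) = (p - 1 - a - b) * ?x"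
      using binomial_absorption[of b "p - 1 - a"] binomial_absorb_comp[of "p - 1 - a" b] by simp
    hence "(of_nat (Suc b) * of_nat ((p - 1 - a) choose Suc b) :: rat) = of_nat (p - 1 - a - b) * of_nat ?x"
      by (metis of_nat_mult)
    also have "(of_nat (p - 1 - a - b) :: rat) = of_nat p - of_nat (a + b + 1)"
      using Suc.prems by (simp flip: of_nat_diff)
    finally show ?thesis by (simp add: algebra_simps)
  qed
  have y: "(of_nat (Suc b) * of_nat ((a + Suc b) choose Suc b) :: rat) = of_nat (a + b + 1) * of_nat ?y"
    using Suc_times_binomial_eq[of "a + b" b] by (metis Suc_eq_plus1 add_Suc_right mult.commute of_nat_mult)
  have "of_nat ?x * of_nat p \<sim>\<^bsub>1\<^esub> 0"
    unfolding zcong_0_iff by (intro Zp_mult_left Zp_p) simp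
  moreover have "of_nat ?x * (- of_nat (a + b + 1)) \<sim>\<^bsub>1\<^esub> ((-1) ^ b * of_nat ?y) * (- of_nat (a + b + 1))"
    by (intro zcong_mult zcong_refl Zp_minus Zp_of_nat Suc.IH) (use Suc.prems in simp)
  ultimately have "of_nat (Suc b) * of_nat ((p - 1 - a) choose Suc b) \<sim>\<^bsub>1\<^esub>
     0 + ((-1) ^ b * of_nat ?y) * (- of_nat (a + b + 1))"
    unfolding x by (rule zcong_add)
  also have "\<dots> = of_nat (Suc b) * ((-1) ^ Suc b * of_nat ((a + Suc b) choose Suc b))"
    using y by (simp add: algebra_simps del: binomial_Suc_Suc of_nat_Suc)
  finally show ?case
    by (rule zcong_cancel) (use Suc.prems in auto)
qed simp

text \<open>
  Only $B_{p-w} / w$ ever occurs, and $w$ is invertible at \<open>p\<close>.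
\<close>
definition beta :: "nat \<Rightarrow> rat" where
  "beta w = bernoulli (p - w) / of_nat w"

lemma beta_Zp: "2 \<le> w \<Longrightarrow> w < p \<Longrightarrow> beta w \<in> Zp 0"
  unfolding beta_def by (intro Zp_divide bernoulli_Zp) auto

text \<open>
  Fermat's little theorem replaces $n^{-a}$ by $n^{p-1-a}$, and Faulhaber's formula turns the inner sum
  into a polynomial in \<open>l\<close>. After division by $l^b$ only the term $l^b$ of this polynomial contributes to
  the sum over \<open>l\<close>, and its coefficient contains $B_{p-a-b}$.
\<close>
lemma harm2_zcong:
  assumes "1 \<le> a" "1 \<le> b" "a + b + 2 \<le> p"
  shows "harm2 (p - 1) a b \<sim>\<^bsub>1\<^esub> (-1) ^ b * of_nat ((a + b) choose a) * beta (a + b)"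
proof -
  define q where "q = p - 1 - a"
  have q: "Suc q = p - a" "q \<ge> 1" "Suc q < p" using assms by (auto simp: q_def)
  define c where "c j = of_nat (Suc q choose j) * bernoulli j / of_nat (Suc q)" for j
  have c_Zp: "c j \<in> Zp 0" if "j \<le> q" for j
    unfolding c_def using that q by (intro Zp_divide Zp_mult_left bernoulli_Zp) auto
  have "harm2 (p - 1) a b = (\<Sum>l\<in>{1..p - 1}. (\<Sum>n\<in>{1..<l}. 1 / of_nat n ^ a) / of_nat l ^ b) + H (a + b)"
  \<comment> \<open>Faulhaber's formula sums over \<open>n < l\<close>; the diagonal is a power sum, hence negligible.\<close>
  proof -
    have "harm l a = (\<Sum>n\<in>{1..<l}. 1 / of_nat n ^ a) + 1 / of_nat l ^ a" if "1 \<le> l" for l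
    proof -
      have "{1..l} = insert l {1..<l}" using that by auto
      thus ?thesis by (simp add: harm_def)
    qed
    thus ?thesis
      unfolding harm2_def harm_def[of "p - 1"] sum.distrib[symmetric]
      by (intro sum.cong refl) (simp add: add_divide_distrib power_add)
  qed
  also have "\<dots> \<sim>\<^bsub>1\<^esub> (\<Sum>l\<in>{1..p - 1}. (\<Sum>n\<in>{1..<l}. of_nat n ^ q) / of_nat l ^ b) + 0"
  proof (intro zcong_add zcong_sum)
    fix l assume l: "l \<in> {1..p - 1}"
    have "(\<Sum>n\<in>{1..<l}. 1 / of_nat n ^ a) \<sim>\<^bsub>1\<^esub> (\<Sum>n\<in>{1..<l}. of_nat n ^ q)"
      unfolding q_def using l assms by (intro zcong_sum fermat_zcong) auto
    thus "(\<Sum>n\<in>{1..<l}. 1 / of_nat n ^ a) / of_nat l ^ b \<sim>\<^bsub>1\<^esub>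
        (\<Sum>n\<in>{1..<l}. of_nat n ^ q) / of_nat l ^ b"
      unfolding zcong_def diff_divide_distrib[symmetric] using l p_gt_0
      by (intro Zp_divide_power) auto
  next
    show "H (a + b) \<sim>\<^bsub>1\<^esub> 0"
      unfolding zcong_0_iff using assms by (intro H_Zp_1) auto
  qed
  also have "(\<Sum>l\<in>{1..p - 1}. (\<Sum>n\<in>{1..<l}. of_nat n ^ q) / of_nat l ^ b) + 0 =
     (\<Sum>l\<in>{1..p - 1}. \<Sum>j\<le>q. c j * (of_nat l ^ (Suc q - j) / of_nat l ^ b))"
  proof -
    have "(\<Sum>n\<in>{1..<l}. of_nat n ^ q :: rat) = (\<Sum>n<l. of_nat n ^ q)" for l
      using q by (intro sum.mono_neutral_left) auto
    thus ?thesis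
      by (simp only: faulhaber c_def sum_divide_distrib add_0_right)
        (simp add: field_simps del: of_nat_Suc binomial_Suc_Suc)
  qed
  also have "\<dots> = (\<Sum>j\<le>q. c j * (\<Sum>l\<in>{1..p - 1}. of_nat l ^ (Suc q - j) / of_nat l ^ b))"
    unfolding sum_distrib_left by (rule sum.swap)
  also have "\<dots> \<sim>\<^bsub>1\<^esub> (\<Sum>j\<le>q. c j * (if Suc q - j = b then -1 else 0))"
    using q assms by (intro zcong_sum zcong_scale quotient_power_sum c_Zp) auto
  also have "\<dots> = (\<Sum>j\<le>q. if j = p - a - b then - c j else 0)"
    using q assms by (intro sum.cong) auto
  also have "\<dots> = - c (p - a - b)"
    using assms by (simp add: q_def)
  also have "c (p - a - b) = of_nat ((p - 1 - a) choose (b - 1)) * (bernoulli (p - a - b) / of_nat b)"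
  proof -
    have "Suc q choose (p - a - b) = Suc q choose b"
      using assms q by (subst binomial_symmetric) auto
    moreover have "b * (Suc q choose b) = Suc q * (q choose (b - 1))"
      using Suc_times_binomial_eq[of q "b - 1"] assms by (simp add: mult.commute)
    hence "of_nat b * of_nat (Suc q choose b) = (of_nat (Suc q) * of_nat (q choose (b - 1)) :: rat)"
      by (metis of_nat_mult)
    ultimately show ?thesis
      using assms unfolding c_def by (simp add: q_def field_simps del: of_nat_Suc)
  qed
  also have "- (of_nat ((p - 1 - a) choose (b - 1)) * (bernoulli (p - a - b) / of_nat b)) \<sim>\<^bsub>1\<^esub>
    - (((-1) ^ (b - 1) * of_nat ((a + (b - 1)) choose (b - 1))) * (bernoulli (p - a - b) / of_nat b))"
    using assms by (intro zcong_minus zcong_mult binomial_reflect Zp_divide bernoulli_Zp) auto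
  also have "\<dots> = (-1) ^ b * of_nat ((a + b) choose a) * beta (a + b)"
  proof -
    have "b * ((a + b) choose a) = (a + b) * ((a + (b - 1)) choose (b - 1))"
      using Suc_times_binomial_eq[of "a + (b - 1)" "b - 1"] assms binomial_symmetric[of a "a + b"]
      by (simp add: mult.commute)
    hence "of_nat b * of_nat ((a + b) choose a) =
        (of_nat (a + b) * of_nat ((a + (b - 1)) choose (b - 1)) :: rat)"
      by (metis of_nat_mult)
    hence "of_nat ((a + (b - 1)) choose (b - 1)) / of_nat b =
        (of_nat ((a + b) choose a) / of_nat (a + b) :: rat)"
      using assms by (simp add: field_simps)
    moreover have "- ((-1) ^ (b - 1)) = ((-1) ^ b :: rat)"
      using assms by (cases b) auto
    moreover have "- (((-1) ^ (b - 1) * of_nat ((a + (b - 1)) choose (b - 1))) * (bernoulli (p - a - b) / of_nat b)) =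
        - ((-1) ^ (b - 1)) * (of_nat ((a + (b - 1)) choose (b - 1)) / of_nat b) * bernoulli (p - a - b)"
      by simp
    ultimately show ?thesis
      unfolding beta_def by (simp only: times_divide_eq_left times_divide_eq_right mult.assoc diff_diff_left)
  qed
  finally show ?thesis .
qed

section \<open>Single sums modulo $p^2$ and $p^3$\<close>

text \<open>
  The binomial expansion of $(-n)^{-a} (1 - u)^{-a}$ with $u = p/n$, truncated after $u^2$. The
  induction over \<open>a\<close> multiplies the truncation by $1 - u$, which changes it by a multiple of $u^3$.
\<close>
lemma one_over_reflect:
  assumes "1 \<le> n" "n < p"
  shows "1 / of_nat (p - n) ^ a \<sim>\<^bsub>3\<^esub> (-1) ^ a * (1 / of_nat n ^ a + of_nat a * of_nat p / of_nat n ^ Suc a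
    + of_nat (Suc a choose 2) * of_nat p ^ 2 / of_nat n ^ (a + 2))"
proof -
  define u :: rat where "u = of_nat p / of_nat n"
  define v :: rat where "v = of_nat n / of_nat (p - n)"
  have pn: "0 < p - n" "p - n < p" using assms by auto
  have u: "u \<in> Zp 1" unfolding u_def using assms by (intro Zp_divide Zp_p) auto
  have v: "v \<in> Zp 0" unfolding v_def using pn by (intro Zp_divide) auto
  have uv: "v * (1 - u) = -1" 
    unfolding u_def v_def using assms pn by (simp add: field_simps of_nat_diff)
  define f :: "nat \<Rightarrow> rat" where "f a = 1 + of_nat a * u + of_nat (Suc a choose 2) * u ^ 2" for a
  have f: "f (Suc a) * (1 - u) = f a - of_nat (Suc (Suc a) choose 2) * u ^ 3" for a
  proof -
    have "Suc (Suc a) choose 2 = (Suc a choose 2) + Suc a" by (simp add: numeral_2_eq_2)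
    thus ?thesis unfolding f_def by (simp add: algebra_simps power3_eq_cube power2_eq_square)
  qed
  have u3: "u ^ 3 \<in> Zp 3"
    using Zp_mult[OF u Zp_mult[OF u u]] by (simp add: power3_eq_cube mult.assoc numeral_3_eq_3)
  have main: "v ^ a \<sim>\<^bsub>3\<^esub> (-1) ^ a * f a" for a
  proof (induction a)
    case 0
    show ?case by (simp add: f_def binomial_eq_0)
  next
    case (Suc a)
    have "v ^ Suc a \<sim>\<^bsub>3\<^esub> v * ((-1) ^ a * f a)"
      using zcong_scale[OF Suc v] by simp
    also have "v * ((-1) ^ a * f a) = v * (-1) ^ a * (f (Suc a) * (1 - u)) +
        v * (-1) ^ a * of_nat (Suc (Suc a) choose 2) * u ^ 3"
      unfolding f by (simp add: algebra_simps)
    also have "\<dots> \<sim>\<^bsub>3\<^esub> v * (-1) ^ a * (f (Suc a) * (1 - u)) + 0"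
    proof (intro zcong_add zcong_refl)
      have "(-1) ^ a \<in> Zp 0" using Zp_power[OF Zp_minus[OF Zp_numeral(1)]] by simp
      thus "v * (-1) ^ a * of_nat (Suc (Suc a) choose 2) * u ^ 3 \<sim>\<^bsub>3\<^esub> 0"
        unfolding zcong_0_iff using v u3 by (intro Zp_mult_left Zp_of_nat)
    qed
    also have "v * (-1) ^ a * (f (Suc a) * (1 - u)) + 0 = (v * (1 - u)) * ((-1) ^ a * f (Suc a))"
      by (simp add: mult_ac)
    also have "\<dots> = (-1) ^ Suc a * f (Suc a)" by (simp add: uv)
    finally show ?case .
  qed
  have "1 / of_nat n ^ a * v ^ a \<sim>\<^bsub>3\<^esub> 1 / of_nat n ^ a * ((-1) ^ a * f a)"
    using assms by (intro zcong_scale main one_over_power_Zp)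
  moreover have "1 / of_nat n ^ a * v ^ a = 1 / of_nat (p - n) ^ a"
    using assms by (simp add: v_def power_divide)
  moreover have "1 / of_nat n ^ a * f a = 1 / of_nat n ^ a
    + of_nat a * of_nat p / of_nat n ^ Suc a
    + of_nat (Suc a choose 2) * of_nat p ^ 2 / of_nat n ^ (a + 2)"
    unfolding f_def u_def using assms
    by (simp add: field_simps power_add power2_eq_square del: binomial_Suc_Suc)
  ultimately show ?thesis by (simp only: mult.left_commute[of _ "(-1) ^ a"])
qed

lemma sign_Zp [simp]: "(-1) ^ n \<in> Zp 0"
  using Zp_power[OF Zp_minus[OF Zp_numeral(1)]] by simp

lemma one_over_reflect_1:
  assumes "1 \<le> n" "n < p"
  shows "1 / of_nat (p - n) ^ a \<sim>\<^bsub>1\<^esub> (-1) ^ a / of_nat n ^ a"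
proof -
  define R :: rat where "R = of_nat a * of_nat p / of_nat n ^ Suc a
      + of_nat (Suc a choose 2) * of_nat p ^ 2 / of_nat n ^ (a + 2)"
  have "R \<in> Zp 1"
    unfolding R_def using assms
    by (intro Zp_add Zp_divide_power Zp_mult_left Zp_p Zp_mono[OF Zp_p_power]) auto
  hence "(-1) ^ a * (1 / of_nat n ^ a + R) \<sim>\<^bsub>1\<^esub> (-1) ^ a / of_nat n ^ a"
    by (simp add: zcong_def distrib_left Zp_mult_left)
  moreover have "1 / of_nat (p - n) ^ a \<sim>\<^bsub>3\<^esub> (-1) ^ a * (1 / of_nat n ^ a + R)"
    using one_over_reflect[OF assms, of a] by (simp only: R_def add.assoc)
  hence "1 / of_nat (p - n) ^ a \<sim>\<^bsub>1\<^esub> (-1) ^ a * (1 / of_nat n ^ a + R)"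
    by (rule zcong_mono) simp
  ultimately show ?thesis
    using zcong_trans by blast
qed

lemma one_over_reflect_2:
  assumes "1 \<le> n" "n < p"
  shows "1 / of_nat (p - n) ^ a \<sim>\<^bsub>2\<^esub> (-1) ^ a * (1 / of_nat n ^ a + of_nat a * of_nat p / of_nat n ^ Suc a)"
proof -
  define R :: rat where "R = of_nat (Suc a choose 2) * of_nat p ^ 2 / of_nat n ^ (a + 2)"
  define S :: rat where "S = 1 / of_nat n ^ a + of_nat a * of_nat p / of_nat n ^ Suc a"
  have "R \<in> Zp 2"
    unfolding R_def using assms by (intro Zp_divide_power Zp_mult_left Zp_p_power) auto
  hence "(-1) ^ a * (S + R) \<sim>\<^bsub>2\<^esub> (-1) ^ a * S"
    by (simp add: zcong_def distrib_left Zp_mult_left)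
  moreover have "1 / of_nat (p - n) ^ a \<sim>\<^bsub>3\<^esub> (-1) ^ a * (S + R)"
    using one_over_reflect[OF assms, of a] by (simp only: R_def S_def add.assoc)
  hence "1 / of_nat (p - n) ^ a \<sim>\<^bsub>2\<^esub> (-1) ^ a * (S + R)"
    by (rule zcong_mono) simp
  ultimately show ?thesis
    unfolding S_def[symmetric] using zcong_trans by blast
qed

lemma sum_reflect: "(\<Sum>n\<in>{1..p - 1}. f n) = (\<Sum>n\<in>{1..p - 1}. f (p - n))"
  by (rule sum.reindex_bij_witness[of _ "\<lambda>n. p - n" "\<lambda>n. p - n"]) auto

text \<open>
  For odd \<open>k\<close> the reflection $m \mapsto p - m$ maps $H_k$ to $-H_k$ up to higher order, so that the
  correction terms determine $2 H_k$.
\<close>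
lemma H_odd:
  assumes "odd k" "k + 4 \<le> p"
  shows "2 * H k \<sim>\<^bsub>3\<^esub> - of_nat k * of_nat p * H (Suc k)"
proof -
  let ?t = "of_nat (Suc k choose 2) :: rat"
  have "H k = (\<Sum>n\<in>{1..p - 1}. 1 / of_nat (p - n) ^ k)"
    unfolding harm_def by (rule sum_reflect)
  also have "\<dots> \<sim>\<^bsub>3\<^esub> (\<Sum>n\<in>{1..p - 1}. (-1) ^ k * (1 / of_nat n ^ k + of_nat k * of_nat p / of_nat n ^ Suc k
    + ?t * of_nat p ^ 2 / of_nat n ^ (k + 2)))"
    by (intro zcong_sum one_over_reflect) auto
  also have "\<dots> = - (H k + of_nat k * of_nat p * H (Suc k) + ?t * of_nat p ^ 2 * H (k + 2))"
    using assms by (simp add: harm_def sum_negf sum.distrib sum_subtractf sum_distrib_left mult.assoc del: binomial_Suc_Suc)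
  finally have "H k + (H k + of_nat k * of_nat p * H (Suc k)) \<sim>\<^bsub>3\<^esub>
    H k + (- (?t * of_nat p ^ 2 * H (k + 2)) - H k)"
    by (simp add: zcong_def algebra_simps)
  also have "H k + (- (?t * of_nat p ^ 2 * H (k + 2)) - H k) = - (?t * (of_nat p ^ 2 * H (k + 2)))"
    by (simp add: mult.assoc)
  also have "\<dots> \<sim>\<^bsub>3\<^esub> 0"
    unfolding zcong_0_iff
  proof (rule Zp_minus, rule Zp_mult_left)
    show "?t \<in> Zp 0" by (rule Zp_of_nat)
    show "of_nat p ^ 2 * H (k + 2) \<in> Zp 3"
      using Zp_mult[OF Zp_p_power[of 2] H_Zp_1[of "k + 2"]] assms by simp
  qed
  finally show ?thesis by (simp add: zcong_def algebra_simps)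
qed

lemma H_odd_Zp_2:
  assumes "odd k" "k + 4 \<le> p"
  shows "H k \<in> Zp 2"
proof (rule Zp_cancel)
  have "of_nat p * H (Suc k) \<in> Zp 2"
    using Zp_mult[OF Zp_p H_Zp_1[of "Suc k"]] assms by (simp add: numeral_2_eq_2)
  hence "- of_nat k * (of_nat p * H (Suc k)) \<in> Zp 2"
    by (rule Zp_mult_left[OF Zp_minus[OF Zp_of_nat]])
  moreover have "2 * H k \<sim>\<^bsub>2\<^esub> - of_nat k * (of_nat p * H (Suc k))"
    using zcong_mono[OF H_odd[OF assms], of 2] by (simp add: mult.assoc)
  ultimately show "of_nat 2 * H k \<in> Zp 2" using zcong_in by simp
qed (use assms in auto)

text \<open>
  By Newton's identities and induction, since $H_i$ is divisible by \<open>p\<close> and \<open>j < p\<close> is invertible.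
\<close>
lemma coeffs_Zp_1:
  assumes "1 \<le> j" "j + 2 \<le> p"
  shows "ecoeff (p - 1) j \<in> Zp 1 \<and> hcoeff 0 (p - 1) j \<in> Zp 1"
  using assms
proof (induction j rule: less_induct)
  case (less j)
  have e: "ecoeff (p - 1) (j - i) \<in> Zp 0" and h: "hcoeff 0 (p - 1) (j - i) \<in> Zp 0" if "i \<in> {1..j}" for i
  proof -
    show "ecoeff (p - 1) (j - i) \<in> Zp 0"
      using less that by (cases "i = j") (auto simp: ecoeff_def intro: Zp_mono[of _ 1])
    show "hcoeff 0 (p - 1) (j - i) \<in> Zp 0"
      using less that by (cases "i = j") (auto intro: Zp_mono[of _ 1])
  qed
  have H: "H i \<in> Zp 1" if "i \<in> {1..j}" for i
    using that less.prems by (intro H_Zp_1) auto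
  have "of_nat j * ecoeff (p - 1) j \<in> Zp 1"
    unfolding newton_ecoeff by (intro Zp_minus Zp_sum Zp_mult_right H e)
  moreover have "of_nat j * hcoeff 0 (p - 1) j \<in> Zp 1"
    unfolding newton_hcoeff by (intro Zp_sum Zp_mult_right H h)
  ultimately show ?case
    using less.prems Zp_cancel by simp
qed

lemmas ecoeff_Zp_1 = coeffs_Zp_1[THEN conjunct1] and hcoeff_Zp_1 = coeffs_Zp_1[THEN conjunct2]

lemma ecoeff_0 [simp]: "ecoeff N 0 = 1"
  by (simp add: ecoeff_def)

lemma ecoeff_Zp_0: "j + 2 \<le> p \<Longrightarrow> ecoeff (p - 1) j \<in> Zp 0"
  using Zp_mono[OF ecoeff_Zp_1, of j 0] by (cases "j = 0") auto

lemma Zp_mult_1_1: "x \<in> Zp 1 \<Longrightarrow> y \<in> Zp 1 \<Longrightarrow> x * y \<in> Zp 2"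
  using Zp_mult[of x 1 y 1] by (simp add: numeral_2_eq_2)

lemma Zp_mult_1_2: "x \<in> Zp 1 \<Longrightarrow> y \<in> Zp 2 \<Longrightarrow> x * y \<in> Zp 3"
  using Zp_mult[of x 1 y 2] by (simp add: numeral_3_eq_3)

lemma Zp_mult_2_1: "x \<in> Zp 2 \<Longrightarrow> y \<in> Zp 1 \<Longrightarrow> x * y \<in> Zp 3"
  using Zp_mult[of x 2 y 1] by simp

lemma coeffs_odd_Zp_2:
  assumes "odd j" "j + 4 \<le> p"
  shows "ecoeff (p - 1) j \<in> Zp 2" "hcoeff 0 (p - 1) j \<in> Zp 2"
proof -
  have prod: "H i * c (j - i) \<in> Zp 2"
    if "i \<in> {1..j}" and c: "\<And>l. 1 \<le> l \<Longrightarrow> l + 2 \<le> p \<Longrightarrow> c l \<in> Zp 1" "c 0 = 1" for i and c :: "nat \<Rightarrow> rat"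
  proof (cases "i = j")
    case True
    thus ?thesis using H_odd_Zp_2[OF assms] c by simp
  next
    case False
    thus ?thesis using that assms by (intro Zp_mult_1_1 H_Zp_1 c) auto
  qed
  have "of_nat j * ecoeff (p - 1) j \<in> Zp 2"
    unfolding newton_ecoeff by (intro Zp_minus Zp_sum prod ecoeff_Zp_1) auto
  moreover have "of_nat j * hcoeff 0 (p - 1) j \<in> Zp 2"
    unfolding newton_hcoeff by (intro Zp_sum prod hcoeff_Zp_1) auto
  moreover have "0 < j" using assms odd_pos by blast
  ultimately show "ecoeff (p - 1) j \<in> Zp 2" "hcoeff 0 (p - 1) j \<in> Zp 2"
    using assms Zp_cancel by auto
qed

text \<open>
  Both factors are divisible by \<open>p\<close>. If the total degree is odd then one of the degrees is odd and
  contributes a second factor \<open>p\<close>. The following lemmas use this to discard mixed terms.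
\<close>
lemma mixed_product_Zp:
  assumes "1 \<le> i" "1 \<le> j" "i + j + 3 \<le> p" "n = 2 \<or> n = 3 \<and> odd (i + j)"
    and x: "x \<in> Zp 1" "odd i \<Longrightarrow> x \<in> Zp 2" and y: "y \<in> Zp 1" "odd j \<Longrightarrow> y \<in> Zp 2"
  shows "x * y \<in> Zp n"
proof (cases "n = 2")
  case True
  thus ?thesis using x y Zp_mult_1_1 by simp
next
  case False
  hence "odd i \<or> odd j" "n = 3" using assms by auto
  thus ?thesis using x y Zp_mult_1_2 Zp_mult_2_1 by blast
qed

text \<open>
  In Newton's identities all terms but the last are mixed products.
\<close>
lemma H_coeffs:
  assumes "1 \<le> k" "k + 4 \<le> p" "n = 2 \<or> n = 3 \<and> odd k"
  shows "of_nat k * ecoeff (p - 1) k \<sim>\<^bsub>n\<^esub> - H k" "of_nat k * hcoeff 0 (p - 1) k \<sim>\<^bsub>n\<^esub> H k"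
proof -
  have *: "(\<Sum>i\<in>{1..k}. H i * c (k - i)) \<sim>\<^bsub>n\<^esub> H k"
    if c: "\<And>l. 1 \<le> l \<Longrightarrow> l + 2 \<le> p \<Longrightarrow> c l \<in> Zp 1" "c 0 = 1"
      "\<And>l. odd l \<Longrightarrow> l + 4 \<le> p \<Longrightarrow> c l \<in> Zp 2" for c :: "nat \<Rightarrow> rat"
  proof -
    have "(\<Sum>i\<in>{1..k}. H i * c (k - i)) \<sim>\<^bsub>n\<^esub> (\<Sum>i\<in>{1..k}. if i = k then H k else 0)"
    proof (rule zcong_sum)
      fix i assume i: "i \<in> {1..k}"
      show "H i * c (k - i) \<sim>\<^bsub>n\<^esub> (if i = k then H k else 0)"
      proof (cases "i = k")
        case False
        have "H i * c (k - i) \<in> Zp n"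
          using i False assms
          by (intro mixed_product_Zp[of i "k - i"] H_Zp_1 H_odd_Zp_2 c) auto
        thus ?thesis using False by (simp add: zcong_0_iff)
      qed (simp add: c)
    qed
    thus ?thesis using assms by simp
  qed
  show "of_nat k * ecoeff (p - 1) k \<sim>\<^bsub>n\<^esub> - H k"
    unfolding newton_ecoeff by (intro zcong_minus * ecoeff_Zp_1 coeffs_odd_Zp_2) auto
  show "of_nat k * hcoeff 0 (p - 1) k \<sim>\<^bsub>n\<^esub> H k"
    unfolding newton_hcoeff by (intro * hcoeff_Zp_1 coeffs_odd_Zp_2) auto
qed

lemma ecoeff_hcoeff:
  assumes "1 \<le> k" "k + 4 \<le> p" "n = 2 \<or> n = 3 \<and> odd k"
  shows "ecoeff (p - 1) k \<sim>\<^bsub>n\<^esub> - hcoeff 0 (p - 1) k"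
proof (rule zcong_cancel)
  have "of_nat k * ecoeff (p - 1) k \<sim>\<^bsub>n\<^esub> - H k"
    using assms by (intro H_coeffs)
  also have "- H k \<sim>\<^bsub>n\<^esub> - (of_nat k * hcoeff 0 (p - 1) k)"
    using assms by (intro zcong_minus zcong_sym[OF H_coeffs(2)])
  finally show "of_nat k * ecoeff (p - 1) k \<sim>\<^bsub>n\<^esub> of_nat k * - hcoeff 0 (p - 1) k"
    by simp
qed (use assms in auto)

text \<open>
  This is the expansion of $\prod_{j \le l} (1 - p/j)$ to first order.
\<close>
lemma alternating_binomial_zcong:
  assumes "l < p"
  shows "(-1) ^ l * of_nat ((p - 1) choose l) \<sim>\<^bsub>2\<^esub> 1 - of_nat p * harm l 1"
  using assms
proof (induction l)
  case 0
  show ?case by (simp add: harm_def)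
next
  case (Suc l)
  let ?x = "(-1) ^ l * of_nat ((p - 1) choose l) :: rat"
  have "Suc l * ((p - 1) choose Suc l) = (p - 1 - l) * ((p - 1) choose l)"
    using binomial_absorption[of l "p - 1"] binomial_absorb_comp[of "p - 1" l] by simp
  hence "(of_nat (Suc l) * of_nat ((p - 1) choose Suc l) :: rat) = of_nat (p - 1 - l) * of_nat ((p - 1) choose l)"
    by (metis of_nat_mult)
  also have "(of_nat (p - 1 - l) :: rat) = of_nat p - of_nat (Suc l)"
    using Suc.prems by (simp flip: of_nat_diff)
  finally have Y: "of_nat ((p - 1) choose Suc l) = (of_nat p / of_nat (Suc l) - 1) * (of_nat ((p - 1) choose l) :: rat)"
    by (simp add: field_simps del: of_nat_Suc)
  have "(-1) ^ Suc l * of_nat ((p - 1) choose Suc l) = (1 - of_nat p * (1 / of_nat (Suc l))) * ?x"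
    unfolding Y by (simp add: algebra_simps del: of_nat_Suc)
  also have "\<dots> \<sim>\<^bsub>2\<^esub> (1 - of_nat p * (1 / of_nat (Suc l))) * (1 - of_nat p * harm l 1)"
    using Suc by (intro zcong_scale Zp_diff Zp_mult_left Zp_inverse) auto
  also have "\<dots> = (1 - of_nat p * harm (Suc l) 1) + (of_nat p * of_nat p) * (harm l 1 / of_nat (Suc l))"
    by (simp add: harm_def algebra_simps)
  also have "\<dots> \<sim>\<^bsub>2\<^esub> (1 - of_nat p * harm (Suc l) 1) + 0"
  proof (intro zcong_add zcong_refl)
    have "of_nat p * of_nat p * (harm l 1 / of_nat (Suc l)) \<in> Zp 2"
      using Suc.prems by (intro Zp_mult_right Zp_mult_1_1 Zp_p Zp_divide harm_Zp_0) auto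
    thus "of_nat p * of_nat p * (harm l 1 / of_nat (Suc l)) \<sim>\<^bsub>2\<^esub> 0"
      by (simp only: zcong_0_iff)
  qed
  finally show ?case by simp
qed

lemma alt_binom_sum_zcong:
  assumes "\<And>l. l \<in> {1..p - 1} \<Longrightarrow> f l \<in> Zp 0"
  shows "alt_binom_sum (p - 1) f \<sim>\<^bsub>2\<^esub> - (\<Sum>l\<in>{1..p - 1}. f l) + of_nat p * (\<Sum>l\<in>{1..p - 1}. harm l 1 * f l)"
proof -
  have "alt_binom_sum (p - 1) f = (\<Sum>l\<in>{1..p - 1}. - f l * ((-1) ^ l * of_nat ((p - 1) choose l)))"
    unfolding alt_binom_sum_def
  proof (rule sum.cong[OF refl])
    fix l assume "l \<in> {1..p - 1}"
    then obtain j where "l = Suc j" by (cases l) auto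
    thus "(-1) ^ (l - 1) * of_nat ((p - 1) choose l) * f l = - f l * ((-1) ^ l * of_nat ((p - 1) choose l))"
      by simp
  qed
  also have "\<dots> \<sim>\<^bsub>2\<^esub> (\<Sum>l\<in>{1..p - 1}. - f l * (1 - of_nat p * harm l 1))"
    using assms by (intro zcong_sum zcong_scale alternating_binomial_zcong Zp_minus) auto
  also have "\<dots> = - (\<Sum>l\<in>{1..p - 1}. f l) + of_nat p * (\<Sum>l\<in>{1..p - 1}. harm l 1 * f l)"
    by (simp add: algebra_simps sum.distrib sum_distrib_left sum_negf sum_subtractf)
  finally show ?thesis .
qed

text \<open>
  By duality and \<open>alternating_binomial_zcong\<close>, $\zeta^{\star}(\{1\}^k) \equiv -H_k + p \zeta^{\star}(1, k)$. The
  left-hand side is $H_k / k$ modulo $p^2$, so that $(k + 1) H_k \equiv k p \zeta^{\star}(1, k)$.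
\<close>
lemma H_zcong_signed:
  assumes "1 \<le> k" "k + 4 \<le> p"
  shows "H k \<sim>\<^bsub>2\<^esub> (-1) ^ k * of_nat k * (of_nat p * beta (Suc k))"
proof (rule zcong_cancel)
  have p1: "p - 1 = Suc (p - 2)" using assms by simp
  have "hcoeff 0 (p - 1) k = alt_binom_sum (p - 1) (\<lambda>l. 1 / of_nat l ^ k)"
    unfolding p1 by (rule hcoeff_dual[symmetric])
  also have "\<dots> \<sim>\<^bsub>2\<^esub> - (\<Sum>l\<in>{1..p - 1}. 1 / of_nat l ^ k) + of_nat p * (\<Sum>l\<in>{1..p - 1}. harm l 1 * (1 / of_nat l ^ k))"
    by (intro alt_binom_sum_zcong one_over_power_Zp) auto
  also have "\<dots> = - H k + of_nat p * harm2 (p - 1) 1 k"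
    by (simp add: harm_def harm2_def)
  also have "\<dots> \<sim>\<^bsub>2\<^esub> - H k + of_nat p * ((-1) ^ k * of_nat ((1 + k) choose 1) * beta (1 + k))"
  proof -
    have "of_nat p * harm2 (p - 1) 1 k \<sim>\<^bsub>1 + 1\<^esub> of_nat p * ((-1) ^ k * of_nat ((1 + k) choose 1) * beta (1 + k))"
      using assms by (intro zcong_mult_left harm2_zcong Zp_p) auto
    thus ?thesis by (intro zcong_add zcong_refl) (simp add: numeral_2_eq_2)
  qed
  finally have "of_nat k * hcoeff 0 (p - 1) k \<sim>\<^bsub>2\<^esub>
     of_nat k * (- H k + of_nat p * ((-1) ^ k * of_nat ((1 + k) choose 1) * beta (1 + k)))"
    by (intro zcong_scale) auto
  moreover have "of_nat k * hcoeff 0 (p - 1) k \<sim>\<^bsub>2\<^esub> H k"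
    using assms by (intro H_coeffs) auto
  ultimately have "H k \<sim>\<^bsub>2\<^esub> of_nat k * (- H k + of_nat p * ((-1) ^ k * of_nat ((1 + k) choose 1) * beta (1 + k)))"
    using zcong_sym zcong_trans by blast
  thus "of_nat (Suc k) * H k \<sim>\<^bsub>2\<^esub> of_nat (Suc k) * ((-1) ^ k * of_nat k * (of_nat p * beta (Suc k)))"
    by (simp add: zcong_def algebra_simps)
qed (use assms in auto)

text \<open>
  For odd \<open>k\<close> both $H_k$ and, as a consequence of \<open>H_zcong_signed\<close>, the right-hand side vanish modulo
  $p^2$; so the sign $(-1)^k$ can be dropped.
\<close>
lemma H_zcong:
  assumes "1 \<le> k" "k + 4 \<le> p"
  shows "H k \<sim>\<^bsub>2\<^esub> of_nat k * (of_nat p * beta (Suc k))"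
proof (cases "even k")
  case True
  thus ?thesis using H_zcong_signed[OF assms] by simp
next
  case False
  have "H k \<sim>\<^bsub>2\<^esub> - (of_nat k * (of_nat p * beta (Suc k)))"
    using H_zcong_signed[OF assms] False by simp
  hence "- (of_nat k * (of_nat p * beta (Suc k))) \<in> Zp 2"
    using H_odd_Zp_2[OF False assms(2)] zcong_in zcong_sym by blast
  hence "of_nat k * (of_nat p * beta (Suc k)) \<in> Zp 2" using Zp_minus by fastforce
  thus ?thesis
    using H_odd_Zp_2[OF False assms(2)] by (simp add: zcong_def Zp_diff)
qed

lemma hcoeff_zcong:
  assumes "1 \<le> k" "k + 4 \<le> p"
  shows "hcoeff 0 (p - 1) k \<sim>\<^bsub>2\<^esub> of_nat p * beta (Suc k)"
proof (rule zcong_cancel)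
  have "of_nat k * hcoeff 0 (p - 1) k \<sim>\<^bsub>2\<^esub> H k"
    using assms by (intro H_coeffs) auto
  also have "H k \<sim>\<^bsub>2\<^esub> of_nat k * (of_nat p * beta (Suc k))"
    using assms by (rule H_zcong)
  finally show "of_nat k * hcoeff 0 (p - 1) k \<sim>\<^bsub>2\<^esub> of_nat k * (of_nat p * beta (Suc k))" .
qed (use assms in auto)

lemma hcoeff_odd_zcong:
  assumes "odd k" "k + 5 \<le> p"
  shows "hcoeff 0 (p - 1) k \<sim>\<^bsub>3\<^esub> - (of_nat (Suc k) / 2) * beta (k + 2) * of_nat p ^ 2"
proof -
  have k: "1 \<le> k" using assms(1) by (cases k) auto
  let ?X = "- (of_nat (Suc k) / 2) * beta (k + 2) * of_nat p ^ 2"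
  have "2 * (of_nat k * hcoeff 0 (p - 1) k) \<sim>\<^bsub>3\<^esub> 2 * H k"
    using assms k by (intro zcong_scale H_coeffs) auto
  also have "2 * H k \<sim>\<^bsub>3\<^esub> - of_nat k * of_nat p * H (Suc k)"
    using assms by (intro H_odd) auto
  also have "\<dots> \<sim>\<^bsub>3\<^esub> - of_nat k * of_nat p * (of_nat (Suc k) * (of_nat p * beta (Suc (Suc k))))"
  proof -
    have "- of_nat k * of_nat p * H (Suc k) \<sim>\<^bsub>1 + 2\<^esub>
        - of_nat k * of_nat p * (of_nat (Suc k) * (of_nat p * beta (Suc (Suc k))))"
      using assms by (intro zcong_mult_left H_zcong Zp_mult_left Zp_p Zp_minus) auto
    thus ?thesis by (simp add: numeral_3_eq_3 numeral_2_eq_2)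
  qed
  also have "\<dots> = 2 * (of_nat k * ?X)"
    by (simp add: algebra_simps power2_eq_square)
  finally have "of_nat 2 * (of_nat k * hcoeff 0 (p - 1) k) \<sim>\<^bsub>3\<^esub> of_nat 2 * (of_nat k * ?X)"
    by simp
  hence "of_nat k * hcoeff 0 (p - 1) k \<sim>\<^bsub>3\<^esub> of_nat k * ?X"
    by (rule zcong_cancel) (use assms in auto)
  thus ?thesis
    by (rule zcong_cancel) (use assms k in auto)
qed

end

section \<open>Two binomial sums\<close>

text \<open>
  A subset of $\{0, \dots, n\}$ with $u + v + 1$ elements, sorted by its element number $u + 1$.
\<close>
lemma sum_choose_convolution:
  "(\<Sum>s\<le>n. (s choose u) * ((n - s) choose v)) = Suc n choose Suc (u + v)"
proof (induction n arbitrary: v)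
  case 0
  show ?case by (cases u; cases v) auto
next
  case (Suc n)
  show ?case
  proof (cases v)
    case 0
    thus ?thesis using sum_choose_upper[of u "Suc n"] by simp
  next
    case (Suc w)
    have "(\<Sum>s\<le>Suc n. (s choose u) * ((Suc n - s) choose Suc w)) =
      (\<Sum>s\<le>n. (s choose u) * ((n - s) choose Suc w) + (s choose u) * ((n - s) choose w))"
      by (auto simp: Suc_diff_le algebra_simps intro!: sum.cong)
    thus ?thesis
      unfolding sum.distrib Suc.IH by (simp add: Suc)
  qed
qed

text \<open>
  The \<open>n\<close>-th finite difference of a polynomial of degree $u + v < n$. The induction uses that one
  difference of the product is a difference of two products of total degree $u + v - 1$.
\<close>
lemma sum_alternating_gbinomial_eq_0:
  fixes x y :: "'a :: field_char_0"
  assumes "u + v < n"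
  shows "(\<Sum>j\<le>n. (-1) ^ j * of_nat (n choose j) * ((x + of_nat j) gchoose u) * ((y - of_nat j) gchoose v)) = 0"
  using assms
proof (induction n arbitrary: u v y)
  case (Suc n)
  let ?F = "\<lambda>u v y j. ((x + of_nat j) gchoose u) * ((y - of_nat j) gchoose v)"
  have *: "(\<Sum>j\<le>Suc n. (-1) ^ j * of_nat (Suc n choose j) * f j) =
      (\<Sum>j\<le>n. (-1) ^ j * of_nat (n choose j) * (f j - f (Suc j)))" for f :: "nat \<Rightarrow> 'a"
  proof -
    have "(\<Sum>j\<le>Suc n. (-1) ^ j * of_nat (Suc n choose j) * f j) =
        f 0 + (\<Sum>j\<le>n. (-1) ^ Suc j * of_nat (n choose Suc j) * f (Suc j)
          + (-1) ^ Suc j * of_nat (n choose j) * f (Suc j))"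
      by (subst sum.atMost_Suc_shift) (simp add: algebra_simps sum.distrib)
    also have "\<dots> = (f 0 + (\<Sum>j\<le>n. (-1) ^ Suc j * of_nat (n choose Suc j) * f (Suc j)))
          + (\<Sum>j\<le>n. (-1) ^ Suc j * of_nat (n choose j) * f (Suc j))"
      by (simp only: sum.distrib add.assoc)
    also have "f 0 + (\<Sum>j\<le>n. (-1) ^ Suc j * of_nat (n choose Suc j) * f (Suc j)) =
        (\<Sum>j\<le>Suc n. (-1) ^ j * of_nat (n choose j) * f j)"
      by (subst sum.atMost_Suc_shift) simp
    also have "\<dots> = (\<Sum>j\<le>n. (-1) ^ j * of_nat (n choose j) * f j)" by simp
    finally show ?thesis
      by (simp add: sum.distrib[symmetric] algebra_simps)
  qed
  have up: "((x + of_nat (Suc j)) gchoose u) =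
      ((x + of_nat j) gchoose u) + (if u = 0 then 0 else (x + of_nat j) gchoose (u - 1))" for j
    using gbinomial_Suc_Suc[of "x + of_nat j" "u - 1"] by (cases u) (simp_all add: algebra_simps)
  have down: "((y - of_nat j) gchoose v) =
      ((y - 1 - of_nat j) gchoose v) + (if v = 0 then 0 else (y - 1 - of_nat j) gchoose (v - 1))" for j
    using gbinomial_Suc_Suc[of "y - 1 - of_nat j" "v - 1"] by (cases v) (simp_all add: algebra_simps)
  have diff: "?F u v y j - ?F u v y (Suc j) =
      (if v = 0 then 0 else ?F u (v - 1) (y - 1) j) - (if u = 0 then 0 else ?F (u - 1) v (y - 1) j)" for j
  proof -
    have "y - of_nat (Suc j) = y - 1 - of_nat j" by simp
    hence "?F u v y (Suc j) = ((x + of_nat (Suc j)) gchoose u) * ((y - 1 - of_nat j) gchoose v)"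
      by (simp only:)
    thus ?thesis
      unfolding up down by (simp add: algebra_simps)
  qed
  have "(\<Sum>j\<le>n. (-1) ^ j * of_nat (n choose j) * (?F u v y j - ?F u v y (Suc j))) =
     (if v = 0 then 0 else \<Sum>j\<le>n. (-1) ^ j * of_nat (n choose j) * ?F u (v - 1) (y - 1) j) -
     (if u = 0 then 0 else \<Sum>j\<le>n. (-1) ^ j * of_nat (n choose j) * ?F (u - 1) v (y - 1) j)"
    unfolding diff by (simp add: right_diff_distrib sum_subtractf)
  also have "\<dots> = 0"
    using Suc.IH[of u "v - 1" "y - 1"] Suc.IH[of "u - 1" v "y - 1"] Suc.prems
    by (auto simp: mult.assoc)
  finally show ?case using *[of "?F u v y"] by (simp only: mult.assoc)
qed simp

lemma gbinomial_neg_1: "((-1 :: rat) gchoose v) = (-1) ^ v"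
  using gbinomial_minus[of "1::rat" v] by (simp flip: binomial_gbinomial)

lemma gbinomial_neg_2: "((-2 :: rat) gchoose v) = (-1) ^ v * of_nat (Suc v)"
proof -
  have "(2 + of_nat v - 1 :: rat) = of_nat (Suc v)" by simp
  thus ?thesis
    using gbinomial_minus[of "2::rat" v]
    by (simp only: binomial_gbinomial[symmetric] binomial_Suc_n)
qed

text \<open>
  The summand is a polynomial of degree $u + v$ in $s$, so the sum over $s = -1, \dots, k$ vanishes by
  \<open>sum_alternating_gbinomial_eq_0\<close>. The right-hand side collects the three terms $s = -1$, $s = k - 1$ and
  $s = k$ outside the range, at which a binomial coefficient with upper entry $-1$ or $-2$ appears.
\<close>
lemma sum_alternating_choose_convolution:
  assumes "even k" "u + v + 2 \<le> k"
  shows "(\<Sum>s\<le>k - 2. (-1) ^ s * of_nat (Suc k choose Suc s) * of_nat (s choose u) * of_nat ((k - 2 - s) choose v)) =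
     (-1) ^ v * ((of_nat k - of_nat (u + v + 1)) * of_nat (k choose u) + of_nat ((k - 1) choose u)
       + (-1) ^ (u + v) * of_nat ((k - 1) choose v) :: rat)"
proof -
  obtain m where k: "k = Suc (Suc m)" using assms by (cases k; cases "k - 1") auto
  let ?f = "\<lambda>j. (-1) ^ j * of_nat (Suc k choose j) * ((-1 + of_nat j) gchoose u) *
     ((of_nat (k - 1) - of_nat j) gchoose v) :: rat"
  have split: "(\<Sum>j\<le>Suc k. f j) = f 0 + (\<Sum>s\<le>m. f (Suc s)) + f k + f (Suc k)" for f :: "nat \<Rightarrow> rat"
    unfolding k sum.atMost_Suc[of f "Suc (Suc m)"] sum.atMost_Suc[of f "Suc m"] sum.atMost_Suc_shift[of f m] ..
  have "0 = (\<Sum>j\<le>Suc k. ?f j)"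
    using sum_alternating_gbinomial_eq_0[of u v "Suc k" "-1 :: rat" "of_nat (k - 1)"] assms by simp
  also have "\<dots> = ?f 0 + (\<Sum>s\<le>m. ?f (Suc s)) + ?f k + ?f (Suc k)"
    by (rule split)
  also have "?f 0 = (-1) ^ u * of_nat ((k - 1) choose v)"
    by (simp add: gbinomial_neg_1 binomial_gbinomial)
  also have "?f k = of_nat (Suc k) * of_nat ((k - 1) choose u) * (-1) ^ v"
  proof -
    have e: "-1 + of_nat k = (of_nat (k - 1) :: rat)" "of_nat (k - 1) - of_nat k = (-1 :: rat)"
      by (simp_all add: k)
    show ?thesis
      using assms by (simp only: e gbinomial_neg_1 binomial_gbinomial[symmetric] binomial_Suc_n) simp
  qed
  also have "?f (Suc k) = - (of_nat (k choose u) * ((-1) ^ v * of_nat (Suc v)))"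
  proof -
    have e: "-1 + of_nat (Suc k) = (of_nat k :: rat)" "of_nat (k - 1) - of_nat (Suc k) = (-2 :: rat)"
      by (simp_all add: k)
    show ?thesis
      using assms by (simp only: e gbinomial_neg_2 binomial_gbinomial[symmetric] binomial_n_n) simp
  qed
  also have "(\<Sum>s\<le>m. ?f (Suc s)) = - (\<Sum>s\<le>k - 2. (-1) ^ s * of_nat (Suc k choose Suc s) *
      of_nat (s choose u) * of_nat ((k - 2 - s) choose v))"
    unfolding sum_negf[symmetric]
  proof (rule sum.cong)
    fix s assume "s \<in> {..k - 2}"
    hence "-1 + of_nat (Suc s) = (of_nat s :: rat)" "of_nat (k - 1) - of_nat (Suc s) = (of_nat (k - 2 - s) :: rat)"
      by (simp_all add: k of_nat_diff)
    thus "?f (Suc s) = - ((-1) ^ s * of_nat (Suc k choose Suc s) * of_nat (s choose u) * of_nat ((k - 2 - s) choose v))"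
      by (simp only: binomial_gbinomial[symmetric] power_Suc mult_minus_left mult_1_left)
  qed (simp add: k)
  finally have eq: "(\<Sum>s\<le>k - 2. (-1) ^ s * of_nat (Suc k choose Suc s) * of_nat (s choose u) *
      of_nat ((k - 2 - s) choose v)) = (-1) ^ u * of_nat ((k - 1) choose v) +
      (-1) ^ v * (of_nat (Suc k) * of_nat ((k - 1) choose u) - of_nat (Suc v) * of_nat (k choose u) :: rat)"
    by (simp add: algebra_simps del: of_nat_Suc binomial_Suc_Suc)
  have "(k - u) * (k choose u) = k * ((k - 1) choose u)"
    by (rule binomial_absorb_comp)
  hence "of_nat (k - u) * of_nat (k choose u) = (of_nat k * of_nat ((k - 1) choose u) :: rat)"
    by (metis of_nat_mult)
  moreover have "of_nat (k - u) = (of_nat k - of_nat u :: rat)"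
    using assms by (simp add: of_nat_diff)
  ultimately have absorb: "of_nat k * of_nat ((k - 1) choose u) = ((of_nat k - of_nat u) * of_nat (k choose u) :: rat)"
    by simp
  have "of_nat (Suc k) * of_nat ((k - 1) choose u) - of_nat (Suc v) * of_nat (k choose u) =
      ((of_nat k - of_nat (u + v + 1)) * of_nat (k choose u) + of_nat ((k - 1) choose u) :: rat)"
    using absorb by (simp add: algebra_simps)
  moreover have "(-1) ^ v * (-1) ^ (u + v) = ((-1) ^ u :: rat)"
    by (simp add: power_add mult.assoc[symmetric] flip: power_mult_distrib)
  ultimately show ?thesis
    unfolding eq by (simp add: distrib_left mult.assoc[symmetric])
qed

section \<open>Marked sums modulo $p^2$\<close>

context at_prime
begin

lemma harm2_conv_double_sum:
  "harm2 N a b = (\<Sum>l\<in>{1..N}. \<Sum>n\<in>{1..l}. 1 / of_nat n ^ a * (1 / of_nat l ^ b))"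
  by (simp add: harm2_def harm_def sum_divide_distrib)

lemma double_sum_reflect:
  fixes F :: "nat \<Rightarrow> nat \<Rightarrow> rat"
  shows "(\<Sum>l\<in>{1..p - 1}. \<Sum>n\<in>{1..l}. F n l) = (\<Sum>l\<in>{1..p - 1}. \<Sum>n\<in>{1..l}. F (p - l) (p - n))"
proof -
  have "(\<Sum>(l, n)\<in>(SIGMA l:{1..p - 1}. {1..l}). F n l) =
      (\<Sum>(l, n)\<in>(SIGMA l:{1..p - 1}. {1..l}). F (p - l) (p - n))"
    by (rule sum.reindex_bij_witness[of _ "\<lambda>(l, n). (p - n, p - l)" "\<lambda>(l, n). (p - n, p - l)"]) auto
  thus ?thesis by (subst (1 2) sum.Sigma) auto
qed

text \<open>
  The reflection $(n, l) \mapsto (p - l, p - n)$ expanded to first order in \<open>p\<close>.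
\<close>
lemma harm2_reverse:
  assumes "even (a + b)"
  shows "harm2 (p - 1) b a \<sim>\<^bsub>2\<^esub> harm2 (p - 1) a b +
    of_nat p * (of_nat a * harm2 (p - 1) (Suc a) b + of_nat b * harm2 (p - 1) a (Suc b))"
proof -
  let ?P = "of_nat p :: rat"
  have sgn: "(-1) ^ b * (-1) ^ a = (1 :: rat)"
    using assms by (simp add: add.commute flip: power_add)
  have "harm2 (p - 1) b a = (\<Sum>l\<in>{1..p - 1}. \<Sum>n\<in>{1..l}. 1 / of_nat (p - l) ^ b * (1 / of_nat (p - n) ^ a))"
    unfolding harm2_conv_double_sum by (rule double_sum_reflect)
  also have "\<dots> \<sim>\<^bsub>2\<^esub> (\<Sum>l\<in>{1..p - 1}. \<Sum>n\<in>{1..l}.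
     1 / of_nat n ^ a * (1 / of_nat l ^ b) + ?P * (of_nat a * (1 / of_nat n ^ Suc a * (1 / of_nat l ^ b))
      + of_nat b * (1 / of_nat n ^ a * (1 / of_nat l ^ Suc b))))"
  proof (rule zcong_sum, rule zcong_sum)
    fix l n assume ln: "l \<in> {1..p - 1}" "n \<in> {1..l}"
    have l: "1 \<le> l" "l < p" and n: "1 \<le> n" "n < p" using ln by auto
    define x y z w :: rat where "x = 1 / of_nat n ^ a" "y = 1 / of_nat l ^ b"
      "z = 1 / of_nat n ^ Suc a" "w = 1 / of_nat l ^ Suc b"
    have Zp: "x \<in> Zp 0" "y \<in> Zp 0" "z \<in> Zp 0" "w \<in> Zp 0"
      unfolding x_y_z_w_def by (rule one_over_power_Zp[OF n] one_over_power_Zp[OF l])+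
    have "1 / of_nat (p - l) ^ b \<sim>\<^bsub>2\<^esub> (-1) ^ b * (y + of_nat b * ?P * w)"
      using one_over_reflect_2[OF l, of b] by (simp only: x_y_z_w_def times_divide_eq_right mult_1_right)
    moreover have "1 / of_nat (p - n) ^ a \<sim>\<^bsub>2\<^esub> (-1) ^ a * (x + of_nat a * ?P * z)"
      using one_over_reflect_2[OF n, of a] by (simp only: x_y_z_w_def times_divide_eq_right mult_1_right)
    moreover have "1 / of_nat (p - l) ^ b \<in> Zp 0"
      using ln by (intro one_over_power_Zp) auto
    moreover have "(-1) ^ a * (x + of_nat a * ?P * z) \<in> Zp 0"
      using Zp by (intro Zp_mult_left Zp_add) auto
    ultimately have "1 / of_nat (p - l) ^ b * (1 / of_nat (p - n) ^ a) \<sim>\<^bsub>2\<^esub>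
      ((-1) ^ b * (y + of_nat b * ?P * w)) * ((-1) ^ a * (x + of_nat a * ?P * z))"
      by (rule zcong_mult)
    also have "\<dots> = ((-1) ^ b * (-1) ^ a) * ((y + of_nat b * ?P * w) * (x + of_nat a * ?P * z))"
      by (simp only: mult_ac)
    also have "\<dots> = (x * y + ?P * (of_nat a * (z * y) + of_nat b * (x * w))) +
        (?P * ?P) * (of_nat b * of_nat a * w * z)"
      unfolding sgn by (simp add: algebra_simps)
    also have "\<dots> \<sim>\<^bsub>2\<^esub> (x * y + ?P * (of_nat a * (z * y) + of_nat b * (x * w))) + 0"
    proof (intro zcong_add zcong_refl)
      have "of_nat b * of_nat a * w * z \<in> Zp 0" using Zp by (intro Zp_mult_left Zp_of_nat)
      thus "(?P * ?P) * (of_nat b * of_nat a * w * z) \<sim>\<^bsub>2\<^esub> 0"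
        unfolding zcong_0_iff by (rule Zp_mult_right[OF Zp_mult_1_1[OF Zp_p Zp_p]])
    qed
    finally show "1 / of_nat (p - l) ^ b * (1 / of_nat (p - n) ^ a) \<sim>\<^bsub>2\<^esub>
      1 / of_nat n ^ a * (1 / of_nat l ^ b) + ?P * (of_nat a * (1 / of_nat n ^ Suc a * (1 / of_nat l ^ b))
      + of_nat b * (1 / of_nat n ^ a * (1 / of_nat l ^ Suc b)))"
      unfolding x_y_z_w_def by simp
  qed
  also have "\<dots> = harm2 (p - 1) a b +
    ?P * (of_nat a * harm2 (p - 1) (Suc a) b + of_nat b * harm2 (p - 1) a (Suc b))"
    unfolding harm2_conv_double_sum by (simp only: sum.distrib sum_distrib_left distrib_left)
  finally show ?thesis .
qed

text \<open>
  A full sum $H_a$ vanishes modulo \<open>p\<close>, so an initial segment is minus the complementary final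
  segment, which the reflection maps back to an initial segment.
\<close>
lemma harm_reflect:
  assumes "1 \<le> l" "l < p" "1 \<le> a" "a + 2 \<le> p"
  shows "harm (p - l) a \<sim>\<^bsub>1\<^esub> - ((-1) ^ a) * harm (l - 1) a"
proof -
  have "{1..p - 1} = {1..p - l} \<union> {p - l + 1..p - 1}" using assms by auto
  hence "H a = harm (p - l) a + (\<Sum>n\<in>{p - l + 1..p - 1}. 1 / of_nat n ^ a)"
    unfolding harm_def by (simp add: sum.union_disjoint)
  also have "(\<Sum>n\<in>{p - l + 1..p - 1}. 1 / of_nat n ^ a :: rat) = (\<Sum>n\<in>{1..l - 1}. 1 / of_nat (p - n) ^ a)"
    using assms by (intro sum.reindex_bij_witness[of _ "\<lambda>n. p - n" "\<lambda>n. p - n"]) auto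
  finally have "harm (p - l) a = H a - (\<Sum>n\<in>{1..l - 1}. 1 / of_nat (p - n) ^ a)" by simp
  also have "\<dots> \<sim>\<^bsub>1\<^esub> 0 - (\<Sum>n\<in>{1..l - 1}. (-1) ^ a / of_nat n ^ a)"
    using assms H_Zp_1[of a]
    by (intro zcong_diff zcong_sum one_over_reflect_1) (auto simp: zcong_0_iff)
  also have "\<dots> = - ((-1) ^ a) * harm (l - 1) a"
    by (simp add: harm_def sum_distrib_left sum_negf)
  finally show ?thesis .
qed

text \<open>
  The reflection changes the sign of the triple sum, because its weight is odd, and makes the
  inequalities strict. The difference between strict and weak inequalities consists of double sums
  and of one power sum.
\<close>
lemma triple_sum_zcong:
  assumes "1 \<le> a" "1 \<le> b" "even (a + b)" "a + b + 3 \<le> p"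
  shows "2 * (\<Sum>l\<in>{1..p - 1}. harm l 1 * (harm l a / of_nat l ^ b)) \<sim>\<^bsub>1\<^esub>
    harm2 (p - 1) 1 (a + b) + harm2 (p - 1) a (Suc b)"
proof -
  let ?C = "\<Sum>l\<in>{1..p - 1}. harm l 1 * (harm l a / of_nat l ^ b)"
  have sgn: "(-1) ^ a * (-1) ^ b = (1 :: rat)"
    using assms by (simp flip: power_add)
  have "?C = (\<Sum>l\<in>{1..p - 1}. harm (p - l) 1 * (harm (p - l) a * (1 / of_nat (p - l) ^ b)))"
    by (subst sum_reflect) simp
  also have "\<dots> \<sim>\<^bsub>1\<^esub> (\<Sum>l\<in>{1..p - 1}. (- ((-1) ^ 1) * harm (l - 1) 1) *
      ((- ((-1) ^ a) * harm (l - 1) a) * ((-1) ^ b / of_nat l ^ b)))"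
  proof (intro zcong_sum zcong_mult harm_reflect one_over_reflect_1)
    fix l assume l: "l \<in> {1..p - 1}"
    show "harm (p - l) 1 \<in> Zp 0" "harm (p - l) a \<in> Zp 0" using l by (auto intro: harm_Zp_0)
    show "(-1) ^ b / of_nat l ^ b \<in> Zp 0" using l by (intro Zp_divide_power) auto
    thus "- ((-1) ^ a) * harm (l - 1) a * ((-1) ^ b / of_nat l ^ b) \<in> Zp 0"
      using l by (intro Zp_mult_left Zp_minus harm_Zp_0) auto
  qed (use assms in auto)
  also have "\<dots> = (\<Sum>l\<in>{1..p - 1}. - (harm l 1 * (harm l a / of_nat l ^ b)) + harm l 1 / of_nat l ^ (a + b)
      + harm l a / of_nat l ^ Suc b - 1 / of_nat l ^ (a + b + 1))"
  proof (rule sum.cong[OF refl])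
    fix l assume l: "l \<in> {1..p - 1}"
    have h: "harm (l - 1) c = harm l c - 1 / of_nat l ^ c" for c
    proof -
      obtain j where "l = Suc j" using l by (cases l) auto
      thus ?thesis by (simp add: harm_def)
    qed
    have "(- ((-1) ^ 1) * harm (l - 1) 1) * ((- ((-1) ^ a) * harm (l - 1) a) * ((-1) ^ b / of_nat l ^ b)) =
       - ((-1) ^ a * (-1) ^ b) * (harm (l - 1) 1 * harm (l - 1) a / of_nat l ^ b)"
      by simp
    also have "\<dots> = - ((harm l 1 - 1 / of_nat l ^ 1) * (harm l a - 1 / of_nat l ^ a) / of_nat l ^ b)"
      unfolding sgn h by simp
    also have "\<dots> = - (harm l 1 * (harm l a / of_nat l ^ b)) + harm l 1 / of_nat l ^ (a + b)
      + harm l a / of_nat l ^ Suc b - 1 / of_nat l ^ (a + b + 1)"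
      using l by (simp add: power_add field_simps)
    finally show "(- ((-1) ^ 1) * harm (l - 1) 1) * ((- ((-1) ^ a) * harm (l - 1) a) * ((-1) ^ b / of_nat l ^ b)) = \<dots>" .
  qed
  also have "\<dots> = - ?C + (harm2 (p - 1) 1 (a + b) + harm2 (p - 1) a (Suc b)) - H (a + b + 1)"
    unfolding harm2_def harm_def[of "p - 1"]
    by (simp only: sum.distrib sum_negf sum_subtractf add.assoc)
  also have "\<dots> \<sim>\<^bsub>1\<^esub> - ?C + (harm2 (p - 1) 1 (a + b) + harm2 (p - 1) a (Suc b)) - 0"
  proof (intro zcong_diff zcong_refl)
    show "H (a + b + 1) \<sim>\<^bsub>1\<^esub> 0"
      unfolding zcong_0_iff using assms by (intro H_Zp_1) auto
  qed
  finally show ?thesis by (simp add: zcong_def algebra_simps)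
qed

lemma zcong_p_mult: "x \<sim>\<^bsub>1\<^esub> y \<Longrightarrow> of_nat p * x \<sim>\<^bsub>2\<^esub> of_nat p * y"
  using zcong_mult_left[OF _ Zp_p, of x 1 y] by (simp add: numeral_2_eq_2)

text \<open>
  With $a = t + 1$, $b = s + 1$ and $w = a + b$, duality gives $-A + p T$ for the double sum
  $A = \zeta^{\star}(a, b)$ and the triple sum $T = \sum_{n, n' \le l} 1 / (n n'^a l^b)$. Here $2A$ is known modulo
  $p^2$ from the stuffle product and \<open>harm2_reverse\<close>, and $2T$ modulo $p$ from \<open>triple_sum_zcong\<close>. Everything
  is then a multiple of $B_{p-w-1} / (w + 1)$ by integers built from binomial coefficients, and these
  collapse to $1 + (-1)^s \binom{w+1}{a+1}$.
\<close>
lemma marked_star_zcong: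
  assumes "even (s + t)" "s + t + 6 \<le> p"
  shows "marked_star (p - 1) t s \<sim>\<^bsub>2\<^esub>
    (1 + (-1) ^ s * of_nat ((s + t + 3) choose Suc s)) / 2 * (of_nat p * beta (s + t + 3))"
proof -
  define a b where "a = Suc t" and "b = Suc s"
  define w where "w = a + b"
  let ?P = "of_nat p :: rat"
  have w: "even w" "w + 4 \<le> p" "s + t + 3 = Suc w" using assms by (simp_all add: w_def a_def b_def)
  have ab: "1 \<le> a" "1 \<le> b" by (simp_all add: a_def b_def)
  define B where "B = beta (Suc w)"
  define C0 C1 :: rat where "C0 = of_nat (Suc w choose a)" and "C1 = of_nat (Suc w choose Suc a)"
  define T where "T = (\<Sum>l\<in>{1..p - 1}. harm l 1 * (harm l a / of_nat l ^ b))"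
  have M: "marked_star (p - 1) t s \<sim>\<^bsub>2\<^esub> - harm2 (p - 1) a b + ?P * T"
  proof -
    have "marked_star (p - 1) t s = alt_binom_sum (p - 1) (\<lambda>l. harm l a / of_nat l ^ b)"
      unfolding marked_star_dual harm_def a_def b_def ..
    also have "\<dots> \<sim>\<^bsub>2\<^esub> - (\<Sum>l\<in>{1..p - 1}. harm l a / of_nat l ^ b) + ?P * T"
      unfolding T_def by (intro alt_binom_sum_zcong Zp_divide_power harm_Zp_0) auto
    finally show ?thesis by (simp add: harm2_def)
  qed
  have A: "2 * harm2 (p - 1) a b \<sim>\<^bsub>2\<^esub> of_nat w * (?P * B) - ?P * (of_nat a * ((-1) ^ b * C1 * B) + of_nat b * (- ((-1) ^ b) * C0 * B))"
  proof -
    let ?X = "of_nat a * harm2 (p - 1) (Suc a) b + of_nat b * harm2 (p - 1) a (Suc b)"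
    have "2 * harm2 (p - 1) a b = (H a * H b + H w - harm2 (p - 1) b a) + harm2 (p - 1) a b"
      using harm2_stuffle[of "p - 1" a b] by (simp add: w_def)
    also have "\<dots> \<sim>\<^bsub>2\<^esub> (0 + of_nat w * (?P * B) - (harm2 (p - 1) a b + ?P * ?X)) + harm2 (p - 1) a b"
    proof (intro zcong_add zcong_diff zcong_refl)
      show "H a * H b \<sim>\<^bsub>2\<^esub> 0"
        unfolding zcong_0_iff using w ab by (intro Zp_mult_1_1 H_Zp_1) (auto simp: w_def)
      show "H w \<sim>\<^bsub>2\<^esub> of_nat w * (?P * B)"
        unfolding B_def using w ab by (intro H_zcong) (auto simp: w_def)
      show "harm2 (p - 1) b a \<sim>\<^bsub>2\<^esub> harm2 (p - 1) a b + ?P * ?X"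
        using w by (intro harm2_reverse) (simp add: w_def)
    qed
    also have "\<dots> = of_nat w * (?P * B) - ?P * ?X" by simp
    also have "\<dots> \<sim>\<^bsub>2\<^esub> of_nat w * (?P * B) - ?P * (of_nat a * ((-1) ^ b * C1 * B) + of_nat b * (- ((-1) ^ b) * C0 * B))"
    proof (intro zcong_diff zcong_refl zcong_p_mult zcong_add zcong_scale Zp_of_nat)
      show "harm2 (p - 1) (Suc a) b \<sim>\<^bsub>1\<^esub> (-1) ^ b * C1 * B"
        using harm2_zcong[of "Suc a" b] ab w by (simp add: C1_def B_def w_def del: binomial_Suc_Suc)
      show "harm2 (p - 1) a (Suc b) \<sim>\<^bsub>1\<^esub> - ((-1) ^ b) * C0 * B"
        using harm2_zcong[of a "Suc b"] ab w by (simp add: C0_def B_def w_def del: binomial_Suc_Suc)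
    qed
    finally show ?thesis .
  qed
  have T: "2 * T \<sim>\<^bsub>1\<^esub> of_nat (Suc w) * B + (- ((-1) ^ b) * C0 * B)"
  proof -
    have "2 * T \<sim>\<^bsub>1\<^esub> harm2 (p - 1) 1 w + harm2 (p - 1) a (Suc b)"
      unfolding T_def w_def using w ab by (intro triple_sum_zcong) (auto simp: w_def)
    also have "\<dots> \<sim>\<^bsub>1\<^esub> of_nat (Suc w) * B + (- ((-1) ^ b) * C0 * B)"
    proof (intro zcong_add)
      show "harm2 (p - 1) 1 w \<sim>\<^bsub>1\<^esub> of_nat (Suc w) * B"
        using harm2_zcong[of 1 w] ab w by (simp add: B_def w_def del: binomial_Suc_Suc of_nat_Suc)
      show "harm2 (p - 1) a (Suc b) \<sim>\<^bsub>1\<^esub> - ((-1) ^ b) * C0 * B"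
        using harm2_zcong[of a "Suc b"] ab w by (simp add: C0_def B_def w_def del: binomial_Suc_Suc)
    qed
    finally show ?thesis .
  qed
  have "of_nat 2 * marked_star (p - 1) t s \<sim>\<^bsub>2\<^esub> 2 * (- harm2 (p - 1) a b + ?P * T)"
    using zcong_scale[OF M, of 2] by simp
  also have "\<dots> = - (2 * harm2 (p - 1) a b) + ?P * (2 * T)" by simp
  also have "\<dots> \<sim>\<^bsub>2\<^esub> - (of_nat w * (?P * B) - ?P * (of_nat a * ((-1) ^ b * C1 * B) + of_nat b * (- ((-1) ^ b) * C0 * B)))
     + ?P * (of_nat (Suc w) * B + (- ((-1) ^ b) * C0 * B))"
    by (intro zcong_add zcong_minus A zcong_p_mult T)
  also have "\<dots> = ?P * B * (1 + (-1) ^ b * (of_nat a * C1 - of_nat (Suc b) * C0))"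
    by (simp add: algebra_simps)
  also have "of_nat a * C1 - of_nat (Suc b) * C0 = - C1"
  proof -
    have "Suc a * (Suc w choose Suc a) = (Suc w - a) * (Suc w choose a)"
      using binomial_absorption[of a "Suc w"] binomial_absorb_comp[of "Suc w" a] by simp
    hence "of_nat (Suc a) * C1 = of_nat (Suc b) * C0"
      unfolding C0_def C1_def by (metis w_def add_diff_cancel_left' add_Suc_right of_nat_mult)
    thus ?thesis by (simp add: algebra_simps)
  qed
  also have "?P * B * (1 + (-1) ^ b * - C1) =
      of_nat 2 * ((1 + (-1) ^ s * of_nat ((s + t + 3) choose Suc s)) / 2 * (?P * beta (s + t + 3)))"
  proof -
    have "Suc w choose Suc a = Suc w choose Suc s"
      by (subst binomial_symmetric) (auto simp: w_def a_def b_def)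
    thus ?thesis
      unfolding w(3) by (simp add: C1_def B_def b_def algebra_simps del: binomial_Suc_Suc)
  qed
  finally show ?thesis
    by (rule zcong_cancel) (use assms in auto)
qed

lemma marked_star_Zp_0: "marked_star (p - 1) t s \<in> Zp 0"
proof -
  have "(\<Sum>n\<in>{1..l}. 1 / of_nat n ^ Suc t) / of_nat l ^ Suc s \<in> Zp 0" if "l \<in> {1..p - 1}" for l
    using that by (intro Zp_divide_power Zp_sum one_over_power_Zp) auto
  thus ?thesis
    unfolding marked_star_dual alt_binom_sum_def by (intro Zp_sum Zp_mult_left) auto
qed

lemma marked_star_Zp_1:
  assumes "even (s + t)" "s + t + 6 \<le> p"
  shows "marked_star (p - 1) s t \<in> Zp 1"
proof (rule zcong_in)
  have "marked_star (p - 1) s t \<sim>\<^bsub>2\<^esub> (1 + (-1) ^ t * of_nat ((t + s + 3) choose Suc t)) / 2 * (of_nat p * beta (t + s + 3))"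
    using assms by (intro marked_star_zcong) (auto simp: add_ac)
  thus "marked_star (p - 1) s t \<sim>\<^bsub>1\<^esub> (1 + (-1) ^ t * of_nat ((t + s + 3) choose Suc t)) / 2 * (of_nat p * beta (t + s + 3))"
    by (rule zcong_mono) simp
  have "(1 + (-1) ^ t * of_nat ((t + s + 3) choose Suc t)) / of_nat 2 \<in> Zp 0"
    using assms by (intro Zp_divide Zp_add Zp_mult_left) auto
  moreover have "of_nat p * beta (t + s + 3) \<in> Zp 1"
    using assms by (intro Zp_mult_right Zp_p beta_Zp) auto
  ultimately show "(1 + (-1) ^ t * of_nat ((t + s + 3) choose Suc t)) / 2 * (of_nat p * beta (t + s + 3)) \<in> Zp 1"
    using Zp_mult_left by (simp only: of_nat_numeral)
qed

text \<open>
  In \<open>marked_conv_marked_star\<close> only the term $i = j = 0$ survives: if $i + j$ is odd then one of the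
  two coefficients is divisible by $p^2$, and otherwise the remaining sum has even weight and
  contributes a factor \<open>p\<close> of its own.
\<close>
lemma marked_zcong_marked_star:
  assumes "even (s + t)" "s + t + 6 \<le> p"
  shows "marked (p - 1) s t \<sim>\<^bsub>2\<^esub> marked_star (p - 1) t s"
proof -
  have "marked (p - 1) s t \<sim>\<^bsub>2\<^esub> (\<Sum>i\<le>s. \<Sum>j\<le>t. if i = 0 \<and> j = 0 then marked_star (p - 1) t s else 0)"
    unfolding marked_conv_marked_star
  proof (intro zcong_sum)
    fix i j assume ij: "i \<in> {..s}" "j \<in> {..t}"
    let ?e = "ecoeff (p - 1)"
    show "?e i * ?e j * marked_star (p - 1) (t - j) (s - i) \<sim>\<^bsub>2\<^esub>
        (if i = 0 \<and> j = 0 then marked_star (p - 1) t s else 0)"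
    proof (cases "i = 0 \<and> j = 0")
      case False
      have e0: "?e i \<in> Zp 0" "?e j \<in> Zp 0" using ij assms by (simp_all add: ecoeff_Zp_0 del: One_nat_def)
      have "?e i * ?e j * marked_star (p - 1) (t - j) (s - i) \<in> Zp 2"
      proof (cases "even (i + j)")
        case True
        have "even (t - j + (s - i))" using True assms ij by (simp add: even_add)
        hence "marked_star (p - 1) (t - j) (s - i) \<in> Zp 1"
          using assms ij by (intro marked_star_Zp_1) auto
        moreover have "?e i * ?e j \<in> Zp 1"
        proof (cases "i = 0")
          case True
          thus ?thesis using False ij assms by (simp add: ecoeff_Zp_1 del: One_nat_def)
        next
          case False
          hence "?e i \<in> Zp 1" using ij assms by (intro ecoeff_Zp_1) auto
          thus ?thesis using e0(2) by (rule Zp_mult_right)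
        qed
        ultimately show ?thesis by (intro Zp_mult_1_1)
      next
        case False
        hence "?e i \<in> Zp 2 \<or> ?e j \<in> Zp 2"
          using coeffs_odd_Zp_2(1)[of i] coeffs_odd_Zp_2(1)[of j] ij assms by (auto simp del: One_nat_def)
        hence "?e i * ?e j \<in> Zp 2" using e0 Zp_mult_left Zp_mult_right by blast
        thus ?thesis by (rule Zp_mult_right[OF _ marked_star_Zp_0])
      qed
      thus ?thesis using False by (simp add: zcong_0_iff)
    qed simp
  qed
  also have "(\<Sum>i\<le>s. \<Sum>j\<le>t. if i = 0 \<and> j = 0 then marked_star (p - 1) t s else 0) = marked_star (p - 1) t s"
  proof -
    have "(\<Sum>i\<le>s. \<Sum>j\<le>t. if i = 0 \<and> j = 0 then marked_star (p - 1) t s else 0) =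
       (\<Sum>i\<le>s. if i = 0 then (\<Sum>j\<le>t. if j = 0 then marked_star (p - 1) t s else 0) else 0)"
      by (intro sum.cong) auto
    thus ?thesis by simp
  qed
  finally show ?thesis .
qed

lemma marked_Zp_0:
  assumes "s + t + 2 \<le> p"
  shows "marked (p - 1) s t \<in> Zp 0"
  unfolding marked_conv_marked_star using assms
  by (intro Zp_sum Zp_mult_left marked_star_Zp_0 ecoeff_Zp_0) auto

text \<open>
  For $n < k - 2$ either the degree $k - 2 - n$ is odd and the coefficient is divisible by $p^2$, or both
  degrees are even and each factor contributes one \<open>p\<close>.
\<close>
lemma convolution_zcong:
  assumes "even k" "2 \<le> k" "k + 4 \<le> p"
    and x: "\<And>n. n \<le> k - 2 \<Longrightarrow> x n \<in> Zp 0" "\<And>n. n \<le> k - 2 \<Longrightarrow> even n \<Longrightarrow> x n \<in> Zp 1"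
    and c: "\<And>l. 1 \<le> l \<Longrightarrow> l + 2 \<le> p \<Longrightarrow> c l \<in> Zp 1" "\<And>l. odd l \<Longrightarrow> l + 4 \<le> p \<Longrightarrow> c l \<in> Zp 2" "c 0 = 1"
  shows "(\<Sum>n\<le>k - 2. x n * c (k - 2 - n)) \<sim>\<^bsub>2\<^esub> x (k - 2)"
proof -
  have "(\<Sum>n\<le>k - 2. x n * c (k - 2 - n)) \<sim>\<^bsub>2\<^esub> (\<Sum>n\<le>k - 2. if n = k - 2 then x (k - 2) else 0)"
  proof (rule zcong_sum)
    fix n assume n: "n \<in> {..k - 2}"
    show "x n * c (k - 2 - n) \<sim>\<^bsub>2\<^esub> (if n = k - 2 then x (k - 2) else 0)"
    proof (cases "n = k - 2")
      case False
      have "x n * c (k - 2 - n) \<in> Zp 2"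
      proof (cases "even n")
        case True
        thus ?thesis using n False assms by (intro Zp_mult_1_1 x c) auto
      next
        case odd: False
        have "odd (k - 2 - n)" using odd n assms by auto
        thus ?thesis using n assms by (intro Zp_mult_left x c) auto
      qed
      thus ?thesis using False by (simp add: zcong_0_iff)
    qed (simp add: c)
  qed
  thus ?thesis by simp
qed

text \<open>
  This is $a_{k,r,i} / 2$ for $u = i - 1$, $v = r - i$, and $b_{k,r,i} / 2$ with $u$ and $v$ exchanged.
\<close>
definition marked_value :: "nat \<Rightarrow> nat \<Rightarrow> nat \<Rightarrow> rat" where
  "marked_value k u v = (of_nat ((k - 1) choose (u + v + 1)) +
     (-1) ^ v * ((of_nat k - of_nat (u + v + 1)) * of_nat (k choose u) + of_nat ((k - 1) choose u)
       + (-1) ^ (u + v) * of_nat ((k - 1) choose v))) / 2"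

lemma sum_marked_value:
  assumes "even k" "u + v + 2 \<le> k"
  shows "(\<Sum>s\<le>k - 2. of_nat (s choose u) * of_nat ((k - 2 - s) choose v) *
     ((1 + (-1) ^ s * of_nat (Suc k choose Suc s)) / 2)) = marked_value k u v"
proof -
  have "(\<Sum>s\<le>k - 2. of_nat (s choose u) * of_nat ((k - 2 - s) choose v)) =
      (of_nat (\<Sum>s\<le>k - 2. (s choose u) * ((k - 2 - s) choose v)) :: rat)"
    by simp
  also have "\<dots> = of_nat ((k - 1) choose (u + v + 1))"
  proof -
    have "Suc (k - 2) = k - 1" using assms by simp
    thus ?thesis by (simp only: sum_choose_convolution Suc_eq_plus1)
  qed
  finally have 1: "(\<Sum>s\<le>k - 2. of_nat (s choose u) * of_nat ((k - 2 - s) choose v)) =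
      (of_nat ((k - 1) choose (u + v + 1)) :: rat)" .
  have "(\<Sum>s\<le>k - 2. of_nat (s choose u) * of_nat ((k - 2 - s) choose v) *
     ((1 + (-1) ^ s * of_nat (Suc k choose Suc s)) / 2)) =
     ((\<Sum>s\<le>k - 2. of_nat (s choose u) * of_nat ((k - 2 - s) choose v)) +
     (\<Sum>s\<le>k - 2. (-1) ^ s * of_nat (Suc k choose Suc s) * of_nat (s choose u) * of_nat ((k - 2 - s) choose v))) / (2 :: rat)"
    unfolding sum.distrib[symmetric] sum_divide_distrib
    by (intro sum.cong refl) (simp add: algebra_simps add_divide_distrib del: binomial_Suc_Suc)
  thus ?thesis
    unfolding 1 sum_alternating_choose_convolution[OF assms] marked_value_def .
qed

lemma sum_indices_at_zcong:
  assumes "even k" "1 \<le> i" "i \<le> r" "r < k" "k + 4 \<le> p"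
  shows "(\<Sum>ks\<in>indices_at k r i. mzeta (p - 1) ks) \<sim>\<^bsub>2\<^esub>
      (-1) ^ (r - 1) * (marked_value k (i - 1) (r - i) * (of_nat p * beta (Suc k)))"
    and "(\<Sum>ks\<in>indices_at k r i. mzeta_star (p - 1) ks) \<sim>\<^bsub>2\<^esub>
      marked_value k (r - i) (i - 1) * (of_nat p * beta (Suc k))"
proof -
  have k: "2 \<le> k" using assms by (cases k; cases "k - 1") auto
  define u v where "u = i - 1" and "v = r - i"
  have uv: "u + v + 2 \<le> k" using assms by (simp add: u_def v_def)
  let ?c = "\<lambda>n s. of_nat (s choose u) * of_nat ((n - s) choose v) :: rat"
  let ?val = "\<lambda>s. (1 + (-1) ^ s * of_nat (Suc k choose Suc s)) / 2 * (of_nat p * beta (Suc k))"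
  have val: "marked_star (p - 1) (k - 2 - s) s \<sim>\<^bsub>2\<^esub> ?val s" if "s \<le> k - 2" for s
  proof -
    have e: "s + (k - 2 - s) + 3 = Suc k" and "s + (k - 2 - s) = k - 2" using that k by auto
    hence "even (s + (k - 2 - s))" "s + (k - 2 - s) + 6 \<le> p" using assms k by simp_all
    thus ?thesis
      using marked_star_zcong[of s "k - 2 - s"] unfolding e by blast
  qed
  have "(\<Sum>n\<le>k - 2. (\<Sum>s\<le>n. ?c n s * marked (p - 1) s (n - s)) * hcoeff 0 (p - 1) (k - 2 - n)) \<sim>\<^bsub>2\<^esub>
      (\<Sum>s\<le>k - 2. ?c (k - 2) s * marked (p - 1) s (k - 2 - s))"
  proof (rule convolution_zcong)
    fix n assume n: "n \<le> k - 2"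
    show "(\<Sum>s\<le>n. ?c n s * marked (p - 1) s (n - s)) \<in> Zp 0"
      using n assms by (intro Zp_sum Zp_mult_left marked_Zp_0 Zp_of_nat) auto
    assume "even n"
    have "marked (p - 1) s (n - s) \<in> Zp 1" if "s \<le> n" for s
    proof (rule zcong_in)
      show "marked (p - 1) s (n - s) \<sim>\<^bsub>1\<^esub> marked_star (p - 1) (n - s) s"
        using n assms that \<open>even n\<close> k by (intro zcong_mono[OF marked_zcong_marked_star, of _ _ 1]) auto
      show "marked_star (p - 1) (n - s) s \<in> Zp 1"
        using n assms that \<open>even n\<close> k by (intro marked_star_Zp_1) auto
    qed
    thus "(\<Sum>s\<le>n. ?c n s * marked (p - 1) s (n - s)) \<in> Zp 1"
      by (intro Zp_sum Zp_mult_left Zp_of_nat) auto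
  qed (use assms k in \<open>simp_all add: hcoeff_Zp_1 coeffs_odd_Zp_2 del: One_nat_def\<close>)
  also have "\<dots> \<sim>\<^bsub>2\<^esub> (\<Sum>s\<le>k - 2. ?c (k - 2) s * ?val s)"
  proof (intro zcong_sum zcong_scale)
    fix s assume s: "s \<in> {..k - 2}"
    have "marked (p - 1) s (k - 2 - s) \<sim>\<^bsub>2\<^esub> marked_star (p - 1) (k - 2 - s) s"
      using s assms k by (intro marked_zcong_marked_star) auto
    also have "\<dots> \<sim>\<^bsub>2\<^esub> ?val s"
      using s by (intro val) simp
    finally show "marked (p - 1) s (k - 2 - s) \<sim>\<^bsub>2\<^esub> ?val s" .
    show "?c (k - 2) s \<in> Zp 0" by (intro Zp_mult_left Zp_of_nat)
  qed
  also have "\<dots> = marked_value k u v * (of_nat p * beta (Suc k))"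
    unfolding sum_marked_value[OF assms(1) uv, symmetric] sum_distrib_right by (simp only: mult.assoc)
  finally show "(\<Sum>ks\<in>indices_at k r i. mzeta (p - 1) ks) \<sim>\<^bsub>2\<^esub>
      (-1) ^ (r - 1) * (marked_value k (i - 1) (r - i) * (of_nat p * beta (Suc k)))"
    unfolding sum_indices_at_mzeta[OF assms(2,3) k] u_def v_def by (intro zcong_scale) auto
  have "(\<Sum>n\<le>k - 2. (\<Sum>s\<le>n. ?c n s * marked_star (p - 1) s (n - s)) * ecoeff (p - 1) (k - 2 - n)) \<sim>\<^bsub>2\<^esub>
      (\<Sum>s\<le>k - 2. ?c (k - 2) s * marked_star (p - 1) s (k - 2 - s))"
  proof (rule convolution_zcong)
    fix n assume n: "n \<le> k - 2"
    show "(\<Sum>s\<le>n. ?c n s * marked_star (p - 1) s (n - s)) \<in> Zp 0"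
      by (intro Zp_sum Zp_mult_left marked_star_Zp_0 Zp_of_nat)
    assume "even n"
    have "marked_star (p - 1) s (n - s) \<in> Zp 1" if "s \<le> n" for s
      using n assms that \<open>even n\<close> k by (intro marked_star_Zp_1) auto
    thus "(\<Sum>s\<le>n. ?c n s * marked_star (p - 1) s (n - s)) \<in> Zp 1"
      by (intro Zp_sum Zp_mult_left Zp_of_nat) auto
  qed (use assms k in \<open>simp_all add: ecoeff_Zp_1 coeffs_odd_Zp_2 del: One_nat_def\<close>)
  also have "\<dots> \<sim>\<^bsub>2\<^esub> (\<Sum>s\<le>k - 2. ?c (k - 2) s * ?val (k - 2 - s))"
  proof (intro zcong_sum zcong_scale)
    fix s assume s: "s \<in> {..k - 2}"
    show "marked_star (p - 1) s (k - 2 - s) \<sim>\<^bsub>2\<^esub> ?val (k - 2 - s)"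
    proof -
      have e: "k - 2 - (k - 2 - s) = s" using s by simp
      show ?thesis using val[OF diff_le_self[of "k - 2" s]] unfolding e .
    qed
    show "?c (k - 2) s \<in> Zp 0" by (intro Zp_mult_left Zp_of_nat)
  qed
  also have "(\<Sum>s\<le>k - 2. ?c (k - 2) s * ?val (k - 2 - s)) =
      (\<Sum>s\<le>k - 2. of_nat (s choose v) * of_nat ((k - 2 - s) choose u) * ?val s)"
    by (rule sum.reindex_bij_witness[of _ "\<lambda>s. k - 2 - s" "\<lambda>s. k - 2 - s"]) (auto simp: mult.commute simp del: diff_diff_left)
  also have "\<dots> = marked_value k v u * (of_nat p * beta (Suc k))"
  proof -
    have vu: "v + u + 2 \<le> k" using uv by simp
    show ?thesis
      unfolding sum_marked_value[OF assms(1) vu, symmetric] sum_distrib_right by (simp only: mult.assoc)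
  qed
  finally show "(\<Sum>ks\<in>indices_at k r i. mzeta_star (p - 1) ks) \<sim>\<^bsub>2\<^esub>
      marked_value k (r - i) (i - 1) * (of_nat p * beta (Suc k))"
    unfolding sum_indices_at_mzeta_star[OF assms(2,3) k] u_def v_def .
qed

section \<open>The congruences behind the sum formulas\<close>

text \<open>
  The term $j = k$ of the bilinear expression remains. The term $j = 0$ is absent because $r \ge 1$, and
  the others are mixed products.
\<close>
lemma sum_indices_zcong:
  assumes "1 \<le> r" "r \<le> k" "k + 4 \<le> p" "n = 2 \<or> n = 3 \<and> odd k"
  shows "(\<Sum>ks\<in>indices k r. mzeta (p - 1) ks) \<sim>\<^bsub>n\<^esub> (-1) ^ (r - 1) * of_nat (k choose r) * hcoeff 0 (p - 1) k"
    and "(\<Sum>ks\<in>indices k r. mzeta_star (p - 1) ks) \<sim>\<^bsub>n\<^esub> of_nat (k choose r) * hcoeff 0 (p - 1) k"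
proof -
  have *: "(\<Sum>j\<le>k. of_nat (j choose r) * c j * d (k - j)) \<sim>\<^bsub>n\<^esub> of_nat (k choose r) * c k"
    if c: "\<And>l. 1 \<le> l \<Longrightarrow> l + 2 \<le> p \<Longrightarrow> c l \<in> Zp 1" "\<And>l. odd l \<Longrightarrow> l + 4 \<le> p \<Longrightarrow> c l \<in> Zp 2"
      and d: "\<And>l. 1 \<le> l \<Longrightarrow> l + 2 \<le> p \<Longrightarrow> d l \<in> Zp 1" "\<And>l. odd l \<Longrightarrow> l + 4 \<le> p \<Longrightarrow> d l \<in> Zp 2" "d 0 = 1"
    for c d :: "nat \<Rightarrow> rat"
  proof -
    have "(\<Sum>j\<le>k. of_nat (j choose r) * c j * d (k - j)) \<sim>\<^bsub>n\<^esub>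
      (\<Sum>j\<le>k. if j = k then of_nat (k choose r) * c k else 0)"
    proof (rule zcong_sum)
      fix j assume j: "j \<in> {..k}"
      consider "j = 0" | "j = k" | "1 \<le> j" "j < k" using j by force
      thus "of_nat (j choose r) * c j * d (k - j) \<sim>\<^bsub>n\<^esub> (if j = k then of_nat (k choose r) * c k else 0)"
      proof cases
        case 1
        thus ?thesis using assms by (cases r) auto
      next
        case 2
        thus ?thesis by (simp add: d)
      next
        case 3
        have "c j * d (k - j) \<in> Zp n"
          using 3 assms by (intro mixed_product_Zp[of j "k - j"] c d) auto
        hence "of_nat (j choose r) * (c j * d (k - j)) \<in> Zp n"
          by (rule Zp_mult_left[OF Zp_of_nat])
        thus ?thesis using 3 by (simp add: zcong_0_iff mult.assoc)
      qed
    qed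
    thus ?thesis by simp
  qed
  have "(\<Sum>ks\<in>indices k r. mzeta (p - 1) ks) \<sim>\<^bsub>n\<^esub> (-1) ^ r * (of_nat (k choose r) * ecoeff (p - 1) k)"
    unfolding sum_indices_mzeta
    by (intro zcong_scale * ecoeff_Zp_1 hcoeff_Zp_1 coeffs_odd_Zp_2) auto
  also have "\<dots> \<sim>\<^bsub>n\<^esub> (-1) ^ r * (of_nat (k choose r) * - hcoeff 0 (p - 1) k)"
    using assms by (intro zcong_scale ecoeff_hcoeff) auto
  also have "\<dots> = (-1) ^ (r - 1) * of_nat (k choose r) * hcoeff 0 (p - 1) k"
    using assms(1) by (cases r) auto
  finally show "(\<Sum>ks\<in>indices k r. mzeta (p - 1) ks) \<sim>\<^bsub>n\<^esub> \<dots>" .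
  show "(\<Sum>ks\<in>indices k r. mzeta_star (p - 1) ks) \<sim>\<^bsub>n\<^esub> of_nat (k choose r) * hcoeff 0 (p - 1) k"
    unfolding sum_indices_mzeta_star
    by (intro * ecoeff_Zp_1 hcoeff_Zp_1 coeffs_odd_Zp_2) auto
qed

lemma sum_indices_zcong_2:
  assumes "0 < r" "r \<le> k" "k + 4 \<le> p"
  shows "(\<Sum>ks\<in>indices k r. mzeta (p - 1) ks) \<sim>\<^bsub>2\<^esub>
       (-1) ^ (r - 1) * of_nat (k choose r) / of_nat (k + 1) * (bernoulli (p - (k + 1)) * of_nat p)"
    and "(\<Sum>ks\<in>indices k r. mzeta_star (p - 1) ks) \<sim>\<^bsub>2\<^esub>
       of_nat (k choose r) / of_nat (k + 1) * (bernoulli (p - (k + 1)) * of_nat p)"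
proof -
  have h: "hcoeff 0 (p - 1) k \<sim>\<^bsub>2\<^esub> of_nat p * beta (Suc k)"
    using assms by (intro hcoeff_zcong) auto
  have "(\<Sum>ks\<in>indices k r. mzeta (p - 1) ks) \<sim>\<^bsub>2\<^esub> (-1) ^ (r - 1) * of_nat (k choose r) * hcoeff 0 (p - 1) k"
    using assms by (intro sum_indices_zcong) auto
  also have "\<dots> \<sim>\<^bsub>2\<^esub> (-1) ^ (r - 1) * of_nat (k choose r) * (of_nat p * beta (Suc k))"
    by (intro zcong_scale[OF h] Zp_mult_left) auto
  finally show "(\<Sum>ks\<in>indices k r. mzeta (p - 1) ks) \<sim>\<^bsub>2\<^esub>
     (-1) ^ (r - 1) * of_nat (k choose r) / of_nat (k + 1) * (bernoulli (p - (k + 1)) * of_nat p)"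
    by (simp add: beta_def mult_ac)
  have "(\<Sum>ks\<in>indices k r. mzeta_star (p - 1) ks) \<sim>\<^bsub>2\<^esub> of_nat (k choose r) * hcoeff 0 (p - 1) k"
    using assms by (intro sum_indices_zcong) auto
  also have "\<dots> \<sim>\<^bsub>2\<^esub> of_nat (k choose r) * (of_nat p * beta (Suc k))"
    by (intro zcong_scale[OF h]) auto
  finally show "(\<Sum>ks\<in>indices k r. mzeta_star (p - 1) ks) \<sim>\<^bsub>2\<^esub>
     of_nat (k choose r) / of_nat (k + 1) * (bernoulli (p - (k + 1)) * of_nat p)"
    by (simp add: beta_def mult_ac)
qed

lemma sum_indices_zcong_3:
  assumes "odd k" "0 < r" "r \<le> k" "k + 5 \<le> p"
  shows "(\<Sum>ks\<in>indices k r. mzeta (p - 1) ks) \<sim>\<^bsub>3\<^esub>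
       (-1) ^ r * (of_nat (k + 1) / 2) * of_nat (k choose r) / of_nat (k + 2) *
        (bernoulli (p - (k + 2)) * of_nat p ^ 2)"
    and "(\<Sum>ks\<in>indices k r. mzeta_star (p - 1) ks) \<sim>\<^bsub>3\<^esub>
       - (of_nat (k + 1) / 2) * of_nat (k choose r) / of_nat (k + 2) *
        (bernoulli (p - (k + 2)) * of_nat p ^ 2)"
proof -
  let ?h = "- (of_nat (Suc k) / 2) * beta (k + 2) * of_nat p ^ 2"
  have h: "hcoeff 0 (p - 1) k \<sim>\<^bsub>3\<^esub> ?h"
    using assms by (intro hcoeff_odd_zcong) auto
  have sgn: "(-1) ^ r = - ((-1) ^ (r - 1) :: rat)" using assms by (cases r) auto
  have "(\<Sum>ks\<in>indices k r. mzeta (p - 1) ks) \<sim>\<^bsub>3\<^esub> (-1) ^ (r - 1) * of_nat (k choose r) * hcoeff 0 (p - 1) k"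
    using assms by (intro sum_indices_zcong) auto
  also have "\<dots> \<sim>\<^bsub>3\<^esub> (-1) ^ (r - 1) * of_nat (k choose r) * ?h"
    by (intro zcong_scale[OF h] Zp_mult_left) auto
  finally show "(\<Sum>ks\<in>indices k r. mzeta (p - 1) ks) \<sim>\<^bsub>3\<^esub>
     (-1) ^ r * (of_nat (k + 1) / 2) * of_nat (k choose r) / of_nat (k + 2) *
      (bernoulli (p - (k + 2)) * of_nat p ^ 2)"
    unfolding sgn by (simp add: beta_def mult_ac)
  have "(\<Sum>ks\<in>indices k r. mzeta_star (p - 1) ks) \<sim>\<^bsub>3\<^esub> of_nat (k choose r) * hcoeff 0 (p - 1) k"
    using assms by (intro sum_indices_zcong) auto
  also have "\<dots> \<sim>\<^bsub>3\<^esub> of_nat (k choose r) * ?h"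
    by (intro zcong_scale[OF h]) auto
  finally show "(\<Sum>ks\<in>indices k r. mzeta_star (p - 1) ks) \<sim>\<^bsub>3\<^esub>
     - (of_nat (k + 1) / 2) * of_nat (k choose r) / of_nat (k + 2) *
      (bernoulli (p - (k + 2)) * of_nat p ^ 2)"
    by (simp add: beta_def mult_ac)
qed

lemma coeff_marked_value:
  assumes "1 \<le> i" "i \<le> r"
  shows "of_int (a_coeff k r i) / 2 = marked_value k (i - 1) (r - i)"
    and "of_int (b_coeff k r i) / 2 = marked_value k (r - i) (i - 1)"
proof -
  have e: "r - 1 + 1 = r" and e': "i - 1 + (r - i) = r - 1" "r - i + (i - 1) = r - 1"
    using assms by auto
  show "of_int (a_coeff k r i) / 2 = marked_value k (i - 1) (r - i)"
    unfolding marked_value_def a_coeff_def e' e by simp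
  show "of_int (b_coeff k r i) / 2 = marked_value k (r - i) (i - 1)"
    unfolding marked_value_def b_coeff_def e' e by simp
qed

lemma sum_indices_at_zcong_2:
  assumes "even k" "1 \<le> i" "i \<le> r" "r < k" "k + 4 \<le> p"
  shows "(\<Sum>ks\<in>indices_at k r i. mzeta (p - 1) ks) \<sim>\<^bsub>2\<^esub>
      (-1) ^ (r - 1) * (of_int (a_coeff k r i) / 2) / of_nat (k + 1) * (bernoulli (p - (k + 1)) * of_nat p)"
    and "(\<Sum>ks\<in>indices_at k r i. mzeta_star (p - 1) ks) \<sim>\<^bsub>2\<^esub>
      of_int (b_coeff k r i) / 2 / of_nat (k + 1) * (bernoulli (p - (k + 1)) * of_nat p)"
  unfolding coeff_marked_value[OF assms(2,3)]
  using sum_indices_at_zcong[OF assms] by (simp_all add: beta_def mult_ac)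

lemma mzeta_Zp_0: "mzeta (p - 1) ks \<in> Zp 0" "mzeta_star (p - 1) ks \<in> Zp 0"
proof -
  have summand: "1 / (\<Prod>j<length ks. of_nat (ms ! j) ^ (ks ! j)) \<in> Zp 0"
    if ms: "length ms = length ks" "set ms \<subseteq> {1..p - 1}" for ms
  proof -
    have "1 / of_nat (ms ! j) ^ (ks ! j) \<in> Zp 0" if "j < length ks" for j
    proof (rule one_over_power_Zp)
      have "ms ! j \<in> set ms" using that ms(1) by (intro nth_mem) simp
      hence "ms ! j \<in> {1..p - 1}" using ms(2) by (rule rev_subsetD)
      thus "1 \<le> ms ! j" "ms ! j < p" using p_gt_0 by auto
    qed
    hence "(\<Prod>j<length ks. 1 / of_nat (ms ! j) ^ (ks ! j)) \<in> Zp 0" by (intro Zp_prod) simp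
    thus ?thesis by (simp add: prod_dividef)
  qed
  show "mzeta (p - 1) ks \<in> Zp 0"
    unfolding mzeta_def by (rule Zp_sum, rule summand) simp_all
  show "mzeta_star (p - 1) ks \<in> Zp 0"
    unfolding mzeta_star_def by (rule Zp_sum, rule summand) simp_all
qed

end

section \<open>Passage to the rings $\mathcal{A}_n$\<close>

lemma finite_small_primes:
  assumes "\<And>p. prime p \<Longrightarrow> P0 \<le> p \<Longrightarrow> \<not> Q p"
  shows "finite {p :: nat. prime p \<and> Q p}"
  by (rule finite_subset[of _ "{..<P0}"]) (use assms in \<open>auto simp: not_less[symmetric]\<close>)

lemma almost_integralI:
  assumes "\<And>p. prime p \<Longrightarrow> P0 \<le> p \<Longrightarrow> x p \<in> at_prime.Zp p 0"
  shows "almost_integral x"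
  unfolding almost_integral_def
proof (rule finite_small_primes)
  fix p assume p: "prime p" "P0 \<le> p"
  then interpret at_prime p by unfold_locales
  show "\<not> \<not> coprime (snd (quotient_of (x p))) (int p)"
    using Zp_0_coprime assms p by blast
qed

text \<open>
  Congruences at all large primes yield identities in $\mathcal{A}_n$; at the finitely many remaining
  primes the representatives may differ arbitrarily.
\<close>
lemma A_class_eqI:
  assumes "0 < n" "\<And>p. prime p \<Longrightarrow> P0 \<le> p \<Longrightarrow> x p \<in> at_prime.Zp p 0 \<and> at_prime.zcong p (x p) n (y p)"
  shows "A_class n x = A_class n y"
  unfolding A_class_eq_iff[OF assms(1)]
proof (rule finite_small_primes)
  fix p assume p: "prime p" "P0 \<le> p"
  then interpret at_prime p by unfold_locales
  have "rat_mod (int p ^ n) (y p) = rat_mod (int p ^ n) (x p)"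
    using assms(2)[OF p] by (intro rat_mod_eq_if_zcong) (auto intro: zcong_sym)
  thus "\<not> rat_mod (int p ^ n) (x p) \<noteq> rat_mod (int p ^ n) (y p)" by simp
qed

lemma A_class_zero:
  assumes "0 < n"
  shows "A_class n (\<lambda>_. 0) = \<zero>\<^bsub>A_ring n\<^esub>"
proof -
  interpret cring "A_ring n" using assms by (rule cring_A_ring)
  have "A_class n (\<lambda>_. 0) \<oplus>\<^bsub>A_ring n\<^esub> A_class n (\<lambda>_. 0) = A_class n (\<lambda>_. 0)"
    using A_class_add_mult(1)[OF assms almost_integral_const almost_integral_const, of 0 0] by simp
  thus ?thesis using A_class_closed[OF assms] by (simp add: add.l_cancel_one)
qed

text \<open>
  The sum in $\mathcal{A}_n$ may be computed with rational representatives.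
\<close>
lemma finsum_A_class:
  assumes "0 < n" "finite S" "\<And>ks p. prime p \<Longrightarrow> f ks p \<in> at_prime.Zp p 0"
  shows "(\<Oplus>\<^bsub>A_ring n\<^esub>ks\<in>S. A_class n (f ks)) = A_class n (\<lambda>p. \<Sum>ks\<in>S. f ks p)"
  using assms(2)
proof induction
  case empty
  interpret cring "A_ring n" using assms(1) by (rule cring_A_ring)
  show ?case using A_class_zero[OF assms(1)] by simp
next
  case (insert ks S)
  interpret cring "A_ring n" using assms(1) by (rule cring_A_ring)
  have "almost_integral (f ks)" using assms(3) by (rule almost_integralI)
  moreover have "almost_integral (\<lambda>p. \<Sum>ks\<in>S. f ks p)"
  proof (rule almost_integralI[of 0])
    fix p :: nat assume "prime p"
    then interpret at_prime p by unfold_locales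
    show "(\<Sum>ks\<in>S. f ks p) \<in> Zp 0" using assms(3) \<open>prime p\<close> by (intro Zp_sum)
  qed
  ultimately have "A_class n (\<lambda>p. f ks p + (\<Sum>ks\<in>S. f ks p)) =
      A_class n (f ks) \<oplus>\<^bsub>A_ring n\<^esub> A_class n (\<lambda>p. \<Sum>ks\<in>S. f ks p)"
    by (rule A_class_add_mult(1)[OF assms(1)])
  moreover have "(\<Oplus>\<^bsub>A_ring n\<^esub>ks\<in>insert ks S. A_class n (f ks)) =
      A_class n (f ks) \<oplus>\<^bsub>A_ring n\<^esub> (\<Oplus>\<^bsub>A_ring n\<^esub>ks\<in>S. A_class n (f ks))"
    using insert.hyps A_class_closed[OF assms(1)] by (intro finsum_insert) auto
  ultimately show ?case using insert by simp
qed

lemma A_scale_bernoulli: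
  assumes "0 < n" "2 \<le> m"
  shows "A_scale n q (bernoulli_A n m \<otimes>\<^bsub>A_ring n\<^esub> p_A n) = A_class n (\<lambda>p. q * (bernoulli (p - m) * of_nat p))"
    and "A_scale n q (bernoulli_A n m \<otimes>\<^bsub>A_ring n\<^esub> p_A n [^]\<^bsub>A_ring n\<^esub> (2::nat)) =
      A_class n (\<lambda>p. q * (bernoulli (p - m) * of_nat p ^ 2))"
proof -
  interpret cring "A_ring n" using assms(1) by (rule cring_A_ring)
  note mult = A_class_add_mult(2)[OF assms(1)]
  have B: "bernoulli (p - m) \<in> at_prime.Zp p 0" if "prime p" "m \<le> p" for p
  proof -
    interpret at_prime p using that by unfold_locales
    show ?thesis using that assms by (intro bernoulli_Zp) auto
  qed
  have int: "almost_integral (\<lambda>p. of_nat p ^ j)" "almost_integral (\<lambda>p. bernoulli (p - m))"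
    "almost_integral (\<lambda>p. bernoulli (p - m) * of_nat p ^ j)" for j
  proof -
    show "almost_integral (\<lambda>p. of_nat p ^ j)"
      by (rule almost_integralI) (metis at_prime.Zp_of_nat at_prime.intro of_nat_power)
    show "almost_integral (\<lambda>p. bernoulli (p - m))"
      using B by (rule almost_integralI)
    show "almost_integral (\<lambda>p. bernoulli (p - m) * of_nat p ^ j)"
    proof (rule almost_integralI[of m])
      fix p assume p: "prime p" "m \<le> p"
      then interpret at_prime p by unfold_locales
      show "bernoulli (p - m) * of_nat p ^ j \<in> Zp 0"
        using B[OF p] by (intro Zp_mult_left Zp_power Zp_of_nat)
    qed
  qed
  have p2: "p_A n [^]\<^bsub>A_ring n\<^esub> (2::nat) = A_class n (\<lambda>p. of_nat p ^ 2)"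
    using mult[OF int(1)[of 1] int(1)[of 1]] A_class_closed[OF assms(1)]
    by (simp add: p_A_def numeral_2_eq_2 nat_pow_def)
  show "A_scale n q (bernoulli_A n m \<otimes>\<^bsub>A_ring n\<^esub> p_A n) = A_class n (\<lambda>p. q * (bernoulli (p - m) * of_nat p))"
    using mult[OF almost_integral_const int(3)[of 1], of q] mult[OF int(2) int(1)[of 1]]
    by (simp add: A_scale_def bernoulli_A_def p_A_def)
  show "A_scale n q (bernoulli_A n m \<otimes>\<^bsub>A_ring n\<^esub> p_A n [^]\<^bsub>A_ring n\<^esub> (2::nat)) =
      A_class n (\<lambda>p. q * (bernoulli (p - m) * of_nat p ^ 2))"
    using mult[OF almost_integral_const int(3)[of 2], of q] mult[OF int(2) int(1)[of 2]]
    by (simp add: A_scale_def bernoulli_A_def p2)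
qed

lemma finsum_zeta_A:
  assumes "0 < n" "finite S"
    and "\<And>p. prime p \<Longrightarrow> P0 \<le> p \<Longrightarrow> at_prime.zcong p (\<Sum>ks\<in>S. mzeta (p - 1) ks) n (y p)"
  shows "(\<Oplus>\<^bsub>A_ring n\<^esub>ks\<in>S. zeta_A n ks) = A_class n y"
proof -
  have Zp: "mzeta (p - 1) ks \<in> at_prime.Zp p 0" if "prime p" for p ks
    using that by (intro at_prime.mzeta_Zp_0 at_prime.intro)
  have "(\<Oplus>\<^bsub>A_ring n\<^esub>ks\<in>S. zeta_A n ks) = A_class n (\<lambda>p. \<Sum>ks\<in>S. mzeta (p - 1) ks)"
    unfolding zeta_A_def by (intro finsum_A_class assms Zp)
  also have "\<dots> = A_class n y"
    using assms(3) Zp by (intro A_class_eqI[OF assms(1), of P0]) (auto intro!: at_prime.Zp_sum at_prime.intro)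
  finally show ?thesis .
qed

lemma finsum_zeta_A_star:
  assumes "0 < n" "finite S"
    and "\<And>p. prime p \<Longrightarrow> P0 \<le> p \<Longrightarrow> at_prime.zcong p (\<Sum>ks\<in>S. mzeta_star (p - 1) ks) n (y p)"
  shows "(\<Oplus>\<^bsub>A_ring n\<^esub>ks\<in>S. zeta_A_star n ks) = A_class n y"
proof -
  have Zp: "mzeta_star (p - 1) ks \<in> at_prime.Zp p 0" if "prime p" for p ks
    using that by (intro at_prime.mzeta_Zp_0 at_prime.intro)
  have "(\<Oplus>\<^bsub>A_ring n\<^esub>ks\<in>S. zeta_A_star n ks) = A_class n (\<lambda>p. \<Sum>ks\<in>S. mzeta_star (p - 1) ks)"
    unfolding zeta_A_star_def by (intro finsum_A_class assms Zp)
  also have "\<dots> = A_class n y"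
    using assms(3) Zp by (intro A_class_eqI[OF assms(1), of P0]) (auto intro!: at_prime.Zp_sum at_prime.intro)
  finally show ?thesis .
qed

theorem theorem2p5:
  fixes k r :: nat
  assumes "0 < k" and "0 < r" and "r \<le> k"
  shows
    "((\<Oplus>\<^bsub>A_ring 2\<^esub>ks\<in>indices k r. zeta_A 2 ks) =
        A_scale 2 ((-1) ^ (r - 1) * of_nat (k choose r) / of_nat (k + 1))
          (bernoulli_A 2 (k + 1) \<otimes>\<^bsub>A_ring 2\<^esub> p_A 2)
      \<and>
      (\<Oplus>\<^bsub>A_ring 2\<^esub>ks\<in>indices k r. zeta_A_star 2 ks) =
        A_scale 2 (of_nat (k choose r) / of_nat (k + 1))
          (bernoulli_A 2 (k + 1) \<otimes>\<^bsub>A_ring 2\<^esub> p_A 2))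
     \<and>
     (odd k \<longrightarrow>
      (\<Oplus>\<^bsub>A_ring 3\<^esub>ks\<in>indices k r. zeta_A 3 ks) =
        A_scale 3 ((-1) ^ r * (of_nat (k + 1) / 2) * of_nat (k choose r) / of_nat (k + 2))
          (bernoulli_A 3 (k + 2) \<otimes>\<^bsub>A_ring 3\<^esub> p_A 3 [^]\<^bsub>A_ring 3\<^esub> (2::nat))
      \<and>
      (\<Oplus>\<^bsub>A_ring 3\<^esub>ks\<in>indices k r. zeta_A_star 3 ks) =
        A_scale 3 (- (of_nat (k + 1) / 2) * of_nat (k choose r) / of_nat (k + 2))
          (bernoulli_A 3 (k + 2) \<otimes>\<^bsub>A_ring 3\<^esub> p_A 3 [^]\<^bsub>A_ring 3\<^esub> (2::nat)))
     \<and>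
     (\<forall>i. 1 \<le> i \<and> i \<le> r \<and> even k \<and> r < k \<longrightarrow>
      (\<Oplus>\<^bsub>A_ring 2\<^esub>ks\<in>indices_at k r i. zeta_A 2 ks) =
        A_scale 2 ((-1) ^ (r - 1) * (of_int (a_coeff k r i) / 2) / of_nat (k + 1))
          (bernoulli_A 2 (k + 1) \<otimes>\<^bsub>A_ring 2\<^esub> p_A 2)
      \<and>
      (\<Oplus>\<^bsub>A_ring 2\<^esub>ks\<in>indices_at k r i. zeta_A_star 2 ks) =
        A_scale 2 (of_int (b_coeff k r i) / 2 / of_nat (k + 1))
          (bernoulli_A 2 (k + 1) \<otimes>\<^bsub>A_ring 2\<^esub> p_A 2))"
proof (intro conjI impI allI)
  have m: "2 \<le> k + 1" "2 \<le> k + 2" using assms by auto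
  note scale2 = A_scale_bernoulli(1)[OF zero_less_numeral m(1)]
  note scale3 = A_scale_bernoulli(2)[OF zero_less_numeral m(2)]
  show "(\<Oplus>\<^bsub>A_ring 2\<^esub>ks\<in>indices k r. zeta_A 2 ks) =
        A_scale 2 ((-1) ^ (r - 1) * of_nat (k choose r) / of_nat (k + 1))
          (bernoulli_A 2 (k + 1) \<otimes>\<^bsub>A_ring 2\<^esub> p_A 2)"
    unfolding scale2
    by (intro finsum_zeta_A at_prime.sum_indices_zcong_2 at_prime.intro finite_indices assms zero_less_numeral)
  show "(\<Oplus>\<^bsub>A_ring 2\<^esub>ks\<in>indices k r. zeta_A_star 2 ks) =
        A_scale 2 (of_nat (k choose r) / of_nat (k + 1))
          (bernoulli_A 2 (k + 1) \<otimes>\<^bsub>A_ring 2\<^esub> p_A 2)"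
    unfolding scale2
    by (intro finsum_zeta_A_star at_prime.sum_indices_zcong_2 at_prime.intro finite_indices assms zero_less_numeral)
  show "(\<Oplus>\<^bsub>A_ring 3\<^esub>ks\<in>indices k r. zeta_A 3 ks) =
        A_scale 3 ((-1) ^ r * (of_nat (k + 1) / 2) * of_nat (k choose r) / of_nat (k + 2))
          (bernoulli_A 3 (k + 2) \<otimes>\<^bsub>A_ring 3\<^esub> p_A 3 [^]\<^bsub>A_ring 3\<^esub> (2::nat))" if "odd k"
    unfolding scale3
    by (intro finsum_zeta_A at_prime.sum_indices_zcong_3 at_prime.intro finite_indices assms that zero_less_numeral)
  show "(\<Oplus>\<^bsub>A_ring 3\<^esub>ks\<in>indices k r. zeta_A_star 3 ks) =
        A_scale 3 (- (of_nat (k + 1) / 2) * of_nat (k choose r) / of_nat (k + 2))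
          (bernoulli_A 3 (k + 2) \<otimes>\<^bsub>A_ring 3\<^esub> p_A 3 [^]\<^bsub>A_ring 3\<^esub> (2::nat))" if "odd k"
    unfolding scale3
    by (intro finsum_zeta_A_star at_prime.sum_indices_zcong_3 at_prime.intro finite_indices assms that zero_less_numeral)
  fix i assume i: "1 \<le> i \<and> i \<le> r \<and> even k \<and> r < k"
  hence i': "even k" "1 \<le> i" "i \<le> r" "r < k" by simp_all
  show "(\<Oplus>\<^bsub>A_ring 2\<^esub>ks\<in>indices_at k r i. zeta_A 2 ks) =
        A_scale 2 ((-1) ^ (r - 1) * (of_int (a_coeff k r i) / 2) / of_nat (k + 1))
          (bernoulli_A 2 (k + 1) \<otimes>\<^bsub>A_ring 2\<^esub> p_A 2)"
    unfolding scale2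
    by (intro finsum_zeta_A at_prime.sum_indices_at_zcong_2 at_prime.intro finite_indices_at i' zero_less_numeral)
  show "(\<Oplus>\<^bsub>A_ring 2\<^esub>ks\<in>indices_at k r i. zeta_A_star 2 ks) =
        A_scale 2 (of_int (b_coeff k r i) / 2 / of_nat (k + 1))
          (bernoulli_A 2 (k + 1) \<otimes>\<^bsub>A_ring 2\<^esub> p_A 2)"
    unfolding scale2
    by (intro finsum_zeta_A_star at_prime.sum_indices_at_zcong_2 at_prime.intro finite_indices_at i' zero_less_numeral)
qed

end
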